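(* (a) Let $V$ be a crossed module, $M$ an abelian $\pi_0(V)$-module, and $z^3\in Z^3_{\mathrm{cpt}}(\pi_0(V),\pi_1(V))$ a componentwise pointed $3$-cocycle whose class in $H^3_{\mathrm{cpt}}(\pi_0(V),\pi_1(V))$ equals the first Postnikov invariant $k^3(V)$. Then \[H^2(V,M)\cong H^2\big((\pi_0(V),\pi_1(V),z^3),M\big)=Z^2/B^2,\] where $Z^2=\{(\varphi,c)\in \operatorname{Hom}_{\pi_0(V)}(\pi_1(V),M)\times C^2_{\mathrm{cpt}}(\pi_0(V),M)\;:\;\varphi\circ z^3=dc\}$ and $B^2=\{0\}\times B^2_{\mathrm{cpt}}(\pi_0(V),M)$. (b) Let $G$ be a simplicial group, $M$ an abelian $\pi_0(G)$-module, and $z^3\in Z^3_{\mathrm{cpt}}(\pi_0(G),\pi_1(G))$ a componentwise pointed $3$-cocycle whose class equals the first Postnikov invariant $k^3(G)$. Then \[H^2(G,M)\cong H^2\big((\pi_0(G),\pi_1(G),z^3),M\big).\]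
   Context: Group cohomology conventions: for a group $\Pi$ and abelian $\Pi$-module $A$ (written additively; if $A$ is written multiplicatively read $0$ as $1$), $C^n(\Pi,A)=\mathrm{Map}(\Pi^n,A)$ with differential $(dc)(g_n,\dots,g_0)=c(g_n,\dots,g_1)+\sum_{k=1}^n(-1)^k c(g_n,\dots,g_{k+1},g_kg_{k-1},g_{k-2},\dots,g_0)+(-1)^{n+1}g_n\cdot c(g_{n-1},\dots,g_0)$; $Z^n,B^n,H^n$ are cocycles, coboundaries, cohomology (this computes ordinary group cohomology). A cochain is componentwise pointed if it vanishes whenever some argument equals $1$; $C^n_{\mathrm{cpt}}$ denotes these, $Z^n_{\mathrm{cpt}}=Z^n\cap C^n_{\mathrm{cpt}}$, $B^n_{\mathrm{cpt}}=B^n\cap C^n_{\mathrm{cpt}}$, $H^n_{\mathrm{cpt}}=Z^n_{\mathrm{cpt}}/B^n_{\mathrm{cpt}}$. Crossed modules: a crossed module $V$ is a group $G_V$, a group $M_V$ with a left action of $G_V$ by automorphisms $(g,m)\mapsto {}^gm$, and a homomorphism $\mu:M_V\to G_V$ with $\mu({}^gm)=g\mu(m)g^{-1}$ and ${}^{\mu(n)}m=nmn^{-1}$. $\pi_0(V):=G_V/\mu(M_V)$, $\pi_1(V):=\ker\mu$ (central, abelian, a $\pi_0(V)$-module via the induced action; written multiplicatively). For $g\in G_V$, $\bar g$ is its class in $\pi_0(V)$. For an abelian $\pi_0(V)$-module $M$, the cohomology $H^n(V,M)$ is defined as the cohomology of the simplicial group $\mathrm{Cosk}_1V$ (the nerve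 of the associated categorical group); in low degrees its cochain complex is: $C^0(V,M)=M$, $C^1(V,M)=\mathrm{Map}(G_V,M)$, $C^2(V,M)=\mathrm{Map}(M_V\times G_V\times G_V,M)$, $C^3(V,M)=\mathrm{Map}(M_V\times M_V\times G_V\times M_V\times G_V\times G_V,M)$ with $(dc)(g)=c-\bar g\cdot c$, $(dc)(m,h,g)=c(\mu(m)h)-c(hg)+\bar h\cdot c(g)$, $(dc)(p,n,k,m,h,g)=c(p,\mu(n)k,\mu(m)h)-c(pn,k,hg)+c(n\,{}^km,kh,g)-\bar k\cdot c(m,h,g)$. Simplicial groups: $G$ has groups $G_n$, faces $d_k:G_n\to G_{n-1}$, degeneracies $s_k:G_n\to G_{n+1}$. Moore complex $N_0G=G_0$, $N_nG=\bigcap_{k=1}^n\ker d_k$, differential $d_0$; $B_nNG:=d_0(N_{n+1}G)$ (normal in $G_n$); $\pi_0(G)=G_0/B_0NG$, $\pi_n(G)=(N_nG\cap\ker d_0)/B_nNG$. For $g\in G_n$ let $\langle g\rangle\in\pi_0(G)$ be the class of $d_1d_2\cdots d_n(g)$. For an abelian $\pi_0(G)$-module $M$: $C^n(G,M)=\mathrm{Map}(G_{n-1}\times\cdots\times G_0,M)$ with $(dc)(g_n,\dots,g_0)=c(d_0g_n,\dots,d_0g_1)+\sum_{k=1}^n(-1)^kc(d_kg_n,\dots,d_kg_{k+1},(d_kg_k)g_{k-1},g_{k-2},\dots,g_0)+(-1)^{n+1}\langle g_n\rangle\cdot c(g_{n-1},\dots,g_0)$, and $H^n(G,M)$ its cohomology.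 The crossed module segment $T^1G$: group part $G_0$, module part $N_1G/B_1NG$, $\mu(xB_1NG)=d_0x$, action ${}^g(xB_1NG)=s_0(g)xs_0(g)^{-1}B_1NG$; one has $\pi_i(T^1G)=\pi_i(G)$ for $i=0,1$. Postnikov invariant: for a crossed module $V$, choose a map $s^0:\pi_0(V)\to G_V$ with $s^0(1)=1$ and $\overline{s^0(p)}=p$, and a map $s^1:\mu(M_V)\to M_V$ with $s^1(1)=1$, $\mu\circ s^1=\mathrm{id}$. Put $Z^2(q,p)=s^1(s^0(q)s^0(p)s^0(qp)^{-1})$ and $z^3_V(r,q,p)=Z^2(r,q)Z^2(rq,p)Z^2(r,qp)^{-1}({}^{s^0(r)}Z^2(q,p))^{-1}\in\pi_1(V)$. Then $z^3_V\in Z^3_{\mathrm{cpt}}(\pi_0(V),\pi_1(V))$ and its class $k^3(V)$ is independent of choices; $k^3(G):=k^3(T^1G)$ for a simplicial group $G$. *)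

theory Defs
  imports "HOL-Algebra.Algebra"
begin

definition is_module :: "('p,'x) monoid_scheme \<Rightarrow> ('a,'y) monoid_scheme \<Rightarrow> ('p \<Rightarrow> 'a \<Rightarrow> 'a) \<Rightarrow> bool" where
  "is_module P A act \<longleftrightarrow> group P \<and> comm_group A
     \<and> (\<forall>p\<in>carrier P. \<forall>a\<in>carrier A. act p a \<in> carrier A)
     \<and> (\<forall>p\<in>carrier P. \<forall>a\<in>carrier A. \<forall>b\<in>carrier A. act p (a \<otimes>\<^bsub>A\<^esub> b) = act p a \<otimes>\<^bsub>A\<^esub> act p b)
     \<and> (\<forall>a\<in>carrier A. act \<one>\<^bsub>P\<^esub> a = a)
     \<and> (\<forall>p\<in>carrier P. \<forall>q\<in>carrier P. \<forall>a\<in>carrier A. act (p \<otimes>\<^bsub>P\<^esub> q) a = act p (act q a))"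

definition fun_group :: "'s set \<Rightarrow> ('a,'y) monoid_scheme \<Rightarrow> ('s \<Rightarrow> 'a) monoid" where
  "fun_group S A = \<lparr>carrier = S \<rightarrow>\<^sub>E carrier A,
                    monoid.mult = (\<lambda>f g. \<lambda>x\<in>S. f x \<otimes>\<^bsub>A\<^esub> g x),
                    one = (\<lambda>x\<in>S. \<one>\<^bsub>A\<^esub>)\<rparr>"

text \<open>C^1 = Map(P,A), C^2 = Map(P^2,A), C^3 = Map(P^3,A); tuples (g_n,...,g_0).\<close>
definition C1 :: "('p,'x) monoid_scheme \<Rightarrow> ('a,'y) monoid_scheme \<Rightarrow> ('p \<Rightarrow> 'a) monoid" where
  "C1 P A = fun_group (carrier P) A"
definition C2 :: "('p,'x) monoid_scheme \<Rightarrow> ('a,'y) monoid_scheme \<Rightarrow> ('p \<times> 'p \<Rightarrow> 'a) monoid" where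
  "C2 P A = fun_group (carrier P \<times> carrier P) A"
definition C3 :: "('p,'x) monoid_scheme \<Rightarrow> ('a,'y) monoid_scheme \<Rightarrow> ('p \<times> 'p \<times> 'p \<Rightarrow> 'a) monoid" where
  "C3 P A = fun_group (carrier P \<times> carrier P \<times> carrier P) A"

definition dg1 :: "('p,'x) monoid_scheme \<Rightarrow> ('a,'y) monoid_scheme \<Rightarrow> ('p \<Rightarrow> 'a \<Rightarrow> 'a) \<Rightarrow> ('p \<Rightarrow> 'a) \<Rightarrow> ('p \<times> 'p \<Rightarrow> 'a)" where
  "dg1 P A act c = (\<lambda>(g1,g0)\<in>carrier P \<times> carrier P.
      c g1 \<otimes>\<^bsub>A\<^esub> inv\<^bsub>A\<^esub> c (g1 \<otimes>\<^bsub>P\<^esub> g0) \<otimes>\<^bsub>A\<^esub> act g1 (c g0))"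

definition dg2 :: "('p,'x) monoid_scheme \<Rightarrow> ('a,'y) monoid_scheme \<Rightarrow> ('p \<Rightarrow> 'a \<Rightarrow> 'a) \<Rightarrow> ('p \<times> 'p \<Rightarrow> 'a) \<Rightarrow> ('p \<times> 'p \<times> 'p \<Rightarrow> 'a)" where
  "dg2 P A act c = (\<lambda>(g2,g1,g0)\<in>carrier P \<times> carrier P \<times> carrier P.
      c (g2,g1) \<otimes>\<^bsub>A\<^esub> inv\<^bsub>A\<^esub> c (g2, g1 \<otimes>\<^bsub>P\<^esub> g0) \<otimes>\<^bsub>A\<^esub> c (g2 \<otimes>\<^bsub>P\<^esub> g1, g0)
        \<otimes>\<^bsub>A\<^esub> inv\<^bsub>A\<^esub> act g2 (c (g1,g0)))"

definition dg3 :: "('p,'x) monoid_scheme \<Rightarrow> ('a,'y) monoid_scheme \<Rightarrow> ('p \<Rightarrow> 'a \<Rightarrow> 'a) \<Rightarrow> ('p \<times> 'p \<times> 'p \<Rightarrow> 'a) \<Rightarrow> ('p \<times> 'p \<times> 'p \<times> 'p \<Rightarrow> 'a)" where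
  "dg3 P A act c = (\<lambda>(g3,g2,g1,g0)\<in>carrier P \<times> carrier P \<times> carrier P \<times> carrier P.
      c (g3,g2,g1) \<otimes>\<^bsub>A\<^esub> inv\<^bsub>A\<^esub> c (g3,g2, g1 \<otimes>\<^bsub>P\<^esub> g0) \<otimes>\<^bsub>A\<^esub> c (g3, g2 \<otimes>\<^bsub>P\<^esub> g1, g0)
        \<otimes>\<^bsub>A\<^esub> inv\<^bsub>A\<^esub> c (g3 \<otimes>\<^bsub>P\<^esub> g2, g1, g0) \<otimes>\<^bsub>A\<^esub> act g3 (c (g2,g1,g0)))"

definition cpt2 :: "('p,'x) monoid_scheme \<Rightarrow> ('a,'y) monoid_scheme \<Rightarrow> ('p \<times> 'p \<Rightarrow> 'a) \<Rightarrow> bool" where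
  "cpt2 P A c \<longleftrightarrow> (\<forall>g1\<in>carrier P. \<forall>g0\<in>carrier P.
      (g1 = \<one>\<^bsub>P\<^esub> \<or> g0 = \<one>\<^bsub>P\<^esub>) \<longrightarrow> c (g1,g0) = \<one>\<^bsub>A\<^esub>)"
definition cpt3 :: "('p,'x) monoid_scheme \<Rightarrow> ('a,'y) monoid_scheme \<Rightarrow> ('p \<times> 'p \<times> 'p \<Rightarrow> 'a) \<Rightarrow> bool" where
  "cpt3 P A c \<longleftrightarrow> (\<forall>g2\<in>carrier P. \<forall>g1\<in>carrier P. \<forall>g0\<in>carrier P.
      (g2 = \<one>\<^bsub>P\<^esub> \<or> g1 = \<one>\<^bsub>P\<^esub> \<or> g0 = \<one>\<^bsub>P\<^esub>) \<longrightarrow> c (g2,g1,g0) = \<one>\<^bsub>A\<^esub>)"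

definition C2cpt :: "('p,'x) monoid_scheme \<Rightarrow> ('a,'y) monoid_scheme \<Rightarrow> ('p \<times> 'p \<Rightarrow> 'a) set" where
  "C2cpt P A = {c \<in> carrier (C2 P A). cpt2 P A c}"

definition B2cpt :: "('p,'x) monoid_scheme \<Rightarrow> ('a,'y) monoid_scheme \<Rightarrow> ('p \<Rightarrow> 'a \<Rightarrow> 'a) \<Rightarrow> ('p \<times> 'p \<Rightarrow> 'a) set" where
  "B2cpt P A act = {c \<in> dg1 P A act ` carrier (C1 P A). cpt2 P A c}"

definition Z3cpt :: "('p,'x) monoid_scheme \<Rightarrow> ('a,'y) monoid_scheme \<Rightarrow> ('p \<Rightarrow> 'a \<Rightarrow> 'a) \<Rightarrow> ('p \<times> 'p \<times> 'p \<Rightarrow> 'a) set" where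
  "Z3cpt P A act = {c \<in> carrier (C3 P A). cpt3 P A c \<and> dg3 P A act c = \<one>\<^bsub>fun_group (carrier P \<times> carrier P \<times> carrier P \<times> carrier P) A\<^esub>}"

definition B3cpt :: "('p,'x) monoid_scheme \<Rightarrow> ('a,'y) monoid_scheme \<Rightarrow> ('p \<Rightarrow> 'a \<Rightarrow> 'a) \<Rightarrow> ('p \<times> 'p \<times> 'p \<Rightarrow> 'a) set" where
  "B3cpt P A act = {c \<in> dg2 P A act ` carrier (C2 P A). cpt3 P A c}"

definition H3cpt_class :: "('p,'x) monoid_scheme \<Rightarrow> ('a,'y) monoid_scheme \<Rightarrow> ('p \<Rightarrow> 'a \<Rightarrow> 'a) \<Rightarrow> ('p \<times> 'p \<times> 'p \<Rightarrow> 'a) \<Rightarrow> ('p \<times> 'p \<times> 'p \<Rightarrow> 'a) set" where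
  "H3cpt_class P A act z = B3cpt P A act #>\<^bsub>C3 P A\<^esub> z"

definition HomP :: "('p,'x) monoid_scheme \<Rightarrow> ('a,'y) monoid_scheme \<Rightarrow> ('p \<Rightarrow> 'a \<Rightarrow> 'a)
     \<Rightarrow> ('b,'z) monoid_scheme \<Rightarrow> ('p \<Rightarrow> 'b \<Rightarrow> 'b) \<Rightarrow> ('a \<Rightarrow> 'b) set" where
  "HomP P A actA M actM = {\<phi> \<in> carrier A \<rightarrow>\<^sub>E carrier M. \<phi> \<in> hom A M \<and>
      (\<forall>p\<in>carrier P. \<forall>a\<in>carrier A. \<phi> (actA p a) = actM p (\<phi> a))}"

definition Z2_triple :: "('p,'x) monoid_scheme \<Rightarrow> ('a,'y) monoid_scheme \<Rightarrow> ('p \<Rightarrow> 'a \<Rightarrow> 'a)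
     \<Rightarrow> ('p \<times> 'p \<times> 'p \<Rightarrow> 'a) \<Rightarrow> ('b,'z) monoid_scheme \<Rightarrow> ('p \<Rightarrow> 'b \<Rightarrow> 'b) \<Rightarrow> (('a \<Rightarrow> 'b) \<times> ('p \<times> 'p \<Rightarrow> 'b)) set" where
  "Z2_triple P A actA z M actM = {(\<phi>, c). \<phi> \<in> HomP P A actA M actM \<and> c \<in> C2cpt P M \<and>
      (\<lambda>x\<in>carrier P \<times> carrier P \<times> carrier P. \<phi> (z x)) = dg2 P M actM c}"

definition B2_triple :: "('p,'x) monoid_scheme \<Rightarrow> ('a,'y) monoid_scheme
     \<Rightarrow> ('b,'z) monoid_scheme \<Rightarrow> ('p \<Rightarrow> 'b \<Rightarrow> 'b) \<Rightarrow> (('a \<Rightarrow> 'b) \<times> ('p \<times> 'p \<Rightarrow> 'b)) set" where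
  "B2_triple P A M actM = {\<one>\<^bsub>fun_group (carrier A) M\<^esub>} \<times> B2cpt P M actM"

definition H2_triple :: "('p,'x) monoid_scheme \<Rightarrow> ('a,'y) monoid_scheme \<Rightarrow> ('p \<Rightarrow> 'a \<Rightarrow> 'a)
     \<Rightarrow> ('p \<times> 'p \<times> 'p \<Rightarrow> 'a) \<Rightarrow> ('b,'z) monoid_scheme \<Rightarrow> ('p \<Rightarrow> 'b \<Rightarrow> 'b)
     \<Rightarrow> (('a \<Rightarrow> 'b) \<times> ('p \<times> 'p \<Rightarrow> 'b)) set monoid" where
  "H2_triple P A actA z M actM =
     ((fun_group (carrier A) M \<times>\<times> C2 P M)\<lparr>carrier := Z2_triple P A actA z M actM\<rparr>)
       Mod B2_triple P A M actM"

record ('g,'m) xmod =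
  xG :: "'g monoid"
  xM :: "'m monoid"
  xact :: "'g \<Rightarrow> 'm \<Rightarrow> 'm"
  xmu :: "'m \<Rightarrow> 'g"

definition crossed_module :: "('g,'m) xmod \<Rightarrow> bool" where
  "crossed_module V \<longleftrightarrow> group (xG V) \<and> group (xM V)
     \<and> (\<forall>g\<in>carrier (xG V). \<forall>m\<in>carrier (xM V). xact V g m \<in> carrier (xM V))
     \<and> (\<forall>g\<in>carrier (xG V). \<forall>m\<in>carrier (xM V). \<forall>n\<in>carrier (xM V).
          xact V g (m \<otimes>\<^bsub>xM V\<^esub> n) = xact V g m \<otimes>\<^bsub>xM V\<^esub> xact V g n)
     \<and> (\<forall>m\<in>carrier (xM V). xact V \<one>\<^bsub>xG V\<^esub> m = m)
     \<and> (\<forall>g\<in>carrier (xG V). \<forall>h\<in>carrier (xG V). \<forall>m\<in>carrier (xM V).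
          xact V (g \<otimes>\<^bsub>xG V\<^esub> h) m = xact V g (xact V h m))
     \<and> xmu V \<in> hom (xM V) (xG V)
     \<and> (\<forall>g\<in>carrier (xG V). \<forall>m\<in>carrier (xM V).
          xmu V (xact V g m) = g \<otimes>\<^bsub>xG V\<^esub> xmu V m \<otimes>\<^bsub>xG V\<^esub> inv\<^bsub>xG V\<^esub> g)
     \<and> (\<forall>m\<in>carrier (xM V). \<forall>n\<in>carrier (xM V).
          xact V (xmu V n) m = n \<otimes>\<^bsub>xM V\<^esub> m \<otimes>\<^bsub>xM V\<^esub> inv\<^bsub>xM V\<^esub> n)"

definition xpi0 :: "('g,'m) xmod \<Rightarrow> 'g set monoid" where
  "xpi0 V = xG V Mod (xmu V ` carrier (xM V))"

definition xcls :: "('g,'m) xmod \<Rightarrow> 'g \<Rightarrow> 'g set" where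
  "xcls V g = (xmu V ` carrier (xM V)) #>\<^bsub>xG V\<^esub> g"

definition xpi1 :: "('g,'m) xmod \<Rightarrow> 'm monoid" where
  "xpi1 V = (xM V)\<lparr>carrier := kernel (xM V) (xG V) (xmu V)\<rparr>"

definition xpi1_act :: "('g,'m) xmod \<Rightarrow> 'g set \<Rightarrow> 'm \<Rightarrow> 'm" where
  "xpi1_act V p m = xact V (SOME g. g \<in> p) m"

definition xC1 :: "('g,'m) xmod \<Rightarrow> ('a,'y) monoid_scheme \<Rightarrow> ('g \<Rightarrow> 'a) monoid" where
  "xC1 V M = fun_group (carrier (xG V)) M"
definition xC2 :: "('g,'m) xmod \<Rightarrow> ('a,'y) monoid_scheme \<Rightarrow> ('m \<times> 'g \<times> 'g \<Rightarrow> 'a) monoid" where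
  "xC2 V M = fun_group (carrier (xM V) \<times> carrier (xG V) \<times> carrier (xG V)) M"

definition xd1 :: "('g,'m) xmod \<Rightarrow> ('a,'y) monoid_scheme \<Rightarrow> ('g set \<Rightarrow> 'a \<Rightarrow> 'a) \<Rightarrow> ('g \<Rightarrow> 'a) \<Rightarrow> ('m \<times> 'g \<times> 'g \<Rightarrow> 'a)" where
  "xd1 V M act c = (\<lambda>(m,h,g)\<in>carrier (xM V) \<times> carrier (xG V) \<times> carrier (xG V).
      c (xmu V m \<otimes>\<^bsub>xG V\<^esub> h) \<otimes>\<^bsub>M\<^esub> inv\<^bsub>M\<^esub> c (h \<otimes>\<^bsub>xG V\<^esub> g) \<otimes>\<^bsub>M\<^esub> act (xcls V h) (c g))"

definition xd2 :: "('g,'m) xmod \<Rightarrow> ('a,'y) monoid_scheme \<Rightarrow> ('g set \<Rightarrow> 'a \<Rightarrow> 'a) \<Rightarrow> ('m \<times> 'g \<times> 'g \<Rightarrow> 'a)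
     \<Rightarrow> ('m \<times> 'm \<times> 'g \<times> 'm \<times> 'g \<times> 'g \<Rightarrow> 'a)" where
  "xd2 V M act c = (\<lambda>(p,n,k,m,h,g)\<in>carrier (xM V) \<times> carrier (xM V) \<times> carrier (xG V)
                                     \<times> carrier (xM V) \<times> carrier (xG V) \<times> carrier (xG V).
      c (p, xmu V n \<otimes>\<^bsub>xG V\<^esub> k, xmu V m \<otimes>\<^bsub>xG V\<^esub> h)
      \<otimes>\<^bsub>M\<^esub> inv\<^bsub>M\<^esub> c (p \<otimes>\<^bsub>xM V\<^esub> n, k, h \<otimes>\<^bsub>xG V\<^esub> g)
      \<otimes>\<^bsub>M\<^esub> c (n \<otimes>\<^bsub>xM V\<^esub> xact V k m, k \<otimes>\<^bsub>xG V\<^esub> h, g)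
      \<otimes>\<^bsub>M\<^esub> inv\<^bsub>M\<^esub> act (xcls V k) (c (m,h,g)))"

definition xZ2 :: "('g,'m) xmod \<Rightarrow> ('a,'y) monoid_scheme \<Rightarrow> ('g set \<Rightarrow> 'a \<Rightarrow> 'a) \<Rightarrow> ('m \<times> 'g \<times> 'g \<Rightarrow> 'a) set" where
  "xZ2 V M act = {c \<in> carrier (xC2 V M).
     xd2 V M act c = \<one>\<^bsub>fun_group (carrier (xM V) \<times> carrier (xM V) \<times> carrier (xG V)
                                     \<times> carrier (xM V) \<times> carrier (xG V) \<times> carrier (xG V)) M\<^esub>}"

definition xB2 :: "('g,'m) xmod \<Rightarrow> ('a,'y) monoid_scheme \<Rightarrow> ('g set \<Rightarrow> 'a \<Rightarrow> 'a) \<Rightarrow> ('m \<times> 'g \<times> 'g \<Rightarrow> 'a) set" where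
  "xB2 V M act = xd1 V M act ` carrier (xC1 V M)"

definition xH2 :: "('g,'m) xmod \<Rightarrow> ('a,'y) monoid_scheme \<Rightarrow> ('g set \<Rightarrow> 'a \<Rightarrow> 'a) \<Rightarrow> ('m \<times> 'g \<times> 'g \<Rightarrow> 'a) set monoid" where
  "xH2 V M act = ((xC2 V M)\<lparr>carrier := xZ2 V M act\<rparr>) Mod xB2 V M act"

definition postnikov_sections :: "('g,'m) xmod \<Rightarrow> ('g set \<Rightarrow> 'g) \<Rightarrow> ('g \<Rightarrow> 'm) \<Rightarrow> bool" where
  "postnikov_sections V s0 s1 \<longleftrightarrow>
     (\<forall>p\<in>carrier (xpi0 V). s0 p \<in> carrier (xG V) \<and> xcls V (s0 p) = p)
     \<and> s0 \<one>\<^bsub>xpi0 V\<^esub> = \<one>\<^bsub>xG V\<^esub>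
     \<and> (\<forall>y\<in>xmu V ` carrier (xM V). s1 y \<in> carrier (xM V) \<and> xmu V (s1 y) = y)
     \<and> s1 \<one>\<^bsub>xG V\<^esub> = \<one>\<^bsub>xM V\<^esub>"

definition postnikov_Z2 :: "('g,'m) xmod \<Rightarrow> ('g set \<Rightarrow> 'g) \<Rightarrow> ('g \<Rightarrow> 'm) \<Rightarrow> 'g set \<Rightarrow> 'g set \<Rightarrow> 'm" where
  "postnikov_Z2 V s0 s1 q p =
     s1 (s0 q \<otimes>\<^bsub>xG V\<^esub> s0 p \<otimes>\<^bsub>xG V\<^esub> inv\<^bsub>xG V\<^esub> s0 (q \<otimes>\<^bsub>xpi0 V\<^esub> p))"

definition postnikov_z3 :: "('g,'m) xmod \<Rightarrow> ('g set \<Rightarrow> 'g) \<Rightarrow> ('g \<Rightarrow> 'm) \<Rightarrow> ('g set \<times> 'g set \<times> 'g set \<Rightarrow> 'm)" where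
  "postnikov_z3 V s0 s1 = (\<lambda>(r,q,p)\<in>carrier (xpi0 V) \<times> carrier (xpi0 V) \<times> carrier (xpi0 V).
      postnikov_Z2 V s0 s1 r q \<otimes>\<^bsub>xM V\<^esub> postnikov_Z2 V s0 s1 (r \<otimes>\<^bsub>xpi0 V\<^esub> q) p
      \<otimes>\<^bsub>xM V\<^esub> inv\<^bsub>xM V\<^esub> postnikov_Z2 V s0 s1 r (q \<otimes>\<^bsub>xpi0 V\<^esub> p)
      \<otimes>\<^bsub>xM V\<^esub> inv\<^bsub>xM V\<^esub> xact V (s0 r) (postnikov_Z2 V s0 s1 q p))"

text \<open>k^3(V): the class of z^3_V for some (any) admissible choice of sections.\<close>
definition k3 :: "('g,'m) xmod \<Rightarrow> ('g set \<times> 'g set \<times> 'g set \<Rightarrow> 'm) set" where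
  "k3 V = (let s = (SOME s. postnikov_sections V (fst s) (snd s))
           in H3cpt_class (xpi0 V) (xpi1 V) (xpi1_act V) (postnikov_z3 V (fst s) (snd s)))"

text \<open>sgrp n = G_n; sface n i : G_n \<rightarrow> G_(n-1) (0 \<le> i \<le> n); sdeg n j : G_n \<rightarrow> G_(n+1) (0 \<le> j \<le> n).
  All levels live in one HOL type 'g.\<close>
record 'g sgroup =
  sgrp :: "nat \<Rightarrow> 'g monoid"
  sface :: "nat \<Rightarrow> nat \<Rightarrow> 'g \<Rightarrow> 'g"
  sdeg :: "nat \<Rightarrow> nat \<Rightarrow> 'g \<Rightarrow> 'g"

definition simplicial_group :: "'g sgroup \<Rightarrow> bool" where
  "simplicial_group S \<longleftrightarrow>
     (\<forall>n. group (sgrp S n))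
     \<and> (\<forall>n. \<forall>i\<le>Suc n. sface S (Suc n) i \<in> hom (sgrp S (Suc n)) (sgrp S n))
     \<and> (\<forall>n. \<forall>j\<le>n. sdeg S n j \<in> hom (sgrp S n) (sgrp S (Suc n)))
     \<comment> \<open>d_i d_j = d_(j-1) d_i for i < j\<close>
     \<and> (\<forall>n i j. i < j \<and> j \<le> Suc (Suc n) \<longrightarrow> (\<forall>x\<in>carrier (sgrp S (Suc (Suc n))).
          sface S (Suc n) i (sface S (Suc (Suc n)) j x) = sface S (Suc n) (j - 1) (sface S (Suc (Suc n)) i x)))
     \<comment> \<open>d_i s_j = s_(j-1) d_i for i < j\<close>
     \<and> (\<forall>n i j. i < j \<and> j \<le> Suc n \<longrightarrow> (\<forall>x\<in>carrier (sgrp S (Suc n)).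
          sface S (Suc (Suc n)) i (sdeg S (Suc n) j x) = sdeg S n (j - 1) (sface S (Suc n) i x)))
     \<comment> \<open>d_j s_j = id = d_(j+1) s_j\<close>
     \<and> (\<forall>n j. j \<le> n \<longrightarrow> (\<forall>x\<in>carrier (sgrp S n).
          sface S (Suc n) j (sdeg S n j x) = x \<and> sface S (Suc n) (Suc j) (sdeg S n j x) = x))
     \<comment> \<open>d_i s_j = s_j d_(i-1) for i > j+1\<close>
     \<and> (\<forall>n i j. Suc j < i \<and> i \<le> Suc (Suc n) \<longrightarrow> (\<forall>x\<in>carrier (sgrp S (Suc n)).
          sface S (Suc (Suc n)) i (sdeg S (Suc n) j x) = sdeg S n j (sface S (Suc n) (i - 1) x)))
     \<comment> \<open>s_i s_j = s_(j+1) s_i for i \<le> j\<close>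
     \<and> (\<forall>n i j. i \<le> j \<and> j \<le> n \<longrightarrow> (\<forall>x\<in>carrier (sgrp S n).
          sdeg S (Suc n) i (sdeg S n j x) = sdeg S (Suc n) (Suc j) (sdeg S n i x)))"

definition N1 :: "'g sgroup \<Rightarrow> 'g set" where
  "N1 S = {x \<in> carrier (sgrp S 1). sface S 1 1 x = \<one>\<^bsub>sgrp S 0\<^esub>}"
definition N2 :: "'g sgroup \<Rightarrow> 'g set" where
  "N2 S = {x \<in> carrier (sgrp S 2). sface S 2 1 x = \<one>\<^bsub>sgrp S 1\<^esub> \<and> sface S 2 2 x = \<one>\<^bsub>sgrp S 1\<^esub>}"
definition BN0 :: "'g sgroup \<Rightarrow> 'g set" where
  "BN0 S = sface S 1 0 ` N1 S"
definition BN1 :: "'g sgroup \<Rightarrow> 'g set" where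
  "BN1 S = sface S 2 0 ` N2 S"

definition spi0 :: "'g sgroup \<Rightarrow> 'g set monoid" where
  "spi0 S = sgrp S 0 Mod BN0 S"
definition spi1 :: "'g sgroup \<Rightarrow> 'g set monoid" where
  "spi1 S = ((sgrp S 1)\<lparr>carrier := {x \<in> N1 S. sface S 1 0 x = \<one>\<^bsub>sgrp S 0\<^esub>}\<rparr>) Mod BN1 S"

definition T1 :: "'g sgroup \<Rightarrow> ('g, 'g set) xmod" where
  "T1 S = \<lparr> xG = sgrp S 0,
            xM = ((sgrp S 1)\<lparr>carrier := N1 S\<rparr>) Mod BN1 S,
            xact = (\<lambda>g C. BN1 S #>\<^bsub>sgrp S 1\<^esub>
                       (sdeg S 0 0 g \<otimes>\<^bsub>sgrp S 1\<^esub> (SOME x. x \<in> C) \<otimes>\<^bsub>sgrp S 1\<^esub> inv\<^bsub>sgrp S 1\<^esub> sdeg S 0 0 g)),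
            xmu = (\<lambda>C. sface S 1 0 (SOME x. x \<in> C)) \<rparr>"

text \<open>action of pi_0(G) on pi_1(G), induced via T^1G (pi_i(T^1G) = pi_i(G))\<close>
definition spi1_act :: "'g sgroup \<Rightarrow> 'g set \<Rightarrow> 'g set \<Rightarrow> 'g set" where
  "spi1_act S p C = xact (T1 S) (SOME g. g \<in> p) C"

definition scls1 :: "'g sgroup \<Rightarrow> 'g \<Rightarrow> 'g set" where
  "scls1 S g = BN0 S #>\<^bsub>sgrp S 0\<^esub> sface S 1 1 g"
definition scls2 :: "'g sgroup \<Rightarrow> 'g \<Rightarrow> 'g set" where
  "scls2 S g = BN0 S #>\<^bsub>sgrp S 0\<^esub> sface S 1 1 (sface S 2 2 g)"

definition sC1 :: "'g sgroup \<Rightarrow> ('a,'y) monoid_scheme \<Rightarrow> ('g \<Rightarrow> 'a) monoid" where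
  "sC1 S M = fun_group (carrier (sgrp S 0)) M"
definition sC2 :: "'g sgroup \<Rightarrow> ('a,'y) monoid_scheme \<Rightarrow> ('g \<times> 'g \<Rightarrow> 'a) monoid" where
  "sC2 S M = fun_group (carrier (sgrp S 1) \<times> carrier (sgrp S 0)) M"

definition sd1 :: "'g sgroup \<Rightarrow> ('a,'y) monoid_scheme \<Rightarrow> ('g set \<Rightarrow> 'a \<Rightarrow> 'a) \<Rightarrow> ('g \<Rightarrow> 'a) \<Rightarrow> ('g \<times> 'g \<Rightarrow> 'a)" where
  "sd1 S M act c = (\<lambda>(g1,g0)\<in>carrier (sgrp S 1) \<times> carrier (sgrp S 0).
      c (sface S 1 0 g1) \<otimes>\<^bsub>M\<^esub> inv\<^bsub>M\<^esub> c (sface S 1 1 g1 \<otimes>\<^bsub>sgrp S 0\<^esub> g0)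
      \<otimes>\<^bsub>M\<^esub> act (scls1 S g1) (c g0))"

definition sd2 :: "'g sgroup \<Rightarrow> ('a,'y) monoid_scheme \<Rightarrow> ('g set \<Rightarrow> 'a \<Rightarrow> 'a) \<Rightarrow> ('g \<times> 'g \<Rightarrow> 'a) \<Rightarrow> ('g \<times> 'g \<times> 'g \<Rightarrow> 'a)" where
  "sd2 S M act c = (\<lambda>(g2,g1,g0)\<in>carrier (sgrp S 2) \<times> carrier (sgrp S 1) \<times> carrier (sgrp S 0).
      c (sface S 2 0 g2, sface S 1 0 g1)
      \<otimes>\<^bsub>M\<^esub> inv\<^bsub>M\<^esub> c (sface S 2 1 g2, sface S 1 1 g1 \<otimes>\<^bsub>sgrp S 0\<^esub> g0)
      \<otimes>\<^bsub>M\<^esub> c (sface S 2 2 g2 \<otimes>\<^bsub>sgrp S 1\<^esub> g1, g0)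
      \<otimes>\<^bsub>M\<^esub> inv\<^bsub>M\<^esub> act (scls2 S g2) (c (g1,g0)))"

definition sZ2 :: "'g sgroup \<Rightarrow> ('a,'y) monoid_scheme \<Rightarrow> ('g set \<Rightarrow> 'a \<Rightarrow> 'a) \<Rightarrow> ('g \<times> 'g \<Rightarrow> 'a) set" where
  "sZ2 S M act = {c \<in> carrier (sC2 S M).
     sd2 S M act c = \<one>\<^bsub>fun_group (carrier (sgrp S 2) \<times> carrier (sgrp S 1) \<times> carrier (sgrp S 0)) M\<^esub>}"
definition sB2 :: "'g sgroup \<Rightarrow> ('a,'y) monoid_scheme \<Rightarrow> ('g set \<Rightarrow> 'a \<Rightarrow> 'a) \<Rightarrow> ('g \<times> 'g \<Rightarrow> 'a) set" where
  "sB2 S M act = sd1 S M act ` carrier (sC1 S M)"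

definition sH2 :: "'g sgroup \<Rightarrow> ('a,'y) monoid_scheme \<Rightarrow> ('g set \<Rightarrow> 'a \<Rightarrow> 'a) \<Rightarrow> ('g \<times> 'g \<Rightarrow> 'a) set monoid" where
  "sH2 S M act = ((sC2 S M)\<lparr>carrier := sZ2 S M act\<rparr>) Mod sB2 S M act"

end

theory Submission
  imports Defs
begin

text \<open>
  After absorbing a coboundary, the given \<open>z\<close> is exactly the nonabelian coboundary of some pointed
  \<open>Z : \<pi>\<^sub>0\<^sup>2 \<rightarrow> M\<^sub>V\<close> lifting the failure of a section \<open>s : \<pi>\<^sub>0 \<rightarrow> G\<^sub>V\<close> to be multiplicative. Writing every
  \<open>g = \<mu>(\<sigma> g) s([g])\<close>, each triple \<open>(m,h,g)\<close> has a defect in \<open>\<pi>\<^sub>1\<close>, and its \<open>V\<close>-coboundary is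
  \<open>z([k],[h],[g])\<close>. Hence \<open>(\<phi>,c) \<mapsto> c([h],[g]) - \<phi>(defect m h g)\<close> takes \<open>Z\<^sup>2\<close> of the triple to cocycles of
  \<open>V\<close>. Conversely, a cocycle \<open>f\<close> of \<open>V\<close> determines \<open>\<phi>(a) = f(a,1,1)\<close>, and after subtracting a coboundary
  \<open>f + \<phi>(defect)\<close> depends on the classes \<open>[h],[g]\<close> only.

  For a simplicial group, a \<open>2\<close>-cocycle is automatically invariant under \<open>B\<^sub>1NG\<close> in its first argument,
  so that pulling back along \<open>G\<^sub>1 \<rightarrow> (N\<^sub>1G/B\<^sub>1NG) \<times> G\<^sub>0\<close> identifies the cocycles of \<open>T\<^sup>1G\<close> with those of
  \<open>G\<close>, and likewise the coboundaries.
\<close>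

section \<open>Abelian groups, modules and cochains\<close>

text \<open>The comparison runs from the triple to \<open>V\<close> because in that direction it is
  an explicit homomorphism on cocycles; in the other direction a coboundary must be subtracted
  before anything descends to classes. It then suffices that a pair goes to a coboundary exactly
  when it lies in \<open>B2_triple\<close>, and that every cocycle is reached up to a coboundary.
  The obstacle is that \<open>Z\<close> satisfies a cocycle identity only up to \<open>z\<close>,
  inside a nonabelian group. Centrality of pi_1 allows defects to be pulled out of any product; what
  is left is rearranged by the Peiffer identity. The normalisations at 1 matter just as much: the
  return direction consists of putting 1 into cocycle identities, where a pointed \<open>z\<close>
  makes the twist disappear. For simplicial groups the comparison is the identity in degree 1 and
  bijective on 2-cocycles. A general 2-cochain on \<open>G1\<close> and \<open>G0\<close> has no
  reason to be invariant under B_1NG, so the invariance has to be extracted from the cocycle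
  identity.\<close>

lemma (in group) inv_cancel_left: "x \<in> carrier G \<Longrightarrow> y \<in> carrier G \<Longrightarrow> inv x \<otimes> (x \<otimes> y) = y"
  by (metis inv_closed l_inv l_one m_assoc)

lemma (in group) cancel_inv_left: "x \<in> carrier G \<Longrightarrow> y \<in> carrier G \<Longrightarrow> x \<otimes> (inv x \<otimes> y) = y"
  by (metis inv_closed r_inv l_one m_assoc)

lemmas (in comm_group) comm_group_simprules [algebra comm_group "one G" "monoid.mult G" "m_inv G"] =
  m_closed inv_closed one_closed l_one r_one m_assoc m_comm m_lcomm l_inv r_inv
  inv_cancel_left cancel_inv_left inv_inv inv_one inv_mult

lemma (in group) eqI_div: "x \<in> carrier G \<Longrightarrow> y \<in> carrier G \<Longrightarrow> x \<otimes> inv y = \<one> \<Longrightarrow> x = y"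
  by (metis inv_closed inv_equality inv_inv)

text \<open>The cancellation behind dd = 0: six values, each occurring twice with opposite signs. It
  serves both \<open>dg2_dg1\<close> and \<open>xd2_xd1\<close>, which differ only in what the six
  values are.\<close>

lemma (in comm_group) alternating_telescope:
  assumes [intro, simp]: "a \<in> carrier G" "b \<in> carrier G" "c \<in> carrier G" "d \<in> carrier G" "e \<in> carrier G" "f \<in> carrier G"
  shows "a \<otimes> inv b \<otimes> c \<otimes> inv (a \<otimes> inv d \<otimes> e) \<otimes> (b \<otimes> inv d \<otimes> f) \<otimes> inv (c \<otimes> inv e \<otimes> f) = \<one>"
  using assms by algebra

lemma (in comm_group) alternating3_mult:
  assumes "a \<in> carrier G" "b \<in> carrier G" "c \<in> carrier G"
    "a' \<in> carrier G" "b' \<in> carrier G" "c' \<in> carrier G"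
  shows "(a \<otimes> a') \<otimes> inv (b \<otimes> b') \<otimes> (c \<otimes> c') = (a \<otimes> inv b \<otimes> c) \<otimes> (a' \<otimes> inv b' \<otimes> c')"
  using assms by algebra

lemma (in comm_group) alternating4_mult:
  assumes "a \<in> carrier G" "b \<in> carrier G" "c \<in> carrier G" "d \<in> carrier G"
    "a' \<in> carrier G" "b' \<in> carrier G" "c' \<in> carrier G" "d' \<in> carrier G"
  shows "(a \<otimes> a') \<otimes> inv (b \<otimes> b') \<otimes> (c \<otimes> c') \<otimes> inv (d \<otimes> d')
    = (a \<otimes> inv b \<otimes> c \<otimes> inv d) \<otimes> (a' \<otimes> inv b' \<otimes> c' \<otimes> inv d')"
  using assms by algebra

lemma fun_group_carrier: "carrier (fun_group S A) = S \<rightarrow>\<^sub>E carrier A"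
  and fun_group_mult: "f \<otimes>\<^bsub>fun_group S A\<^esub> g = (\<lambda>x\<in>S. f x \<otimes>\<^bsub>A\<^esub> g x)"
  and fun_group_one: "\<one>\<^bsub>fun_group S A\<^esub> = (\<lambda>x\<in>S. \<one>\<^bsub>A\<^esub>)"
  by (simp_all add: fun_group_def)

lemma fun_group_comm_group:
  assumes "comm_group A"
  shows "comm_group (fun_group S A)"
proof -
  interpret comm_group A by fact
  show ?thesis
  proof (rule comm_groupI)
    fix f assume f: "f \<in> carrier (fun_group S A)"
    have "(\<lambda>x\<in>S. inv\<^bsub>A\<^esub> f x) \<in> carrier (fun_group S A)"
      using f by (auto simp: fun_group_carrier)
    moreover have "(\<lambda>x\<in>S. inv\<^bsub>A\<^esub> f x) \<otimes>\<^bsub>fun_group S A\<^esub> f = \<one>\<^bsub>fun_group S A\<^esub>"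
      using f by (auto simp: fun_group_carrier fun_group_mult fun_group_one fun_eq_iff PiE_iff)
    ultimately show "\<exists>g\<in>carrier (fun_group S A). g \<otimes>\<^bsub>fun_group S A\<^esub> f = \<one>\<^bsub>fun_group S A\<^esub>"
      by blast
  next
    fix f assume f: "f \<in> carrier (fun_group S A)"
    show "\<one>\<^bsub>fun_group S A\<^esub> \<otimes>\<^bsub>fun_group S A\<^esub> f = f"
      using f by (auto simp: fun_group_carrier fun_group_mult fun_group_one fun_eq_iff PiE_iff extensional_def)
  next
    fix f g h
    assume "f \<in> carrier (fun_group S A)" "g \<in> carrier (fun_group S A)" "h \<in> carrier (fun_group S A)"
    then show "f \<otimes>\<^bsub>fun_group S A\<^esub> g \<otimes>\<^bsub>fun_group S A\<^esub> h
        = f \<otimes>\<^bsub>fun_group S A\<^esub> (g \<otimes>\<^bsub>fun_group S A\<^esub> h)"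
      by (auto simp: fun_group_carrier fun_group_mult fun_eq_iff m_assoc PiE_iff)
  next
    fix f g
    assume "f \<in> carrier (fun_group S A)" "g \<in> carrier (fun_group S A)"
    then show "f \<otimes>\<^bsub>fun_group S A\<^esub> g = g \<otimes>\<^bsub>fun_group S A\<^esub> f"
      by (auto simp: fun_group_carrier fun_group_mult fun_eq_iff m_comm PiE_iff)
  qed (auto simp: fun_group_carrier fun_group_mult fun_group_one)
qed

lemma fun_group_inv:
  assumes "comm_group A" "f \<in> carrier (fun_group S A)"
  shows "inv\<^bsub>fun_group S A\<^esub> f = (\<lambda>x\<in>S. inv\<^bsub>A\<^esub> f x)"
proof -
  interpret A: comm_group A by fact
  interpret F: comm_group "fun_group S A" by (rule fun_group_comm_group) fact
  show ?thesis
    using assms(2)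
    by (intro F.inv_equality) (auto simp: fun_group_carrier fun_group_mult fun_group_one fun_eq_iff PiE_iff)
qed

lemma fun_group_homI:
  assumes "\<And>f x. f \<in> carrier (fun_group S A) \<Longrightarrow> x \<in> T \<Longrightarrow> d f x \<in> carrier A"
    and "\<And>f. f \<in> carrier (fun_group S A) \<Longrightarrow> d f \<in> extensional T"
    and "\<And>f g x. f \<in> carrier (fun_group S A) \<Longrightarrow> g \<in> carrier (fun_group S A) \<Longrightarrow> x \<in> T
      \<Longrightarrow> d (f \<otimes>\<^bsub>fun_group S A\<^esub> g) x = d f x \<otimes>\<^bsub>A\<^esub> d g x"
    and "comm_group A"
  shows "d \<in> hom (fun_group S A) (fun_group T A)"
proof (rule homI)
  interpret F: comm_group "fun_group S A" by (rule fun_group_comm_group) fact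
  fix f assume f: "f \<in> carrier (fun_group S A)"
  then show "d f \<in> carrier (fun_group T A)"
    using assms(1,2) by (auto simp: fun_group_carrier PiE_def)
  fix g assume g: "g \<in> carrier (fun_group S A)"
  show "d (f \<otimes>\<^bsub>fun_group S A\<^esub> g) = d f \<otimes>\<^bsub>fun_group T A\<^esub> d g"
    unfolding fun_group_mult[of T]
    by (rule extensionalityI[of _ T]) (use f g assms(2,3) in auto)
qed

text \<open>First isomorphism theorem for the composite of \<open>h\<close> with the projection
  modulo \<open>B'\<close>. The point of this form is that \<open>h\<close> itself need be onto only
  up to elements of \<open>B'\<close>; it is applied both to the triple and to simplicial
  cocycles.\<close>

lemma quotient_isoI:
  assumes A: "comm_group A" and B: "comm_group B" and B': "subgroup B' B"
    and h: "h \<in> hom A B"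
    and A': "A' = {a \<in> carrier A. h a \<in> B'}"
    and onto: "\<And>b. b \<in> carrier B \<Longrightarrow> \<exists>a\<in>carrier A. \<exists>b'\<in>B'. b = b' \<otimes>\<^bsub>B\<^esub> h a"
  shows "B Mod B' \<cong> A Mod A'"
proof -
  interpret A: comm_group A by fact
  interpret B: comm_group B by fact
  interpret N: normal B' B using B' by (simp add: B.normal_iff_subgroup)
  let ?k = "\<lambda>a. B' #>\<^bsub>B\<^esub> h a"
  have hc: "\<And>a. a \<in> carrier A \<Longrightarrow> h a \<in> carrier B" using h by (auto simp: hom_def)
  have "?k \<in> hom A (B Mod B')"
    using h by (auto simp: hom_def FactGroup_def N.rcos_sum B.rcosetsI N.subset Pi_iff)
  then interpret k: group_hom A "B Mod B'" ?k
    by (simp add: group_hom_def group_hom_axioms_def N.factorgroup_is_group)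
  have "kernel A (B Mod B') ?k = A'"
    using hc A' B.coset_join2[OF _ B'] B.coset_join1[OF _ _ B']
    by (auto simp: kernel_def)
  moreover have "?k ` carrier A = carrier (B Mod B')"
  proof -
    have "U \<in> ?k ` carrier A" if "U \<in> carrier (B Mod B')" for U
    proof -
      from that obtain b where b: "b \<in> carrier B" "U = B' #>\<^bsub>B\<^esub> b"
        by (auto simp: carrier_FactGroup)
      then obtain a b' where a: "a \<in> carrier A" "b' \<in> B'" "b = b' \<otimes>\<^bsub>B\<^esub> h a"
        using onto by blast
      then have "U = ?k a"
        using b by (metis B.coset_join2 B.coset_mult_assoc B' N.mem_carrier N.subset hc)
      then show ?thesis using a by blast
    qed
    then show ?thesis using k.hom_closed by blast
  qed
  ultimately have "A Mod A' \<cong> B Mod B'"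
    using k.FactGroup_iso by simp
  moreover have "group (A Mod A')"
    using k.normal_kernel \<open>kernel A (B Mod B') ?k = A'\<close> normal.factorgroup_is_group by metis
  ultimately show ?thesis by (simp add: group.iso_sym)
qed

section \<open>Modules over a group and their cochains in degrees 1 to 3\<close>

locale gmodule =
  fixes P :: "('p,'x) monoid_scheme" and A :: "('a,'y) monoid_scheme" and act :: "'p \<Rightarrow> 'a \<Rightarrow> 'a"
  assumes mod: "is_module P A act"
begin

sublocale P: group P using mod by (simp add: is_module_def)
sublocale A: comm_group A using mod by (simp add: is_module_def)

lemma act_closed [simp, intro]: "p \<in> carrier P \<Longrightarrow> a \<in> carrier A \<Longrightarrow> act p a \<in> carrier A"
  and act_mult: "p \<in> carrier P \<Longrightarrow> a \<in> carrier A \<Longrightarrow> b \<in> carrier A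
    \<Longrightarrow> act p (a \<otimes>\<^bsub>A\<^esub> b) = act p a \<otimes>\<^bsub>A\<^esub> act p b"
  and act_id: "a \<in> carrier A \<Longrightarrow> act \<one>\<^bsub>P\<^esub> a = a"
  and act_comp: "p \<in> carrier P \<Longrightarrow> q \<in> carrier P \<Longrightarrow> a \<in> carrier A
    \<Longrightarrow> act (p \<otimes>\<^bsub>P\<^esub> q) a = act p (act q a)"
  using mod by (auto simp: is_module_def)

lemma act_hom: "p \<in> carrier P \<Longrightarrow> act p \<in> hom A A"
  by (auto simp: hom_def act_mult)

lemma act_one [simp]: "p \<in> carrier P \<Longrightarrow> act p \<one>\<^bsub>A\<^esub> = \<one>\<^bsub>A\<^esub>"
  using hom_one[OF act_hom] A.is_group by blast

lemma act_inv: "p \<in> carrier P \<Longrightarrow> a \<in> carrier A \<Longrightarrow> act p (inv\<^bsub>A\<^esub> a) = inv\<^bsub>A\<^esub> act p a"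
  using group_hom.hom_inv[of A A "act p" a] act_hom
  by (simp add: group_hom_def group_hom_axioms_def)

lemmas act_simps = act_mult act_inv act_id act_comp

lemma fun_closed: "f \<in> carrier (fun_group S A) \<Longrightarrow> x \<in> S \<Longrightarrow> f x \<in> carrier A"
  by (auto simp: fun_group_carrier)

lemma dg1_hom: "dg1 P A act \<in> hom (C1 P A) (C2 P A)"
  unfolding C1_def C2_def
proof (rule fun_group_homI)
  fix f g x
  assume fg: "f \<in> carrier (fun_group (carrier P) A)" "g \<in> carrier (fun_group (carrier P) A)"
    and x: "x \<in> carrier P \<times> carrier P"
  note [simp] = fun_closed[OF fg(1)] fun_closed[OF fg(2)]
  show "dg1 P A act (f \<otimes>\<^bsub>fun_group (carrier P) A\<^esub> g) x = dg1 P A act f x \<otimes>\<^bsub>A\<^esub> dg1 P A act g x"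
    using x by (auto simp: dg1_def fun_group_mult act_mult intro!: A.alternating3_mult)
qed (auto simp: dg1_def fun_closed A.comm_group_axioms)

lemma dg2_hom: "dg2 P A act \<in> hom (C2 P A) (C3 P A)"
  unfolding C2_def C3_def
proof (rule fun_group_homI)
  let ?S = "carrier P \<times> carrier P"
  fix f g x
  assume fg: "f \<in> carrier (fun_group ?S A)" "g \<in> carrier (fun_group ?S A)"
    and x: "x \<in> carrier P \<times> carrier P \<times> carrier P"
  note [simp] = fun_closed[OF fg(1)] fun_closed[OF fg(2)]
  show "dg2 P A act (f \<otimes>\<^bsub>fun_group ?S A\<^esub> g) x = dg2 P A act f x \<otimes>\<^bsub>A\<^esub> dg2 P A act g x"
    using x by (auto simp: dg2_def fun_group_mult act_mult intro!: A.alternating4_mult)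
qed (auto simp: dg2_def fun_closed A.comm_group_axioms)

lemma C2_group: "comm_group (C2 P A)"
  and C3_group: "comm_group (C3 P A)"
  by (simp_all add: C2_def C3_def fun_group_comm_group A.comm_group_axioms)

lemma dg2_dg1:
  assumes "b \<in> carrier (C1 P A)"
  shows "dg2 P A act (dg1 P A act b) = \<one>\<^bsub>C3 P A\<^esub>"
proof (rule ext)
  fix x
  have b: "\<And>g. g \<in> carrier P \<Longrightarrow> b g \<in> carrier A" using assms by (auto simp: C1_def fun_group_carrier)
  show "dg2 P A act (dg1 P A act b) x = \<one>\<^bsub>C3 P A\<^esub> x"
  proof (cases "x \<in> carrier P \<times> carrier P \<times> carrier P")
    case True
    then obtain r q p where x: "x = (r,q,p)" and [simp]: "r \<in> carrier P" "q \<in> carrier P" "p \<in> carrier P"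
      by auto
    have [simp]: "b r \<in> carrier A" "b q \<in> carrier A" "b p \<in> carrier A"
      "b (r \<otimes>\<^bsub>P\<^esub> q) \<in> carrier A" "b (q \<otimes>\<^bsub>P\<^esub> p) \<in> carrier A"
      "b (r \<otimes>\<^bsub>P\<^esub> (q \<otimes>\<^bsub>P\<^esub> p)) \<in> carrier A" by (auto intro!: b)
    have [simp]: "act r (act q (b p)) \<in> carrier A" "act r (b q) \<in> carrier A"
      "act r (b (q \<otimes>\<^bsub>P\<^esub> p)) \<in> carrier A"  by auto
    have "dg2 P A act (dg1 P A act b) x =
       b r \<otimes>\<^bsub>A\<^esub> inv\<^bsub>A\<^esub> b (r \<otimes>\<^bsub>P\<^esub> q) \<otimes>\<^bsub>A\<^esub> act r (b q) \<otimes>\<^bsub>A\<^esub>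
       inv\<^bsub>A\<^esub> (b r \<otimes>\<^bsub>A\<^esub> inv\<^bsub>A\<^esub> b (r \<otimes>\<^bsub>P\<^esub> (q \<otimes>\<^bsub>P\<^esub> p)) \<otimes>\<^bsub>A\<^esub> act r (b (q \<otimes>\<^bsub>P\<^esub> p))) \<otimes>\<^bsub>A\<^esub>
       (b (r \<otimes>\<^bsub>P\<^esub> q) \<otimes>\<^bsub>A\<^esub> inv\<^bsub>A\<^esub> b (r \<otimes>\<^bsub>P\<^esub> (q \<otimes>\<^bsub>P\<^esub> p)) \<otimes>\<^bsub>A\<^esub> act r (act q (b p))) \<otimes>\<^bsub>A\<^esub>
       inv\<^bsub>A\<^esub> (act r (b q) \<otimes>\<^bsub>A\<^esub> inv\<^bsub>A\<^esub> act r (b (q \<otimes>\<^bsub>P\<^esub> p)) \<otimes>\<^bsub>A\<^esub> act r (act q (b p)))"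
      by (simp add: x dg2_def dg1_def act_simps P.m_assoc)
    also have "\<dots> = \<one>\<^bsub>A\<^esub>"
      by (rule A.alternating_telescope) (auto intro!: b)
    finally show ?thesis by (simp add: C3_def fun_group_one x)
  qed (auto simp: dg2_def C3_def fun_group_one)
qed

text \<open>Membership in \<open>B3cpt\<close> makes the coboundary pointed, not the cochain that it
  comes from, yet the lift of the Postnikov cocycle may only be modified by a pointed cochain.
  Vanishing of dc at (1,1,g) and (g,1,1) leaves c(1,1) - c(1,g) and c(g,1) - g c(1,1), so all
  degenerate values of c are governed by c(1,1).\<close>

lemma B3cpt_pointed_preimage:
  assumes "b \<in> B3cpt P A act"
  obtains c where "c \<in> C2cpt P A" "dg2 P A act c = b"
proof -
  from assms obtain c where c: "c \<in> carrier (C2 P A)" and b: "b = dg2 P A act c" and bp: "cpt3 P A b"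
    by (auto simp: B3cpt_def)
  have cc: "\<And>q p. q \<in> carrier P \<Longrightarrow> p \<in> carrier P \<Longrightarrow> c (q,p) \<in> carrier A"
    using c by (auto simp: C2_def fun_group_carrier)
  define e where "e = c (\<one>\<^bsub>P\<^esub>,\<one>\<^bsub>P\<^esub>)"
  have e: "e \<in> carrier A" by (simp add: e_def cc)
  have c1: "c (\<one>\<^bsub>P\<^esub>, g) = e" if g: "g \<in> carrier P" for g
  proof -
    have "dg2 P A act c (\<one>\<^bsub>P\<^esub>, \<one>\<^bsub>P\<^esub>, g) = \<one>\<^bsub>A\<^esub>"
      using bp g by (auto simp: b cpt3_def)
    then have "e \<otimes>\<^bsub>A\<^esub> inv\<^bsub>A\<^esub> c (\<one>\<^bsub>P\<^esub>, g) \<otimes>\<^bsub>A\<^esub> c (\<one>\<^bsub>P\<^esub>, g) \<otimes>\<^bsub>A\<^esub> inv\<^bsub>A\<^esub> c (\<one>\<^bsub>P\<^esub>, g) = \<one>\<^bsub>A\<^esub>"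
      using g by (simp add: dg2_def act_id cc e_def)
    then show ?thesis using g e
      by - (rule A.eqI_div[symmetric], simp_all add: cc A.m_assoc)
  qed
  have c2: "c (g, \<one>\<^bsub>P\<^esub>) = act g e" if g: "g \<in> carrier P" for g
  proof -
    have "dg2 P A act c (g, \<one>\<^bsub>P\<^esub>, \<one>\<^bsub>P\<^esub>) = \<one>\<^bsub>A\<^esub>"
      using bp g by (auto simp: b cpt3_def)
    then have "c (g, \<one>\<^bsub>P\<^esub>) \<otimes>\<^bsub>A\<^esub> inv\<^bsub>A\<^esub> c (g, \<one>\<^bsub>P\<^esub>) \<otimes>\<^bsub>A\<^esub> c (g, \<one>\<^bsub>P\<^esub>) \<otimes>\<^bsub>A\<^esub> inv\<^bsub>A\<^esub> act g e = \<one>\<^bsub>A\<^esub>"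
      using g by (simp add: dg2_def e_def)
    then show ?thesis using g e
      by - (rule A.eqI_div, simp_all add: cc)
  qed
  \<comment> \<open>By \<open>c1\<close> and \<open>c2\<close>, \<open>c\<close> agrees with the coboundary of the constant \<open>e\<close> on degenerate pairs.\<close>
  define k where "k = (\<lambda>g\<in>carrier P. inv\<^bsub>A\<^esub> e)"
  have k: "k \<in> carrier (C1 P A)" using e by (auto simp: k_def C1_def fun_group_carrier)
  define c' where "c' = c \<otimes>\<^bsub>C2 P A\<^esub> dg1 P A act k"
  have dk: "dg1 P A act k \<in> carrier (C2 P A)" using dg1_hom k by (auto simp: hom_def)
  interpret C2: comm_group "C2 P A" by (rule C2_group)
  interpret C3: comm_group "C3 P A" by (rule C3_group)
  have "dg2 P A act c' = b"
    using dg2_hom c dk dg2_dg1[OF k] by (simp add: c'_def hom_mult b hom_in_carrier[of _ "C2 P A"])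
  moreover have "c' (q,p) = \<one>\<^bsub>A\<^esub>"
    if "q \<in> carrier P" "p \<in> carrier P" "q = \<one>\<^bsub>P\<^esub> \<or> p = \<one>\<^bsub>P\<^esub>" for q p
    using that e
    by (auto simp: c'_def C2_def fun_group_mult dg1_def k_def c1 c2 act_simps)
  moreover have "c' \<in> carrier (C2 P A)" using c dk by (simp add: c'_def)
  ultimately show ?thesis
    by (intro that) (auto simp: C2cpt_def cpt2_def)
qed

end

section \<open>Crossed modules\<close>

locale xmodule =
  fixes V :: "('g,'m) xmod"
  assumes crossed: "crossed_module V"
begin

abbreviation "G \<equiv> xG V"
abbreviation "N \<equiv> xM V"
abbreviation "\<mu> \<equiv> xmu V"
abbreviation "I \<equiv> \<mu> ` carrier N"
abbreviation "P \<equiv> xpi0 V"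
abbreviation "A \<equiv> xpi1 V"
abbreviation "cl \<equiv> xcls V"
abbreviation gmult (infixl \<open>\<cdot>\<close> 70) where "g \<cdot> h \<equiv> g \<otimes>\<^bsub>xG V\<^esub> h"
abbreviation nmult (infixl \<open>\<bullet>\<close> 70) where "m \<bullet> n \<equiv> m \<otimes>\<^bsub>xM V\<^esub> n"
abbreviation xaction (infixr \<open>\<triangleright>\<close> 75) where "g \<triangleright> m \<equiv> xact V g m"

sublocale G: group "xG V" using crossed by (simp add: crossed_module_def)
sublocale N: group "xM V" using crossed by (simp add: crossed_module_def)

lemma xact_closed [simp, intro]: "g \<in> carrier G \<Longrightarrow> m \<in> carrier N \<Longrightarrow> g \<triangleright> m \<in> carrier N"
  and xact_mult: "g \<in> carrier G \<Longrightarrow> m \<in> carrier N \<Longrightarrow> n \<in> carrier N \<Longrightarrow> g \<triangleright> (m \<bullet> n) = (g \<triangleright> m) \<bullet> (g \<triangleright> n)"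
  and xact_id [simp]: "m \<in> carrier N \<Longrightarrow> \<one>\<^bsub>G\<^esub> \<triangleright> m = m"
  and xact_comp: "g \<in> carrier G \<Longrightarrow> h \<in> carrier G \<Longrightarrow> m \<in> carrier N \<Longrightarrow> (g \<cdot> h) \<triangleright> m = g \<triangleright> h \<triangleright> m"
  and mu_hom: "\<mu> \<in> hom N G"
  and mu_xact: "g \<in> carrier G \<Longrightarrow> m \<in> carrier N \<Longrightarrow> \<mu> (g \<triangleright> m) = g \<cdot> \<mu> m \<cdot> inv\<^bsub>G\<^esub> g"
  and peiffer: "m \<in> carrier N \<Longrightarrow> n \<in> carrier N \<Longrightarrow> \<mu> n \<triangleright> m = n \<bullet> m \<bullet> inv\<^bsub>N\<^esub> n"
  using crossed by (simp_all add: crossed_module_def)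

lemma mu_closed [simp, intro]: "m \<in> carrier N \<Longrightarrow> \<mu> m \<in> carrier G"
  and mu_mult: "m \<in> carrier N \<Longrightarrow> n \<in> carrier N \<Longrightarrow> \<mu> (m \<bullet> n) = \<mu> m \<cdot> \<mu> n"
  using mu_hom by (auto simp: hom_def)

sublocale mu: group_hom "xM V" "xG V" "xmu V"
  by (simp add: group_hom_def group_hom_axioms_def mu_hom)

lemma xact_hom: "g \<in> carrier G \<Longrightarrow> xact V g \<in> hom N N"
  by (auto simp: hom_def xact_mult)

lemma xact_one [simp]: "g \<in> carrier G \<Longrightarrow> g \<triangleright> \<one>\<^bsub>N\<^esub> = \<one>\<^bsub>N\<^esub>"
  using hom_one[OF xact_hom] N.is_group by blast

lemma peiffer': "m \<in> carrier N \<Longrightarrow> n \<in> carrier N \<Longrightarrow> n \<bullet> m = (\<mu> n \<triangleright> m) \<bullet> n"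
  by (simp add: peiffer N.m_assoc)

lemma image_subgroup: "subgroup I G"
  using mu.img_is_subgroup .

sublocale I: normal "xmu V ` carrier (xM V)" "xG V"
  by (auto simp: G.normal_inv_iff image_subgroup simp flip: mu_xact)

sublocale P: group "xpi0 V"
  unfolding xpi0_def by (rule I.factorgroup_is_group)

lemma cl_closed [simp, intro]: "g \<in> carrier G \<Longrightarrow> cl g \<in> carrier P"
  and carrier_P: "p \<in> carrier P \<longleftrightarrow> (\<exists>g\<in>carrier G. p = cl g)"
  by (auto simp: xpi0_def xcls_def carrier_FactGroup)

lemma cl_mult: "g \<in> carrier G \<Longrightarrow> h \<in> carrier G \<Longrightarrow> cl (g \<cdot> h) = cl g \<otimes>\<^bsub>P\<^esub> cl h"
  by (simp add: xpi0_def xcls_def I.rcos_sum)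

lemma one_P: "\<one>\<^bsub>P\<^esub> = I"
  by (simp add: xpi0_def)

lemma cl_mu [simp]: "m \<in> carrier N \<Longrightarrow> cl (\<mu> m) = \<one>\<^bsub>P\<^esub>"
  by (simp add: one_P xcls_def G.coset_join2 image_subgroup)

lemma cl_one [simp]: "cl \<one>\<^bsub>G\<^esub> = \<one>\<^bsub>P\<^esub>"
  using cl_mu[of "\<one>\<^bsub>N\<^esub>"] by simp

lemma cl_mu_mult [simp]: "m \<in> carrier N \<Longrightarrow> g \<in> carrier G \<Longrightarrow> cl (\<mu> m \<cdot> g) = cl g"
  by (simp add: cl_mult)

lemma mem_cl: "g \<in> cl h \<longleftrightarrow> (\<exists>m\<in>carrier N. g = \<mu> m \<cdot> h)"
  by (auto simp: xcls_def r_coset_def)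

lemma cl_eqD:
  assumes "cl g = cl h" "g \<in> carrier G" "h \<in> carrier G"
  obtains m where "m \<in> carrier N" "g = \<mu> m \<cdot> h"
proof -
  have "g \<in> cl g" using assms(2) by (auto simp: mem_cl intro!: bexI[of _ "\<one>\<^bsub>N\<^esub>"])
  then show ?thesis using assms(1) that by (auto simp: mem_cl)
qed

lemma carrier_A: "a \<in> carrier A \<longleftrightarrow> a \<in> carrier N \<and> \<mu> a = \<one>\<^bsub>G\<^esub>"
  and mult_A: "a \<otimes>\<^bsub>A\<^esub> b = a \<bullet> b" and one_A: "\<one>\<^bsub>A\<^esub> = \<one>\<^bsub>N\<^esub>"
  by (auto simp: xpi1_def kernel_def)

text \<open>For a in the kernel, \<open>\<mu> a\<close> acts trivially, while by the Peiffer
  identity it acts as conjugation by a.\<close>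

lemma central: "a \<in> carrier A \<Longrightarrow> m \<in> carrier N \<Longrightarrow> m \<bullet> a = a \<bullet> m"
  using peiffer'[of m a] by (simp add: carrier_A)

lemma central': "a \<in> carrier A \<Longrightarrow> m \<in> carrier N \<Longrightarrow> n \<in> carrier N \<Longrightarrow> m \<bullet> (a \<bullet> n) = a \<bullet> (m \<bullet> n)"
  using central[of a m] by (simp add: carrier_A flip: N.m_assoc)

lemma mu_xact_A: "a \<in> carrier A \<Longrightarrow> m \<in> carrier N \<Longrightarrow> \<mu> m \<triangleright> a = a"
  using central[of a m] by (simp add: peiffer carrier_A N.m_assoc)

lemma xact_A: "a \<in> carrier A \<Longrightarrow> g \<in> carrier G \<Longrightarrow> g \<triangleright> a \<in> carrier A"
  by (simp add: carrier_A mu_xact)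

text \<open>\<open>xpi1_act\<close> uses an arbitrary representative of the class. Two
  representatives differ by some \<open>\<mu> m\<close>, which acts by conjugation and hence
  trivially on the central subgroup pi_1.\<close>

lemma act_cl:
  assumes "g \<in> carrier G" "a \<in> carrier A"
  shows "xpi1_act V (cl g) a = g \<triangleright> a"
proof -
  have "g \<in> cl g" using assms(1) by (auto simp: mem_cl intro!: bexI[of _ "\<one>\<^bsub>N\<^esub>"])
  then have "(SOME h. h \<in> cl g) \<in> cl g" by (rule someI)
  then obtain m where "m \<in> carrier N" "(SOME h. h \<in> cl g) = \<mu> m \<cdot> g" by (auto simp: mem_cl)
  then show ?thesis
    using assms carrier_A mu_xact_A xact_A by (simp add: xpi1_act_def xact_comp)
qed

lemma group_A: "comm_group A"
proof -
  have "subgroup (kernel N G \<mu>) N" by (rule mu.subgroup_kernel)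
  then have "group A" unfolding xpi1_def by (rule N.subgroup_imp_group)
  then show ?thesis
    by (rule group.group_comm_groupI) (use central carrier_A mult_A in auto)
qed

lemma module_A: "is_module P A (xpi1_act V)"
  unfolding is_module_def
proof (intro conjI ballI)
  fix p assume "p \<in> carrier P"
  then obtain g where g: "g \<in> carrier G" "p = cl g" by (auto simp: carrier_P)
  fix a assume a: "a \<in> carrier A"
  show "xpi1_act V p a \<in> carrier A" using g a by (simp add: act_cl xact_A)
  {
    fix b assume b: "b \<in> carrier A"
    have "a \<bullet> b \<in> carrier A" using a b by (simp add: carrier_A mu_mult)
    then show "xpi1_act V p (a \<otimes>\<^bsub>A\<^esub> b) = xpi1_act V p a \<otimes>\<^bsub>A\<^esub> xpi1_act V p b"
      using g a b carrier_A by (simp add: act_cl mult_A xact_mult)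
  }
  fix q assume "q \<in> carrier P"
  then obtain h where h: "h \<in> carrier G" "q = cl h" by (auto simp: carrier_P)
  have "p \<otimes>\<^bsub>P\<^esub> q = cl (g \<cdot> h)" using g h by (simp add: cl_mult)
  then show "xpi1_act V (p \<otimes>\<^bsub>P\<^esub> q) a = xpi1_act V p (xpi1_act V q a)"
    using g h a carrier_A xact_A by (simp add: act_cl xact_comp)
next
  fix a assume "a \<in> carrier A"
  then show "xpi1_act V \<one>\<^bsub>P\<^esub> a = a" using act_cl[of "\<one>\<^bsub>G\<^esub>" a] by (simp add: carrier_A)
qed (use group_A P.is_group in auto)

sublocale A: gmodule "xpi0 V" "xpi1 V" "xpi1_act V"
  by unfold_locales (rule module_A)

lemma inv_A: "a \<in> carrier A \<Longrightarrow> inv\<^bsub>A\<^esub> a = inv\<^bsub>N\<^esub> a"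
  by (metis A.A.inv_closed A.A.l_inv N.inv_equality carrier_A mult_A one_A)

end

section \<open>Lifting the Postnikov cocycle\<close>

text \<open>The lift \<open>Z\<close> need not come from sections as in \<^const>\<open>postnikov_Z2\<close>: multiplying that map by a
  pointed \<open>\<pi>\<^sub>1\<close>-valued cochain makes its nonabelian coboundary equal to \<open>z\<close> on the nose.\<close>

locale postnikov_lift = xmodule V for V :: "('g,'m) xmod" +
  fixes s :: "'g set \<Rightarrow> 'g" and Z :: "'g set \<Rightarrow> 'g set \<Rightarrow> 'm" and z :: "'g set \<times> 'g set \<times> 'g set \<Rightarrow> 'm"
  assumes s_closed [simp, intro]: "p \<in> carrier P \<Longrightarrow> s p \<in> carrier G"
    and cl_s [simp]: "p \<in> carrier P \<Longrightarrow> cl (s p) = p"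
    and s_one [simp]: "s \<one>\<^bsub>P\<^esub> = \<one>\<^bsub>G\<^esub>"
    and Z_closed [simp, intro]: "q \<in> carrier P \<Longrightarrow> p \<in> carrier P \<Longrightarrow> Z q p \<in> carrier N"
    and Z_one_left [simp]: "p \<in> carrier P \<Longrightarrow> Z \<one>\<^bsub>P\<^esub> p = \<one>\<^bsub>N\<^esub>"
    and Z_one_right [simp]: "p \<in> carrier P \<Longrightarrow> Z p \<one>\<^bsub>P\<^esub> = \<one>\<^bsub>N\<^esub>"
    and mu_Z: "q \<in> carrier P \<Longrightarrow> p \<in> carrier P \<Longrightarrow> \<mu> (Z q p) \<cdot> s (q \<otimes>\<^bsub>P\<^esub> p) = s q \<cdot> s p"
    and z_closed: "z \<in> carrier (C3 P A)"
    and z_pointed: "cpt3 P A z"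
    and z_eq: "r \<in> carrier P \<Longrightarrow> q \<in> carrier P \<Longrightarrow> p \<in> carrier P
      \<Longrightarrow> Z r q \<bullet> Z (r \<otimes>\<^bsub>P\<^esub> q) p = z (r, q, p) \<bullet> ((s r \<triangleright> Z q p) \<bullet> Z r (q \<otimes>\<^bsub>P\<^esub> p))"

section \<open>Existence of a lift whose nonabelian coboundary is the given cocycle\<close>

context xmodule
begin

text \<open>Needed because \<open>k3\<close> is defined by Hilbert choice: only existence guarantees
  that the chosen pair is a pair of sections.\<close>

lemma sections_exist: "\<exists>s0 s1. postnikov_sections V s0 s1"
proof -
  define s where "s p = (SOME g. g \<in> carrier G \<and> cl g = p)" for p
  define l where "l y = (SOME m. m \<in> carrier N \<and> \<mu> m = y)" for y
  have "s p \<in> carrier G \<and> cl (s p) = p" if "p \<in> carrier P" for p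
    unfolding s_def using that by - (rule someI_ex, auto simp: carrier_P)
  moreover have "l y \<in> carrier N \<and> \<mu> (l y) = y" if "y \<in> I" for y
    unfolding l_def using that by - (rule someI_ex, auto)
  \<comment> \<open>Redefining both choices at 1 keeps them sections and supplies the
    normalisation.\<close>
  ultimately have "postnikov_sections V (s(\<one>\<^bsub>P\<^esub> := \<one>\<^bsub>G\<^esub>)) (l(\<one>\<^bsub>G\<^esub> := \<one>\<^bsub>N\<^esub>))"
    unfolding postnikov_sections_def by simp
  then show ?thesis by blast
qed

lemma central_interchange:
  assumes "a \<in> carrier A" "b \<in> carrier A" "m \<in> carrier N" "n \<in> carrier N"
  shows "(a \<bullet> m) \<bullet> (b \<bullet> n) = (a \<bullet> b) \<bullet> (m \<bullet> n)"
  using assms central'[of b m n] by (simp add: carrier_A N.m_assoc)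

lemma postnikov_lift_exists:
  assumes z: "z \<in> Z3cpt P A (xpi1_act V)" and k3: "H3cpt_class P A (xpi1_act V) z = k3 V"
  shows "\<exists>s Z. postnikov_lift V s Z z"
proof -
  define s1 where "s1 = (SOME s. postnikov_sections V (fst s) (snd s))"
  have "postnikov_sections V (fst s1) (snd s1)"
    unfolding s1_def using sections_exist by - (rule someI_ex, auto)
  then obtain s l where s: "postnikov_sections V s l" and s1: "s1 = (s, l)"
    by (metis prod.collapse)
  define W where "W = postnikov_Z2 V s l"
  define w where "w = postnikov_z3 V s l"
  have s_props [simp]: "\<And>p. p \<in> carrier P \<Longrightarrow> s p \<in> carrier G" "\<And>p. p \<in> carrier P \<Longrightarrow> cl (s p) = p"
    "s \<one>\<^bsub>P\<^esub> = \<one>\<^bsub>G\<^esub>" "l \<one>\<^bsub>G\<^esub> = \<one>\<^bsub>N\<^esub>"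
    and l: "\<And>y. y \<in> I \<Longrightarrow> l y \<in> carrier N \<and> \<mu> (l y) = y"
    using s by (auto simp: postnikov_sections_def)
  have in_I: "s q \<cdot> s p \<cdot> inv\<^bsub>G\<^esub> s (q \<otimes>\<^bsub>P\<^esub> p) \<in> I" if qp: "q \<in> carrier P" "p \<in> carrier P" for q p
  proof -
    have "cl (s q \<cdot> s p) = cl (s (q \<otimes>\<^bsub>P\<^esub> p))" using qp by (simp add: cl_mult)
    then obtain m where "m \<in> carrier N" "s q \<cdot> s p = \<mu> m \<cdot> s (q \<otimes>\<^bsub>P\<^esub> p)"
      using cl_eqD[of "s q \<cdot> s p" "s (q \<otimes>\<^bsub>P\<^esub> p)"] qp by auto
    then show ?thesis using qp by (simp add: G.m_assoc)
  qed
  have W [simp]: "W q p \<in> carrier N" "\<mu> (W q p) = s q \<cdot> s p \<cdot> inv\<^bsub>G\<^esub> s (q \<otimes>\<^bsub>P\<^esub> p)"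
    if "q \<in> carrier P" "p \<in> carrier P" for q p
    using l[OF in_I[OF that]] by (auto simp: W_def postnikov_Z2_def)
  have W1: "W \<one>\<^bsub>P\<^esub> p = \<one>\<^bsub>N\<^esub>" "W p \<one>\<^bsub>P\<^esub> = \<one>\<^bsub>N\<^esub>" if "p \<in> carrier P" for p
    using that by (auto simp: W_def postnikov_Z2_def)
  have "z \<in> carrier (C3 P A)" and zc: "cpt3 P A z" using z by (auto simp: Z3cpt_def)
  interpret C3: comm_group "C3 P A" by (rule A.C3_group)
  interpret C2: comm_group "C2 P A" by (rule A.C2_group)
  have "group_hom (C2 P A) (C3 P A) (dg2 P A (xpi1_act V))"
    by (simp add: group_hom_def group_hom_axioms_def A.dg2_hom)
  then have "\<one>\<^bsub>C3 P A\<^esub> \<in> B3cpt P A (xpi1_act V)"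
    using group_hom.hom_one[of "C2 P A" "C3 P A" "dg2 P A (xpi1_act V)"] C2.one_closed
    by (force simp: B3cpt_def cpt3_def C3_def fun_group_one image_iff)
  \<comment> \<open>Equality of classes is equality of cosets as sets. As \<open>z\<close> lies in
    its own coset, it lies in that of \<open>w\<close>, which writes it as a pointed coboundary
    times \<open>w\<close>.\<close>
  then have "z \<in> H3cpt_class P A (xpi1_act V) z"
    using \<open>z \<in> carrier (C3 P A)\<close> by (force simp: H3cpt_class_def r_coset_def)
  then have "z \<in> H3cpt_class P A (xpi1_act V) w"
    unfolding k3 by (simp add: k3_def s1 w_def flip: s1_def)
  then obtain b where "b \<in> B3cpt P A (xpi1_act V)" and zb: "z = b \<otimes>\<^bsub>C3 P A\<^esub> w"
    by (auto simp: H3cpt_class_def r_coset_def)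
  then obtain c where "c \<in> C2cpt P A" and b: "b = dg2 P A (xpi1_act V) c"
    using A.B3cpt_pointed_preimage by metis
  then have cA: "\<And>q p. q \<in> carrier P \<Longrightarrow> p \<in> carrier P \<Longrightarrow> c (q,p) \<in> carrier A"
    and c1: "\<And>p. p \<in> carrier P \<Longrightarrow> c (\<one>\<^bsub>P\<^esub>,p) = \<one>\<^bsub>N\<^esub>" "\<And>p. p \<in> carrier P \<Longrightarrow> c (p,\<one>\<^bsub>P\<^esub>) = \<one>\<^bsub>N\<^esub>"
    by (auto simp: C2cpt_def C2_def fun_group_carrier cpt2_def one_A)
  have cN [simp]: "c (q,p) \<in> carrier N" "\<mu> (c (q,p)) = \<one>\<^bsub>G\<^esub>" if "q \<in> carrier P" "p \<in> carrier P" for q p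
    using cA[OF that] by (auto simp: carrier_A)
  have "postnikov_lift V s (\<lambda>q p. c (q,p) \<bullet> W q p) z"
  proof
    fix q p assume qp: "q \<in> carrier P" "p \<in> carrier P"
    then show "\<mu> (c (q,p) \<bullet> W q p) \<cdot> s (q \<otimes>\<^bsub>P\<^esub> p) = s q \<cdot> s p"
      by (simp add: mu_mult G.m_assoc)
    fix r assume r: "r \<in> carrier P"
    let ?Y = "s r \<triangleright> W q p" and ?W = "W r (q \<otimes>\<^bsub>P\<^esub> p)" and ?c = "c (r, q \<otimes>\<^bsub>P\<^esub> p)" and ?d = "s r \<triangleright> c (q,p)"
    have w: "w (r,q,p) = W r q \<bullet> W (r \<otimes>\<^bsub>P\<^esub> q) p \<bullet> inv\<^bsub>N\<^esub> ?W \<bullet> inv\<^bsub>N\<^esub> ?Y"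
      using qp r by (simp add: w_def postnikov_z3_def W_def)
    have wW: "W r q \<bullet> W (r \<otimes>\<^bsub>P\<^esub> q) p = w (r,q,p) \<bullet> (?Y \<bullet> ?W)"
      using qp r by (simp add: w N.m_assoc N.inv_cancel_left)
    have wA: "w (r,q,p) \<in> carrier A"
      using qp r
      by (simp add: w carrier_A mu_mult mu_xact G.m_assoc G.inv_mult_group P.m_assoc G.inv_cancel_left G.cancel_inv_left)
    have dA: "?d \<in> carrier A" using qp r by (simp add: xact_A cA)
    have bA: "b (r,q,p) \<in> carrier A"
      using qp r by (simp add: b dg2_def cA)
    have "b (r,q,p) = c (r,q) \<otimes>\<^bsub>A\<^esub> inv\<^bsub>A\<^esub> ?c \<otimes>\<^bsub>A\<^esub> c (r \<otimes>\<^bsub>P\<^esub> q, p) \<otimes>\<^bsub>A\<^esub> inv\<^bsub>A\<^esub> ?d"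
      using qp r act_cl[of "s r" "c (q,p)"] by (simp add: b dg2_def cA)
    then have "b (r,q,p) \<otimes>\<^bsub>A\<^esub> (?d \<otimes>\<^bsub>A\<^esub> ?c) = c (r,q) \<otimes>\<^bsub>A\<^esub> c (r \<otimes>\<^bsub>P\<^esub> q, p)"
      using qp r dA cA A.A.m_comm[of ?d ?c] by (simp add: A.A.m_assoc A.A.m_comm A.A.m_lcomm A.A.inv_cancel_left A.A.cancel_inv_left)
    then have bc: "c (r,q) \<bullet> c (r \<otimes>\<^bsub>P\<^esub> q, p) = b (r,q,p) \<bullet> (?d \<bullet> ?c)" by (simp add: mult_A)
    \<comment> \<open>The values of \<open>c\<close> are central, so the nonabelian coboundary of
      the product of \<open>c\<close> and \<open>W\<close> separates into the abelian coboundary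
      \<open>b\<close> of \<open>c\<close> and the nonabelian coboundary \<open>w\<close> of
      \<open>W\<close>.\<close>
    have "(c (r,q) \<bullet> W r q) \<bullet> (c (r \<otimes>\<^bsub>P\<^esub> q, p) \<bullet> W (r \<otimes>\<^bsub>P\<^esub> q) p)
        = (b (r,q,p) \<bullet> (?d \<bullet> ?c)) \<bullet> (w (r,q,p) \<bullet> (?Y \<bullet> ?W))"
      using qp r by (subst central_interchange) (simp_all add: cA bc wW)
    also have "\<dots> = (b (r,q,p) \<bullet> w (r,q,p)) \<bullet> ((?d \<bullet> ?c) \<bullet> (?Y \<bullet> ?W))"
      using qp r wA bA dA cA carrier_A by (intro central_interchange) auto
    also have "(?d \<bullet> ?c) \<bullet> (?Y \<bullet> ?W) = (?d \<bullet> ?Y) \<bullet> (?c \<bullet> ?W)"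
      using qp r by (subst central_interchange) (simp_all add: dA cA)
    also have "b (r,q,p) \<bullet> w (r,q,p) = z (r,q,p)"
      using qp r by (simp add: zb C3_def fun_group_mult mult_A)
    finally show "(c (r,q) \<bullet> W r q) \<bullet> (c (r \<otimes>\<^bsub>P\<^esub> q, p) \<bullet> W (r \<otimes>\<^bsub>P\<^esub> q) p)
        = z (r,q,p) \<bullet> ((s r \<triangleright> (c (q,p) \<bullet> W q p)) \<bullet> (?c \<bullet> ?W))"
      using qp r by (simp add: xact_mult)
  qed (use zc \<open>z \<in> carrier (C3 P A)\<close> in \<open>simp_all add: c1 W1\<close>)
  then show ?thesis by blast
qed

end

section \<open>The defect of a triple and its coboundary\<close>

context postnikov_lift
begin

text \<open>The factor is determined only up to pi_1. At 1 every element of pi_1 would qualify, so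
  the value 1 is imposed there; this makes defects with trivial arguments computable.\<close>

definition \<sigma> :: "'g \<Rightarrow> 'm" where
  "\<sigma> g = (if g = \<one>\<^bsub>G\<^esub> then \<one>\<^bsub>N\<^esub> else SOME m. m \<in> carrier N \<and> g = \<mu> m \<cdot> s (cl g))"

lemma sigma_one [simp]: "\<sigma> \<one>\<^bsub>G\<^esub> = \<one>\<^bsub>N\<^esub>"
  by (simp add: \<sigma>_def)

lemma sigma:
  assumes "g \<in> carrier G"
  shows sigma_closed [simp, intro]: "\<sigma> g \<in> carrier N"
    and mu_sigma: "\<mu> (\<sigma> g) \<cdot> s (cl g) = g"
proof -
  have "\<exists>m. m \<in> carrier N \<and> g = \<mu> m \<cdot> s (cl g)"
    using cl_eqD[of g "s (cl g)"] assms by (metis cl_closed cl_s s_closed)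
  from someI_ex[OF this] have "\<sigma> g \<in> carrier N \<and> \<mu> (\<sigma> g) \<cdot> s (cl g) = g"
    by (cases "g = \<one>\<^bsub>G\<^esub>") (simp_all add: \<sigma>_def)
  then show "\<sigma> g \<in> carrier N" "\<mu> (\<sigma> g) \<cdot> s (cl g) = g" by auto
qed

text \<open>The relation \<open>(\<mu> m h) g = \<mu> m (h g)\<close> expands in two ways into the form \<open>\<mu>(x) s([h][g])\<close>;
  the defect is the quotient of the two resulting values of \<open>x\<close>.\<close>

definition defect :: "'m \<Rightarrow> 'g \<Rightarrow> 'g \<Rightarrow> 'm" where
  "defect m h g = \<sigma> (\<mu> m \<cdot> h) \<bullet> (s (cl h) \<triangleright> \<sigma> g) \<bullet> Z (cl h) (cl g) \<bullet> inv\<^bsub>N\<^esub> (m \<bullet> \<sigma> (h \<cdot> g))"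

text \<open>Both expansions describe the same element \<open>\<mu> m \<cdot> h \<cdot> g\<close> of
  the group, so cancelling the common section value shows that the two factors in \<open>N\<close>
  have equal images under \<open>\<mu>\<close>.\<close>

lemma defect_closed [simp, intro]:
  assumes "m \<in> carrier N" "h \<in> carrier G" "g \<in> carrier G"
  shows "defect m h g \<in> carrier A"
proof -
  let ?H = "s (cl h)" and ?K = "s (cl g)"
  let ?l = "\<sigma> (\<mu> m \<cdot> h) \<bullet> (?H \<triangleright> \<sigma> g) \<bullet> Z (cl h) (cl g)" and ?r = "m \<bullet> \<sigma> (h \<cdot> g)"
  have "\<mu> ?l \<cdot> s (cl h \<otimes>\<^bsub>P\<^esub> cl g) = \<mu> (\<sigma> (\<mu> m \<cdot> h)) \<cdot> (?H \<cdot> \<mu> (\<sigma> g) \<cdot> inv\<^bsub>G\<^esub> ?H) \<cdot> (?H \<cdot> ?K)"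
    using assms by (simp add: mu_mult mu_xact G.m_assoc mu_Z)
  also have "\<dots> = (\<mu> (\<sigma> (\<mu> m \<cdot> h)) \<cdot> ?H) \<cdot> (\<mu> (\<sigma> g) \<cdot> ?K)"
    using assms by (simp add: G.m_assoc G.inv_cancel_left)
  also have "\<dots> = \<mu> m \<cdot> h \<cdot> g"
    using assms mu_sigma[of "\<mu> m \<cdot> h"] by (simp add: mu_sigma)
  also have "\<dots> = \<mu> ?r \<cdot> s (cl h \<otimes>\<^bsub>P\<^esub> cl g)"
    using assms mu_sigma[of "h \<cdot> g"] by (simp add: mu_mult G.m_assoc cl_mult)
  finally have eq: "\<mu> ?l \<cdot> s (cl h \<otimes>\<^bsub>P\<^esub> cl g) = \<mu> ?r \<cdot> s (cl h \<otimes>\<^bsub>P\<^esub> cl g)" .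
  have lr: "?l \<in> carrier N" "?r \<in> carrier N" using assms by auto
  have "s (cl h \<otimes>\<^bsub>P\<^esub> cl g) \<in> carrier G" using assms by simp
  with eq have "\<mu> ?l = \<mu> ?r"
    using G.r_cancel mu_closed[OF lr(1)] mu_closed[OF lr(2)] by blast
  moreover note lr
  moreover have "defect m h g = ?l \<bullet> inv\<^bsub>N\<^esub> ?r" by (simp add: defect_def)
  ultimately show ?thesis by (simp only: carrier_A mu_mult N.inv_closed N.m_closed mu.hom_inv G.r_inv mu_closed simp_thms)
qed

lemma defect_closed_N [simp, intro]:
  "m \<in> carrier N \<Longrightarrow> h \<in> carrier G \<Longrightarrow> g \<in> carrier G \<Longrightarrow> defect m h g \<in> carrier N"
  using defect_closed carrier_A by blast

lemma defect_eq:
  assumes "m \<in> carrier N" "h \<in> carrier G" "g \<in> carrier G"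
  shows "\<sigma> (\<mu> m \<cdot> h) \<bullet> (s (cl h) \<triangleright> \<sigma> g) \<bullet> Z (cl h) (cl g) = defect m h g \<bullet> (m \<bullet> \<sigma> (h \<cdot> g))"
  using assms by (simp add: defect_def N.m_assoc)

text \<open>The four defects record four ways of rewriting products built from k, h, g and the
  elements p, n, m of \<open>N\<close>. Composing the rewritings along the two sides reaches the
  same expression, except that the two values of \<open>Z\<close> on one side are regrouped into the
  two on the other, and by \<open>z_eq\<close> this costs exactly \<open>z\<close>. All four defects
  are central, so their positions do not matter.\<close>

lemma defect_cocycle:
  assumes [simp]: "p \<in> carrier N" "n \<in> carrier N" "k \<in> carrier G" "m \<in> carrier N" "h \<in> carrier G" "g \<in> carrier G"
  shows "defect p (\<mu> n \<cdot> k) (\<mu> m \<cdot> h) \<bullet> defect (n \<bullet> (k \<triangleright> m)) (k \<cdot> h) g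
    = z (cl k, cl h, cl g) \<bullet> (defect (p \<bullet> n) k (h \<cdot> g) \<bullet> (k \<triangleright> defect m h g))"
proof -
  define K where "K = s (cl k)"
  define kh where "kh = s (cl k \<otimes>\<^bsub>P\<^esub> cl h)"
  define u where "u = \<sigma> (\<mu> p \<cdot> (\<mu> n \<cdot> k))"
  define v where "v = \<sigma> (\<mu> m \<cdot> h)"
  define t where "t = \<sigma> ((\<mu> n \<cdot> k) \<cdot> (\<mu> m \<cdot> h))"
  define e where "e = \<sigma> (h \<cdot> g)"
  define q where "q = \<sigma> (k \<cdot> (h \<cdot> g))"
  define w where "w = \<sigma> g"
  define z0 where "z0 = z (cl k, cl h, cl g)"
  let ?A1 = "defect p (\<mu> n \<cdot> k) (\<mu> m \<cdot> h)" and ?A2 = "defect (p \<bullet> n) k (h \<cdot> g)"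
    and ?A3 = "defect (n \<bullet> (k \<triangleright> m)) (k \<cdot> h) g" and ?A4 = "K \<triangleright> defect m h g"
  let ?Zkh = "Z (cl k) (cl h)" and ?Zhg = "Z (cl h) (cl g)"
    and ?Zkhg = "Z (cl k \<otimes>\<^bsub>P\<^esub> cl h) (cl g)" and ?Zk = "Z (cl k) (cl h \<otimes>\<^bsub>P\<^esub> cl g)"
  have [simp]: "K \<in> carrier G" "kh \<in> carrier G" "u \<in> carrier N" "v \<in> carrier N" "t \<in> carrier N"
    "e \<in> carrier N" "q \<in> carrier N" "w \<in> carrier N"
    by (auto simp: K_def kh_def u_def v_def t_def e_def q_def w_def)
  have z0: "z0 \<in> carrier A" using z_closed by (auto simp: z0_def C3_def fun_group_carrier)
  have A: "?A1 \<in> carrier A" "?A2 \<in> carrier A" "?A3 \<in> carrier A" "?A4 \<in> carrier A"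
    by (auto simp: xact_A)
  have N: "?A1 \<in> carrier N" "?A2 \<in> carrier N" "?A3 \<in> carrier N" "?A4 \<in> carrier N" "z0 \<in> carrier N"
    using A z0 by (auto simp: carrier_A)
  have n_k_m: "\<mu> (n \<bullet> (k \<triangleright> m)) \<cdot> (k \<cdot> h) = (\<mu> n \<cdot> k) \<cdot> (\<mu> m \<cdot> h)"
    by (simp add: mu_mult mu_xact G.m_assoc G.inv_cancel_left)
  have e1: "u \<bullet> (K \<triangleright> v) \<bullet> ?Zkh = ?A1 \<bullet> (p \<bullet> t)"
    using defect_eq[of p "\<mu> n \<cdot> k" "\<mu> m \<cdot> h"] by (simp add: u_def v_def t_def K_def)
  have e2: "u \<bullet> (K \<triangleright> e) \<bullet> ?Zk = ?A2 \<bullet> (p \<bullet> n \<bullet> q)"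
    using defect_eq[of "p \<bullet> n" k "h \<cdot> g"] by (simp add: u_def e_def q_def K_def mu_mult cl_mult G.m_assoc)
  have e3: "t \<bullet> (kh \<triangleright> w) \<bullet> ?Zkhg = ?A3 \<bullet> (n \<bullet> (k \<triangleright> m) \<bullet> q)"
    using defect_eq[of "n \<bullet> (k \<triangleright> m)" "k \<cdot> h" g, unfolded n_k_m]
    by (simp add: t_def w_def q_def kh_def cl_mult G.m_assoc)
  have e4: "(K \<triangleright> v) \<bullet> (K \<triangleright> s (cl h) \<triangleright> w) \<bullet> (K \<triangleright> ?Zhg) = ?A4 \<bullet> ((K \<triangleright> m) \<bullet> (K \<triangleright> e))"
    using arg_cong[OF defect_eq[of m h g], of "xact V K"] by (simp add: v_def w_def e_def xact_mult)
  have e5: "?Zkh \<bullet> ?Zkhg = z0 \<bullet> ((K \<triangleright> ?Zhg) \<bullet> ?Zk)"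
    by (simp add: z_eq z0_def K_def)
  \<comment> \<open>Peiffer: moving \<open>w\<close> past \<open>Z\<close> replaces the action of
    s([k][h]) by that of s([k]) s([h]), because \<open>\<mu>\<close> of \<open>Z\<close> is their
    quotient.\<close>
  have e6: "?Zkh \<bullet> (kh \<triangleright> w) = (K \<triangleright> s (cl h) \<triangleright> w) \<bullet> ?Zkh"
  proof -
    have "?Zkh \<bullet> (kh \<triangleright> w) = ((\<mu> ?Zkh \<cdot> kh) \<triangleright> w) \<bullet> ?Zkh"
      using peiffer'[of "kh \<triangleright> w" ?Zkh] by (simp add: xact_comp)
    then show ?thesis by (simp add: kh_def K_def mu_Z xact_comp)
  qed
  \<comment> \<open>The elements \<open>\<mu> u \<cdot> K\<close> and
    \<open>\<mu> (p \<bullet> n) \<cdot> k\<close> coincide, so they act equally on m; Peiffer turns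
    the parts coming from \<open>\<mu>\<close> into conjugations by u and by
    \<open>p \<bullet> n\<close>.\<close>
  have e7: "u \<bullet> (K \<triangleright> m) = (p \<bullet> n) \<bullet> (k \<triangleright> m) \<bullet> inv\<^bsub>N\<^esub> (p \<bullet> n) \<bullet> u"
  proof -
    have "\<mu> u \<cdot> K = \<mu> (p \<bullet> n) \<cdot> k"
      using mu_sigma[of "\<mu> p \<cdot> (\<mu> n \<cdot> k)"] by (simp add: u_def K_def mu_mult G.m_assoc)
    then have "\<mu> u \<triangleright> K \<triangleright> m = \<mu> (p \<bullet> n) \<triangleright> k \<triangleright> m"
      by (metis \<open>K \<in> carrier G\<close> \<open>u \<in> carrier N\<close> assms(1-4) N.m_closed mu_closed xact_comp)
    then have "\<mu> u \<triangleright> K \<triangleright> m = (p \<bullet> n) \<bullet> (k \<triangleright> m) \<bullet> inv\<^bsub>N\<^esub> (p \<bullet> n)"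
      by (simp only: peiffer xact_closed assms N.m_closed)
    then show ?thesis using peiffer'[of "K \<triangleright> m" u] by simp
  qed
  \<comment> \<open>k and \<open>K\<close> have the same class, and the action on pi_1 depends on
    the class only.\<close>
  have km: "k \<triangleright> defect m h g = ?A4"
    using act_cl[of k "defect m h g"] act_cl[of K "defect m h g"] by (simp add: K_def)
  \<comment> \<open>Both sides of the claim, multiplied by \<open>?W\<close>, equal \<open>u (K \<triangleright> v) ?Zkh (kh \<triangleright> w) ?Zkhg\<close>.\<close>
  let ?W = "(p \<bullet> n) \<bullet> (k \<triangleright> m) \<bullet> q"
  have "(?A1 \<bullet> ?A3) \<bullet> ?W = ?A1 \<bullet> (p \<bullet> (?A3 \<bullet> (n \<bullet> (k \<triangleright> m) \<bullet> q)))"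
    using A N by (simp add: N.m_assoc central'[of ?A3 p])
  also have "\<dots> = ?A1 \<bullet> (p \<bullet> (t \<bullet> (kh \<triangleright> w) \<bullet> ?Zkhg))"
    by (simp only: e3)
  also have "\<dots> = (?A1 \<bullet> (p \<bullet> t)) \<bullet> ((kh \<triangleright> w) \<bullet> ?Zkhg)"
    using N by (simp add: N.m_assoc)
  also have "\<dots> = (u \<bullet> (K \<triangleright> v) \<bullet> ?Zkh) \<bullet> ((kh \<triangleright> w) \<bullet> ?Zkhg)"
    by (simp only: e1)
  also have "\<dots> = u \<bullet> (K \<triangleright> v) \<bullet> ((?Zkh \<bullet> (kh \<triangleright> w)) \<bullet> ?Zkhg)"
    by (simp add: N.m_assoc)
  also have "\<dots> = u \<bullet> (K \<triangleright> v) \<bullet> (((K \<triangleright> s (cl h) \<triangleright> w) \<bullet> ?Zkh) \<bullet> ?Zkhg)"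
    by (simp only: e6)
  also have "\<dots> = u \<bullet> (K \<triangleright> v) \<bullet> (K \<triangleright> s (cl h) \<triangleright> w) \<bullet> (?Zkh \<bullet> ?Zkhg)"
    by (simp add: N.m_assoc)
  also have "\<dots> = u \<bullet> (K \<triangleright> v) \<bullet> (K \<triangleright> s (cl h) \<triangleright> w) \<bullet> (z0 \<bullet> ((K \<triangleright> ?Zhg) \<bullet> ?Zk))"
    by (simp only: e5)
  also have "\<dots> = z0 \<bullet> (u \<bullet> (((K \<triangleright> v) \<bullet> (K \<triangleright> s (cl h) \<triangleright> w) \<bullet> (K \<triangleright> ?Zhg)) \<bullet> ?Zk))"
    using N z0 by (simp add: N.m_assoc central'[OF z0])
  also have "\<dots> = z0 \<bullet> (u \<bullet> ((?A4 \<bullet> ((K \<triangleright> m) \<bullet> (K \<triangleright> e))) \<bullet> ?Zk))"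
    by (simp only: e4)
  also have "\<dots> = z0 \<bullet> (?A4 \<bullet> ((u \<bullet> (K \<triangleright> m)) \<bullet> ((K \<triangleright> e) \<bullet> ?Zk)))"
    using N A by (simp add: N.m_assoc central'[of ?A4 u])
  also have "\<dots> = z0 \<bullet> (?A4 \<bullet> ((p \<bullet> n) \<bullet> ((k \<triangleright> m) \<bullet> (inv\<^bsub>N\<^esub> (p \<bullet> n) \<bullet> (u \<bullet> (K \<triangleright> e) \<bullet> ?Zk)))))"
    unfolding e7 using N by (simp add: N.m_assoc)
  also have "\<dots> = z0 \<bullet> (?A4 \<bullet> ((p \<bullet> n) \<bullet> ((k \<triangleright> m) \<bullet> (inv\<^bsub>N\<^esub> (p \<bullet> n) \<bullet> (?A2 \<bullet> (p \<bullet> n \<bullet> q))))))"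
    by (simp only: e2)
  also have "inv\<^bsub>N\<^esub> (p \<bullet> n) \<bullet> (?A2 \<bullet> (p \<bullet> n \<bullet> q)) = ?A2 \<bullet> q"
    using N A by (simp add: central'[of ?A2] N.m_assoc N.inv_mult_group N.inv_cancel_left)
  also have "(p \<bullet> n) \<bullet> ((k \<triangleright> m) \<bullet> (?A2 \<bullet> q)) = ?A2 \<bullet> ?W"
    using N A by (simp add: central'[of ?A2] N.m_assoc)
  also have "z0 \<bullet> (?A4 \<bullet> (?A2 \<bullet> ?W)) = (z0 \<bullet> (?A2 \<bullet> ?A4)) \<bullet> ?W"
    using N A by (simp add: central'[of ?A4] N.m_assoc)
  finally show ?thesis
    using N by (simp add: km z0_def)
qed

end

section \<open>Second cohomology of a crossed module\<close>

lemma (in comm_group) subgroup_comm_group: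
  assumes "subgroup H G"
  shows "comm_group (G\<lparr>carrier := H\<rparr>)"
proof (rule group.group_comm_groupI)
  show "group (G\<lparr>carrier := H\<rparr>)" by (rule subgroup_imp_group) fact
qed (use subgroup.mem_carrier[OF assms] m_comm in auto)

lemma comm_group_DirProd:
  assumes "comm_group G" "comm_group H"
  shows "comm_group (G \<times>\<times> H)"
proof -
  interpret G: comm_group G by fact
  interpret H: comm_group H by fact
  show ?thesis
    by (rule group.group_comm_groupI)
      (auto simp: DirProd_group G.is_group H.is_group G.m_comm H.m_comm)
qed

lemma hom_image_subgroup_carrier_update:
  assumes "d \<in> hom A B" "group A" "group B" "subgroup K B" "d ` carrier A \<subseteq> K"
  shows "subgroup (d ` carrier A) (B\<lparr>carrier := K\<rparr>)"
proof -
  interpret d: group_hom A B d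
    using assms by (simp add: group_hom_def group_hom_axioms_def)
  show ?thesis
    using d.img_is_subgroup d.H.subgroup_incl assms by metis
qed

section \<open>The low-degree cochain complex of a crossed module\<close>

locale xmodule_coeff = xmodule V + M: gmodule "xpi0 V" M act
  for V :: "('g,'m) xmod" and M :: "('a,'y) monoid_scheme" and act :: "'g set \<Rightarrow> 'a \<Rightarrow> 'a"
begin

abbreviation cmult (infixl \<open>\<star>\<close> 65) where "x \<star> y \<equiv> x \<otimes>\<^bsub>M\<^esub> y"
abbreviation cinv (\<open>(\<ominus>\<ominus> _)\<close> [81] 80) where "\<ominus>\<ominus> x \<equiv> inv\<^bsub>M\<^esub> x"

abbreviation "S2 \<equiv> carrier N \<times> carrier G \<times> carrier G"
abbreviation "S3 \<equiv> carrier N \<times> carrier N \<times> carrier G \<times> carrier N \<times> carrier G \<times> carrier G"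

lemma xC1_group: "comm_group (xC1 V M)" and xC2_group: "comm_group (xC2 V M)"
  by (simp_all add: xC1_def xC2_def fun_group_comm_group M.A.comm_group_axioms)

lemma xd1_hom: "xd1 V M act \<in> hom (xC1 V M) (xC2 V M)"
  unfolding xC1_def xC2_def
proof (rule fun_group_homI)
  let ?S = "carrier G"
  fix f g x
  assume fg: "f \<in> carrier (fun_group ?S M)" "g \<in> carrier (fun_group ?S M)" and x: "x \<in> S2"
  note [simp] = M.fun_closed[OF fg(1)] M.fun_closed[OF fg(2)]
  show "xd1 V M act (f \<otimes>\<^bsub>fun_group ?S M\<^esub> g) x = xd1 V M act f x \<star> xd1 V M act g x"
    using x by (auto simp: xd1_def fun_group_mult M.act_mult intro!: M.A.alternating3_mult)
qed (auto simp: xd1_def M.fun_closed M.A.comm_group_axioms)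

lemma xd2_hom: "xd2 V M act \<in> hom (xC2 V M) (fun_group S3 M)"
  unfolding xC2_def
proof (rule fun_group_homI)
  fix f g x
  assume fg: "f \<in> carrier (fun_group S2 M)" "g \<in> carrier (fun_group S2 M)" and x: "x \<in> S3"
  note [simp] = M.fun_closed[OF fg(1)] M.fun_closed[OF fg(2)]
  show "xd2 V M act (f \<otimes>\<^bsub>fun_group S2 M\<^esub> g) x = xd2 V M act f x \<star> xd2 V M act g x"
    using x by (auto simp: xd2_def fun_group_mult M.act_mult intro!: M.A.alternating4_mult)
qed (auto simp: xd2_def M.fun_closed M.A.comm_group_axioms)

lemma xZ2_subgroup: "subgroup (xZ2 V M act) (xC2 V M)"
proof -
  interpret F: comm_group "fun_group S3 M" by (rule fun_group_comm_group) (rule M.A.comm_group_axioms)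
  interpret C: comm_group "xC2 V M" by (rule xC2_group)
  interpret d: group_hom "xC2 V M" "fun_group S3 M" "xd2 V M act"
    by (simp add: group_hom_def group_hom_axioms_def xd2_hom)
  show ?thesis using d.subgroup_kernel by (simp add: kernel_def xZ2_def)
qed

lemma xZ2_group: "comm_group ((xC2 V M)\<lparr>carrier := xZ2 V M act\<rparr>)"
  by (rule comm_group.subgroup_comm_group[OF xC2_group xZ2_subgroup])

lemma xd2_xd1:
  assumes "b \<in> carrier (xC1 V M)"
  shows "xd1 V M act b \<in> xZ2 V M act"
proof -
  have b: "\<And>g. g \<in> carrier G \<Longrightarrow> b g \<in> carrier M" using assms by (auto simp: xC1_def fun_group_carrier)
  have "xd2 V M act (xd1 V M act b) x = \<one>\<^bsub>fun_group S3 M\<^esub> x" for x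
  proof (cases "x \<in> S3")
    case True
    then obtain p n k m h g where x: "x = (p,n,k,m,h,g)"
      and [simp]: "p \<in> carrier N" "n \<in> carrier N" "k \<in> carrier G" "m \<in> carrier N" "h \<in> carrier G" "g \<in> carrier G"
      by auto
    \<comment> \<open>This makes the argument of \<open>b\<close> in the third face agree with one
      in the first face, so that \<open>n2\<close> really occurs twice.\<close>
    have n_k_m: "\<mu> (n \<bullet> (k \<triangleright> m)) \<cdot> (k \<cdot> h) = \<mu> n \<cdot> k \<cdot> (\<mu> m \<cdot> h)"
      by (simp add: mu_mult mu_xact G.m_assoc G.inv_cancel_left)
    define n1 where "n1 = b (\<mu> (p \<bullet> n) \<cdot> k)"
    define n2 where "n2 = b (\<mu> n \<cdot> k \<cdot> (\<mu> m \<cdot> h))"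
    define n3 where "n3 = act (cl k) (b (\<mu> m \<cdot> h))"
    define n4 where "n4 = b (k \<cdot> (h \<cdot> g))"
    define n5 where "n5 = act (cl k) (b (h \<cdot> g))"
    define n6 where "n6 = act (cl k) (act (cl h) (b g))"
    have [simp]: "n1 \<in> carrier M" "n2 \<in> carrier M" "n3 \<in> carrier M" "n4 \<in> carrier M" "n5 \<in> carrier M" "n6 \<in> carrier M"
      by (auto simp: n1_def n2_def n3_def n4_def n5_def n6_def b)
    have "xd1 V M act b (p, \<mu> n \<cdot> k, \<mu> m \<cdot> h) = n1 \<star> \<ominus>\<ominus> n2 \<star> n3"
      by (simp add: xd1_def n1_def n2_def n3_def mu_mult G.m_assoc)
    moreover have "xd1 V M act b (p \<bullet> n, k, h \<cdot> g) = n1 \<star> \<ominus>\<ominus> n4 \<star> n5"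
      by (simp add: xd1_def n1_def n4_def n5_def)
    moreover have "xd1 V M act b (n \<bullet> (k \<triangleright> m), k \<cdot> h, g) = n2 \<star> \<ominus>\<ominus> n4 \<star> n6"
      using n_k_m b by (simp add: xd1_def n2_def n4_def n6_def G.m_assoc cl_mult M.act_comp del: mu.hom_mult)
    moreover have "act (cl k) (xd1 V M act b (m, h, g)) = n3 \<star> \<ominus>\<ominus> n5 \<star> n6"
      using b by (simp add: xd1_def n3_def n5_def n6_def M.act_simps)
    ultimately have "xd2 V M act (xd1 V M act b) x
        = (n1 \<star> \<ominus>\<ominus> n2 \<star> n3) \<star> \<ominus>\<ominus> (n1 \<star> \<ominus>\<ominus> n4 \<star> n5) \<star> (n2 \<star> \<ominus>\<ominus> n4 \<star> n6) \<star> \<ominus>\<ominus> (n3 \<star> \<ominus>\<ominus> n5 \<star> n6)"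
      by (simp add: x xd2_def del: mu.hom_mult)
    also have "\<dots> = \<one>\<^bsub>M\<^esub>" by (rule M.A.alternating_telescope) auto
    finally show ?thesis using True by (simp add: fun_group_one)
  qed (auto simp: xd2_def fun_group_one)
  then show ?thesis
    using xd1_hom assms by (auto simp: xZ2_def hom_def)
qed

lemma xB2_subgroup: "subgroup (xB2 V M act) ((xC2 V M)\<lparr>carrier := xZ2 V M act\<rparr>)"
proof -
  interpret C1: comm_group "xC1 V M" by (rule xC1_group)
  interpret C2: comm_group "xC2 V M" by (rule xC2_group)
  show ?thesis
    unfolding xB2_def using xd2_xd1
    by (intro hom_image_subgroup_carrier_update[OF xd1_hom C1.is_group C2.is_group xZ2_subgroup]) auto
qed

lemma xZ2_iff:
  "f \<in> xZ2 V M act \<longleftrightarrow> f \<in> carrier (xC2 V M) \<and>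
    (\<forall>p\<in>carrier N. \<forall>n\<in>carrier N. \<forall>k\<in>carrier G. \<forall>m\<in>carrier N. \<forall>h\<in>carrier G. \<forall>g\<in>carrier G.
      xd2 V M act f (p,n,k,m,h,g) = \<one>\<^bsub>M\<^esub>)"
  (is "_ \<longleftrightarrow> _ \<and> ?R")
proof -
  have "xd2 V M act f = \<one>\<^bsub>fun_group S3 M\<^esub> \<longleftrightarrow> (\<forall>x\<in>S3. xd2 V M act f x = \<one>\<^bsub>M\<^esub>)"
    by (auto simp: fun_group_one xd2_def fun_eq_iff)
  then show ?thesis by (auto simp: xZ2_def)
qed

lemma xC2_closed: "f \<in> carrier (xC2 V M) \<Longrightarrow> m \<in> carrier N \<Longrightarrow> h \<in> carrier G \<Longrightarrow> g \<in> carrier G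
    \<Longrightarrow> f (m,h,g) \<in> carrier M"
  by (auto simp: xC2_def fun_group_carrier)

end

lemma (in comm_group) alternating4_eq_oneD:
  assumes "a \<otimes> inv b \<otimes> c \<otimes> inv d = \<one>" "a \<in> carrier G" "b \<in> carrier G" "c \<in> carrier G" "d \<in> carrier G"
  shows "a \<otimes> c = b \<otimes> d"
proof -
  have "(a \<otimes> c) \<otimes> inv (b \<otimes> d) = a \<otimes> inv b \<otimes> c \<otimes> inv d" using assms(2-) by algebra
  then show ?thesis using assms eqI_div[of "a \<otimes> c" "b \<otimes> d"] by simp
qed

context xmodule_coeff
begin

text \<open>The form without inverses, in which substituting 1 for arguments lets equal factors
  cancel directly.\<close>

lemma xZ2_cocycle:
  assumes f: "f \<in> xZ2 V M act"
    and [simp]: "p \<in> carrier N" "n \<in> carrier N" "k \<in> carrier G" "m \<in> carrier N" "h \<in> carrier G" "g \<in> carrier G"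
  shows "f (p, \<mu> n \<cdot> k, \<mu> m \<cdot> h) \<star> f (n \<bullet> (k \<triangleright> m), k \<cdot> h, g) = f (p \<bullet> n, k, h \<cdot> g) \<star> act (cl k) (f (m, h, g))"
proof -
  have "f \<in> carrier (xC2 V M)" using f by (simp add: xZ2_def)
  note [simp] = xC2_closed[OF this]
  have "xd2 V M act f (p,n,k,m,h,g) = \<one>\<^bsub>M\<^esub>" using f by (simp add: xZ2_iff)
  then have "f (p, \<mu> n \<cdot> k, \<mu> m \<cdot> h) \<star> \<ominus>\<ominus> f (p \<bullet> n, k, h \<cdot> g) \<star> f (n \<bullet> (k \<triangleright> m), k \<cdot> h, g)
      \<star> \<ominus>\<ominus> act (cl k) (f (m, h, g)) = \<one>\<^bsub>M\<^esub>"
    by (simp add: xd2_def)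
  then show ?thesis by (rule M.A.alternating4_eq_oneD) auto
qed

end

section \<open>The comparison map from cocycles of the triple to cocycles of the crossed
  module\<close>

locale lift_coeff = postnikov_lift V s Z z + xmodule_coeff V M act
  for V :: "('g,'m) xmod" and s Z z and M :: "('a,'y) monoid_scheme" and act
begin

abbreviation "T2 \<equiv> Z2_triple P A (xpi1_act V) z M act"
abbreviation "E \<equiv> fun_group (carrier A) M \<times>\<times> C2 P M"

text \<open>The inverse is what makes the twists cancel: pulling \<open>c\<close> back to
  \<open>V\<close> gives coboundary dc, applying the homomorphism to the defect gives its value on
  \<open>z\<close>, and these two agree on \<open>T2\<close>.\<close>

definition \<Psi> :: "('m \<Rightarrow> 'a) \<times> ('g set \<times> 'g set \<Rightarrow> 'a) \<Rightarrow> 'm \<times> 'g \<times> 'g \<Rightarrow> 'a" where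
  "\<Psi> x = (\<lambda>(m,h,g)\<in>S2. snd x (cl h, cl g) \<star> \<ominus>\<ominus> fst x (defect m h g))"

lemma E_group: "comm_group E"
  by (intro comm_group_DirProd fun_group_comm_group M.A.comm_group_axioms M.C2_group)

lemma HomP_mult: "\<phi> \<in> HomP P A (xpi1_act V) M act \<Longrightarrow> a \<in> carrier A \<Longrightarrow> b \<in> carrier A \<Longrightarrow> \<phi> (a \<bullet> b) = \<phi> a \<star> \<phi> b"
  and HomP_closed: "\<phi> \<in> HomP P A (xpi1_act V) M act \<Longrightarrow> a \<in> carrier A \<Longrightarrow> \<phi> a \<in> carrier M"
  and HomP_act: "\<phi> \<in> HomP P A (xpi1_act V) M act \<Longrightarrow> g \<in> carrier G \<Longrightarrow> a \<in> carrier A \<Longrightarrow> \<phi> (g \<triangleright> a) = act (cl g) (\<phi> a)"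
  by (auto simp: HomP_def hom_def mult_A simp flip: act_cl)

lemma HomPI:
  assumes "\<phi> \<in> extensional (carrier A)"
    and "\<And>a. a \<in> carrier A \<Longrightarrow> \<phi> a \<in> carrier M"
    and "\<And>a b. a \<in> carrier A \<Longrightarrow> b \<in> carrier A \<Longrightarrow> \<phi> (a \<bullet> b) = \<phi> a \<star> \<phi> b"
    and "\<And>g a. g \<in> carrier G \<Longrightarrow> a \<in> carrier A \<Longrightarrow> \<phi> (g \<triangleright> a) = act (cl g) (\<phi> a)"
  shows "\<phi> \<in> HomP P A (xpi1_act V) M act"
  using assms by (auto simp: HomP_def hom_def mult_A PiE_iff carrier_P act_cl)

lemma z_in_A [simp]: "r \<in> carrier P \<Longrightarrow> q \<in> carrier P \<Longrightarrow> p \<in> carrier P \<Longrightarrow> z (r,q,p) \<in> carrier A"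
  using z_closed by (auto simp: C3_def fun_group_carrier)

lemma T2_iff:
  "(\<phi>, c) \<in> T2 \<longleftrightarrow> \<phi> \<in> HomP P A (xpi1_act V) M act \<and> c \<in> C2cpt P M \<and>
     (\<forall>r\<in>carrier P. \<forall>q\<in>carrier P. \<forall>p\<in>carrier P. \<phi> (z (r,q,p)) = dg2 P M act c (r,q,p))"
proof -
  have "(\<lambda>x\<in>carrier P \<times> carrier P \<times> carrier P. \<phi> (z x)) = dg2 P M act c \<longleftrightarrow>
    (\<forall>x\<in>carrier P \<times> carrier P \<times> carrier P. \<phi> (z x) = dg2 P M act c x)"
    by (auto simp: dg2_def fun_eq_iff)
  then show ?thesis by (auto simp: Z2_triple_def)
qed

lemma one_HomP: "\<one>\<^bsub>fun_group (carrier A) M\<^esub> \<in> HomP P A (xpi1_act V) M act"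
proof (rule HomPI)
  fix a b assume "a \<in> carrier A" "b \<in> carrier A"
  moreover from this have "a \<bullet> b \<in> carrier A" using A.A.m_closed by (simp add: mult_A)
  ultimately show "\<one>\<^bsub>fun_group (carrier A) M\<^esub> (a \<bullet> b) = \<one>\<^bsub>fun_group (carrier A) M\<^esub> a \<star> \<one>\<^bsub>fun_group (carrier A) M\<^esub> b"
    by (simp add: fun_group_one)
qed (auto simp: fun_group_one xact_A)

lemma C2cpt_closed: "c \<in> C2cpt P M \<Longrightarrow> q \<in> carrier P \<Longrightarrow> p \<in> carrier P \<Longrightarrow> c (q,p) \<in> carrier M"
  by (auto simp: C2cpt_def C2_def fun_group_carrier)

lemma T2_subset: "T2 \<subseteq> carrier E"
  by (auto simp: T2_iff HomP_def C2cpt_def fun_group_carrier)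

lemma T2_subgroup: "subgroup T2 E"
proof -
  interpret E: comm_group E by (rule E_group)
  interpret C2: comm_group "C2 P M" by (rule M.C2_group)
  interpret C3: comm_group "C3 P M" by (rule M.C3_group)
  interpret FA: comm_group "fun_group (carrier A) M"
    by (intro fun_group_comm_group M.A.comm_group_axioms)
  interpret d: group_hom "C2 P M" "C3 P M" "dg2 P M act"
    by (simp add: group_hom_def group_hom_axioms_def M.dg2_hom)
  have inv_C3: "(inv\<^bsub>C3 P M\<^esub> f) (r,q,p) = \<ominus>\<ominus> f (r,q,p)"
    if "f \<in> carrier (C3 P M)" "r \<in> carrier P" "q \<in> carrier P" "p \<in> carrier P" for f r q p
    using that by (simp add: C3_def fun_group_inv M.A.comm_group_axioms)
  have inv_C2: "(inv\<^bsub>C2 P M\<^esub> f) (q,p) = \<ominus>\<ominus> f (q,p)"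
    if "f \<in> carrier (C2 P M)" "q \<in> carrier P" "p \<in> carrier P" for f q p
    using that by (simp add: C2_def fun_group_inv M.A.comm_group_axioms)
  have A_mult: "a \<bullet> b \<in> carrier A" if "a \<in> carrier A" "b \<in> carrier A" for a b
    using A.A.m_closed that by (simp add: mult_A)
  show ?thesis
  proof (rule E.subgroupI)
    show "T2 \<subseteq> carrier E" by (rule T2_subset)
    have "(\<one>\<^bsub>fun_group (carrier A) M\<^esub>, \<one>\<^bsub>C2 P M\<^esub>) \<in> T2"
      unfolding T2_iff d.hom_one
      by (auto simp: one_HomP[unfolded fun_group_one] C2cpt_def cpt2_def C2_def C3_def fun_group_one fun_group_carrier)
    then show "T2 \<noteq> {}" by blast
  next
    fix x assume "x \<in> T2"
    then obtain \<phi> c where x: "x = (\<phi>, c)" and t: "(\<phi>, c) \<in> T2" by (cases x) auto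
    have \<phi>: "\<phi> \<in> HomP P A (xpi1_act V) M act" and c: "c \<in> C2cpt P M" "c \<in> carrier (C2 P M)"
      using t by (auto simp: T2_iff C2cpt_def)
    have \<phi>c: "\<phi> \<in> carrier (fun_group (carrier A) M)" using \<phi> by (auto simp: HomP_def fun_group_carrier)
    have inv\<phi>: "inv\<^bsub>fun_group (carrier A) M\<^esub> \<phi> = (\<lambda>x\<in>carrier A. \<ominus>\<ominus> \<phi> x)"
      using \<phi>c by (simp add: fun_group_inv M.A.comm_group_axioms)
    have "inv\<^bsub>fun_group (carrier A) M\<^esub> \<phi> \<in> HomP P A (xpi1_act V) M act"
      unfolding inv\<phi>
      by (rule HomPI)
        (use \<phi> in \<open>auto simp: HomP_closed HomP_mult HomP_act A_mult xact_A M.A.inv_mult M.act_inv\<close>)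
    moreover have "inv\<^bsub>C2 P M\<^esub> c \<in> C2cpt P M"
      using c by (auto simp: C2cpt_def cpt2_def inv_C2)
    ultimately have "(inv\<^bsub>fun_group (carrier A) M\<^esub> \<phi>, inv\<^bsub>C2 P M\<^esub> c) \<in> T2"
      using t c(2) by (simp add: T2_iff inv\<phi> inv_C3)
    then show "inv\<^bsub>E\<^esub> x \<in> T2"
      using \<phi>c c(2) by (simp add: x FA.is_group C2.is_group)
  next
    fix x y assume "x \<in> T2" "y \<in> T2"
    then obtain \<phi> c \<psi> e where x: "x = (\<phi>, c)" and t: "(\<phi>, c) \<in> T2"
      and y: "y = (\<psi>, e)" and u: "(\<psi>, e) \<in> T2" by (cases x, cases y) auto
    have hom: "\<phi> \<in> HomP P A (xpi1_act V) M act" "\<psi> \<in> HomP P A (xpi1_act V) M act"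
      and c: "c \<in> C2cpt P M" "c \<in> carrier (C2 P M)" and e: "e \<in> C2cpt P M" "e \<in> carrier (C2 P M)"
      using t u by (auto simp: T2_iff C2cpt_def)
    have "(\<lambda>x\<in>carrier A. \<phi> x \<star> \<psi> x) \<in> HomP P A (xpi1_act V) M act"
      by (rule HomPI)
        (use hom in \<open>auto simp: HomP_closed HomP_mult HomP_act A_mult xact_A M.act_mult M.A.m_ac\<close>)
    moreover have "c \<otimes>\<^bsub>C2 P M\<^esub> e \<in> C2cpt P M"
      using c e by (simp add: C2cpt_def cpt2_def) (auto simp: C2_def fun_group_mult)
    ultimately have "(\<phi> \<otimes>\<^bsub>fun_group (carrier A) M\<^esub> \<psi>, c \<otimes>\<^bsub>C2 P M\<^esub> e) \<in> T2"
      using t u c(2) e(2) by (simp add: T2_iff fun_group_mult) (simp add: C3_def fun_group_mult)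
    then show "x \<otimes>\<^bsub>E\<^esub> y \<in> T2" by (simp add: x y)
  qed
qed

lemma T2_group: "comm_group (E\<lparr>carrier := T2\<rparr>)"
  by (rule comm_group.subgroup_comm_group[OF E_group T2_subgroup])

end

text \<open>Here \<open>a1\<close> to \<open>a4\<close> stand for images of defects and
  \<open>c1\<close> to \<open>c4\<close> for values of \<open>c\<close>; the hypothesis is the image
  of \<open>defect_cocycle\<close> with the value on \<open>z\<close> already replaced by
  dc.\<close>

lemma (in comm_group) twisted_cocycle:
  assumes "a1 \<otimes> a3 = (c1 \<otimes> inv c2 \<otimes> c3 \<otimes> inv c4) \<otimes> (a2 \<otimes> a4)"
    and c: "a1 \<in> carrier G" "a2 \<in> carrier G" "a3 \<in> carrier G" "a4 \<in> carrier G"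
      "c1 \<in> carrier G" "c2 \<in> carrier G" "c3 \<in> carrier G" "c4 \<in> carrier G"
  shows "(c1 \<otimes> inv a1) \<otimes> inv (c2 \<otimes> inv a2) \<otimes> (c3 \<otimes> inv a3) \<otimes> inv (c4 \<otimes> inv a4) = \<one>"
proof -
  have "(c1 \<otimes> inv a1) \<otimes> inv (c2 \<otimes> inv a2) \<otimes> (c3 \<otimes> inv a3) \<otimes> inv (c4 \<otimes> inv a4)
      = (c1 \<otimes> inv c2 \<otimes> c3 \<otimes> inv c4) \<otimes> (a2 \<otimes> a4) \<otimes> inv (a1 \<otimes> a3)"
    using c by algebra
  then show ?thesis unfolding assms(1) using c by simp
qed

lemma (in comm_group) mult_div_interchange:
  "a \<in> carrier G \<Longrightarrow> b \<in> carrier G \<Longrightarrow> c \<in> carrier G \<Longrightarrow> d \<in> carrier G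
    \<Longrightarrow> (a \<otimes> b) \<otimes> inv (c \<otimes> d) = (a \<otimes> inv c) \<otimes> (b \<otimes> inv d)"
  by algebra

context lift_coeff
begin

lemma Psi_cocycle:
  assumes "x \<in> T2"
  shows "\<Psi> x \<in> xZ2 V M act"
proof -
  obtain \<phi> c where x: "x = (\<phi>, c)" by (cases x)
  have \<phi>: "\<phi> \<in> HomP P A (xpi1_act V) M act" and c: "c \<in> C2cpt P M"
    and \<phi>z: "\<And>r q p. r \<in> carrier P \<Longrightarrow> q \<in> carrier P \<Longrightarrow> p \<in> carrier P \<Longrightarrow> \<phi> (z (r,q,p)) = dg2 P M act c (r,q,p)"
    using assms by (auto simp: x T2_iff)
  note [simp] = HomP_closed[OF \<phi>] C2cpt_closed[OF c]
  have A_mult: "a \<bullet> b \<in> carrier A" if "a \<in> carrier A" "b \<in> carrier A" for a b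
    using A.A.m_closed that by (simp add: mult_A)
  have "xd2 V M act (\<Psi> x) (p,n,k,m,h,g) = \<one>\<^bsub>M\<^esub>"
    if [simp]: "p \<in> carrier N" "n \<in> carrier N" "k \<in> carrier G" "m \<in> carrier N" "h \<in> carrier G" "g \<in> carrier G"
    for p n k m h g
  proof -
    have kA: "k \<triangleright> defect m h g \<in> carrier A" by (intro xact_A) auto
    have "\<phi> (defect p (\<mu> n \<cdot> k) (\<mu> m \<cdot> h)) \<star> \<phi> (defect (n \<bullet> (k \<triangleright> m)) (k \<cdot> h) g)
        = \<phi> (z (cl k, cl h, cl g)) \<star> (\<phi> (defect (p \<bullet> n) k (h \<cdot> g)) \<star> \<phi> (k \<triangleright> defect m h g))"
      using arg_cong[OF defect_cocycle[OF that], of \<phi>] by (simp add: HomP_mult[OF \<phi>] A_mult kA)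
    then have "\<phi> (defect p (\<mu> n \<cdot> k) (\<mu> m \<cdot> h)) \<star> \<phi> (defect (n \<bullet> (k \<triangleright> m)) (k \<cdot> h) g)
        = (c (cl k, cl h) \<star> \<ominus>\<ominus> c (cl k, cl h \<otimes>\<^bsub>P\<^esub> cl g) \<star> c (cl k \<otimes>\<^bsub>P\<^esub> cl h, cl g) \<star> \<ominus>\<ominus> act (cl k) (c (cl h, cl g)))
          \<star> (\<phi> (defect (p \<bullet> n) k (h \<cdot> g)) \<star> act (cl k) (\<phi> (defect m h g)))"
      by (simp add: \<phi>z dg2_def HomP_act[OF \<phi>])
    from M.A.twisted_cocycle[OF this] show ?thesis
      by (simp add: xd2_def \<Psi>_def x cl_mult M.act_mult M.act_inv)
  qed
  moreover have "\<Psi> x \<in> carrier (xC2 V M)"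
    by (auto simp: \<Psi>_def x xC2_def fun_group_carrier)
  ultimately show ?thesis by (simp add: xZ2_iff)
qed

lemma Psi_hom: "\<Psi> \<in> hom (E\<lparr>carrier := T2\<rparr>) ((xC2 V M)\<lparr>carrier := xZ2 V M act\<rparr>)"
proof (rule homI)
  fix x y assume "x \<in> carrier (E\<lparr>carrier := T2\<rparr>)" "y \<in> carrier (E\<lparr>carrier := T2\<rparr>)"
  then obtain \<phi> c \<psi> e where x: "x = (\<phi>, c)" and t: "(\<phi>, c) \<in> T2"
      and y: "y = (\<psi>, e)" and u: "(\<psi>, e) \<in> T2" by (cases x, cases y) auto
  have hom: "\<phi> \<in> HomP P A (xpi1_act V) M act" "\<psi> \<in> HomP P A (xpi1_act V) M act"
    and c: "c \<in> C2cpt P M" and e: "e \<in> C2cpt P M"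
    using t u by (auto simp: T2_iff)
  note [simp] = C2cpt_closed[OF c] C2cpt_closed[OF e] HomP_closed[OF hom(1)] HomP_closed[OF hom(2)]
  have "\<Psi> (x \<otimes>\<^bsub>E\<^esub> y) = \<Psi> x \<otimes>\<^bsub>xC2 V M\<^esub> \<Psi> y"
    by (auto simp: fun_eq_iff x y \<Psi>_def xC2_def fun_group_mult C2_def M.A.mult_div_interchange)
  then show "\<Psi> (x \<otimes>\<^bsub>E\<lparr>carrier := T2\<rparr>\<^esub> y) = \<Psi> x \<otimes>\<^bsub>(xC2 V M)\<lparr>carrier := xZ2 V M act\<rparr>\<^esub> \<Psi> y"
    by simp
qed (simp add: Psi_cocycle)

end

section \<open>Which pairs the comparison map sends to coboundaries\<close>

context lift_coeff
begin

lemma defect_one_right: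
  assumes "m \<in> carrier N" "h \<in> carrier G"
  shows "\<sigma> (\<mu> m \<cdot> h) = defect m h \<one>\<^bsub>G\<^esub> \<bullet> (m \<bullet> \<sigma> h)"
  using defect_eq[of m h "\<one>\<^bsub>G\<^esub>"] assms by simp

text \<open>A coboundary on pi_0 pulls back to a coboundary on the group. Conversely, evaluate at
  (a,1,1) with a in pi_1: pointedness kills \<open>c\<close>, and the coboundary of \<open>b\<close>
  gives the constant b(1). Hence the homomorphism is constant, so trivial. Evaluating at (m,h,1)
  then shows that \<open>b\<close> is constant on classes, so it descends to a 1-cochain whose
  coboundary is \<open>c\<close>.\<close>

lemma Psi_boundary_iff:
  "B2_triple P A M act = {x \<in> T2. \<Psi> x \<in> xB2 V M act}"
proof (intro Set.set_eqI iffI)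
  fix x assume "x \<in> B2_triple P A M act"
  then obtain b where b: "b \<in> carrier (C1 P M)" and cpt: "cpt2 P M (dg1 P M act b)"
    and x: "x = (\<one>\<^bsub>fun_group (carrier A) M\<^esub>, dg1 P M act b)"
    by (auto simp: B2_triple_def B2cpt_def)
  have bM: "\<And>p. p \<in> carrier P \<Longrightarrow> b p \<in> carrier M" using b by (auto simp: C1_def fun_group_carrier)
  have "dg1 P M act b \<in> carrier (C2 P M)" using M.dg1_hom b by (auto simp: hom_def)
  then have "x \<in> T2"
    unfolding x T2_iff using cpt M.dg2_dg1[OF b]
    by (simp add: one_HomP C2cpt_def) (simp add: fun_group_one C3_def)
  moreover have "\<Psi> x = xd1 V M act (\<lambda>g\<in>carrier G. b (cl g))"
    by (auto simp: fun_eq_iff \<Psi>_def x fun_group_one xd1_def dg1_def bM cl_mult)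
  moreover have "(\<lambda>g\<in>carrier G. b (cl g)) \<in> carrier (xC1 V M)"
    by (auto simp: xC1_def fun_group_carrier bM)
  ultimately show "x \<in> {x \<in> T2. \<Psi> x \<in> xB2 V M act}" by (auto simp: xB2_def)
next
  fix x assume "x \<in> {x \<in> T2. \<Psi> x \<in> xB2 V M act}"
  then obtain \<phi> c b where x: "x = (\<phi>, c)" "(\<phi>, c) \<in> T2"
    and b: "b \<in> carrier (xC1 V M)" and eq: "\<Psi> (\<phi>, c) = xd1 V M act b"
    by (cases x) (auto simp: xB2_def)
  have \<phi>: "\<phi> \<in> HomP P A (xpi1_act V) M act" and c: "c \<in> C2cpt P M"
    using x by (auto simp: T2_iff)
  note [simp] = HomP_closed[OF \<phi>] C2cpt_closed[OF c]
  have bM [simp]: "\<And>g. g \<in> carrier G \<Longrightarrow> b g \<in> carrier M" using b by (auto simp: xC1_def fun_group_carrier)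
  have c1: "c (p, \<one>\<^bsub>P\<^esub>) = \<one>\<^bsub>M\<^esub>" if "p \<in> carrier P" for p
    using c that by (auto simp: C2cpt_def cpt2_def)
  have eq': "c (cl h, cl g) \<star> \<ominus>\<ominus> \<phi> (defect m h g) = b (\<mu> m \<cdot> h) \<star> \<ominus>\<ominus> b (h \<cdot> g) \<star> act (cl h) (b g)"
    if "m \<in> carrier N" "h \<in> carrier G" "g \<in> carrier G" for m h g
    using fun_cong[OF eq, of "(m,h,g)"] that by (simp add: \<Psi>_def xd1_def)
  have \<phi>1: "\<ominus>\<ominus> \<phi> (defect a \<one>\<^bsub>G\<^esub> \<one>\<^bsub>G\<^esub>) = b \<one>\<^bsub>G\<^esub>" if a: "a \<in> carrier A" for a
  proof -
    have [simp]: "a \<in> carrier N" "\<mu> a = \<one>\<^bsub>G\<^esub>" using a by (auto simp: carrier_A)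
    have d: "defect a \<one>\<^bsub>G\<^esub> \<one>\<^bsub>G\<^esub> \<in> carrier A" by auto
    show ?thesis using eq'[of a "\<one>\<^bsub>G\<^esub>" "\<one>\<^bsub>G\<^esub>"] d by (simp add: c1 M.act_id)
  qed
  \<comment> \<open>Since \<open>\<mu> a\<close> is 1, every factor of the defect except the inverse
    of a is trivial by the normalisations of \<open>\<sigma>\<close> and \<open>Z\<close>.\<close>
  have d1: "defect a \<one>\<^bsub>G\<^esub> \<one>\<^bsub>G\<^esub> = inv\<^bsub>A\<^esub> a" if a: "a \<in> carrier A" for a
    using a by (simp add: defect_def inv_A carrier_A)
  have "\<phi> \<in> hom A M" using \<phi> by (simp add: HomP_def)
  then have \<phi>_one: "\<phi> \<one>\<^bsub>A\<^esub> = \<one>\<^bsub>M\<^esub>" using hom_one A.A.is_group M.A.is_group by blast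
  have b1: "b \<one>\<^bsub>G\<^esub> = \<one>\<^bsub>M\<^esub>"
    using \<phi>1[of "\<one>\<^bsub>A\<^esub>"] d1[of "\<one>\<^bsub>A\<^esub>"] by (simp add: \<phi>_one)
  have \<phi>0: "\<phi> a = \<one>\<^bsub>M\<^esub>" if "a \<in> carrier A" for a
    using \<phi>1[of "inv\<^bsub>A\<^esub> a"] d1[of "inv\<^bsub>A\<^esub> a"] that b1 by simp
  have "\<phi> = \<one>\<^bsub>fun_group (carrier A) M\<^esub>"
    using \<phi> \<phi>0 by (auto simp: fun_group_one HomP_def fun_eq_iff PiE_iff extensional_def)
  moreover have b_inv: "b (\<mu> m \<cdot> h) = b h" if "m \<in> carrier N" "h \<in> carrier G" for m h
    using eq'[of m h "\<one>\<^bsub>G\<^esub>"] that M.A.eqI_div[of "b (\<mu> m \<cdot> h)" "b h"] by (simp add: c1 b1 \<phi>0)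
  have b_cl: "b (s (cl g)) = b g" if "g \<in> carrier G" for g
    using b_inv[of "\<sigma> g" "s (cl g)"] that by (simp add: mu_sigma)
  have "c = dg1 P M act (\<lambda>p\<in>carrier P. b (s p))"
  proof (rule extensionalityI[of _ "carrier P \<times> carrier P"])
    show "c \<in> extensional (carrier P \<times> carrier P)"
      using c by (auto simp: C2cpt_def C2_def fun_group_carrier PiE_iff)
    fix x assume "x \<in> carrier P \<times> carrier P"
    then obtain q p where x: "x = (q,p)" and qp: "q \<in> carrier P" "p \<in> carrier P" by auto
    have "b (s (q \<otimes>\<^bsub>P\<^esub> p)) = b (s q \<cdot> s p)"
      using b_cl[of "s q \<cdot> s p"] qp by (simp add: cl_mult)
    then show "c x = dg1 P M act (\<lambda>p\<in>carrier P. b (s p)) x"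
      using eq'[of "\<one>\<^bsub>N\<^esub>" "s q" "s p"] qp by (simp add: x dg1_def \<phi>0)
  qed (auto simp: dg1_def)
  moreover have "(\<lambda>p\<in>carrier P. b (s p)) \<in> carrier (C1 P M)"
    by (auto simp: C1_def fun_group_carrier)
  ultimately show "x \<in> B2_triple P A M act"
    using c by (auto simp: x B2_triple_def B2cpt_def C2cpt_def)
qed

end

text \<open>The a's are values of a cocycle, the b's those of a coboundary, and the d's images of
  defects satisfying an identity twisted by t. The combination a - b + d inherits precisely the
  twist t; this is what \<open>e_cocyc\<close> needs.\<close>

lemma (in comm_group) cocycle_quotient_mult:
  assumes "a1 \<otimes> a2 = a3 \<otimes> a4" "b1 \<otimes> b2 = b3 \<otimes> b4" "d1 \<otimes> d2 = t \<otimes> (d3 \<otimes> d4)"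
    and c: "a1 \<in> carrier G" "a2 \<in> carrier G" "a3 \<in> carrier G" "a4 \<in> carrier G"
      "b1 \<in> carrier G" "b2 \<in> carrier G" "b3 \<in> carrier G" "b4 \<in> carrier G"
      "d1 \<in> carrier G" "d2 \<in> carrier G" "d3 \<in> carrier G" "d4 \<in> carrier G" "t \<in> carrier G"
  shows "(a1 \<otimes> inv b1 \<otimes> d1) \<otimes> (a2 \<otimes> inv b2 \<otimes> d2) = t \<otimes> ((a3 \<otimes> inv b3 \<otimes> d3) \<otimes> (a4 \<otimes> inv b4 \<otimes> d4))"
proof -
  have "(a1 \<otimes> inv b1 \<otimes> d1) \<otimes> (a2 \<otimes> inv b2 \<otimes> d2) = (a1 \<otimes> a2) \<otimes> inv (b1 \<otimes> b2) \<otimes> (d1 \<otimes> d2)"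
    using c by algebra
  also have "\<dots> = (a3 \<otimes> a4) \<otimes> inv (b3 \<otimes> b4) \<otimes> (t \<otimes> (d3 \<otimes> d4))" by (simp only: assms)
  also have "\<dots> = t \<otimes> ((a3 \<otimes> inv b3 \<otimes> d3) \<otimes> (a4 \<otimes> inv b4 \<otimes> d4))"
    using c by algebra
  finally show ?thesis .
qed

lemma (in comm_group) alternating4_eqI:
  assumes "a \<otimes> c = t \<otimes> (b \<otimes> d)" "a \<in> carrier G" "b \<in> carrier G" "c \<in> carrier G" "d \<in> carrier G" "t \<in> carrier G"
  shows "t = a \<otimes> inv b \<otimes> c \<otimes> inv d"
proof -
  have "a \<otimes> inv b \<otimes> c \<otimes> inv d = (a \<otimes> c) \<otimes> inv (b \<otimes> d)" using assms(2-) by algebra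
  also have "\<dots> = t" unfolding assms(1) using assms(2-) by algebra
  finally show ?thesis ..
qed

lemma (in comm_group) split_off:
  "f \<in> carrier G \<Longrightarrow> x \<in> carrier G \<Longrightarrow> d \<in> carrier G \<Longrightarrow> f = x \<otimes> ((f \<otimes> inv x \<otimes> d) \<otimes> inv d)"
  by algebra

lemma (in comm_group) normalisation_cancel:
  assumes "x = d \<otimes> f \<otimes> y" "d \<in> carrier G" "f \<in> carrier G" "y \<in> carrier G"
  shows "f \<otimes> inv (x \<otimes> inv y \<otimes> \<one>) \<otimes> d = \<one>"
  unfolding assms(1) using assms(2-) by algebra

section \<open>Every cocycle of the crossed module comes from the triple, up to a coboundary\<close>

context lift_coeff
begin

text \<open>Multiplication by a in pi_1 changes f only by the factor f(a,1,1), which yields the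
  homomorphism. The remaining function \<open>e\<close> obeys the cocycle identity twisted by
  \<open>z\<close> and vanishes at (m,h,1). These two properties alone force it to depend on classes
  only.\<close>

lemma normalized_cocycle_decomposition:
  assumes f: "f \<in> xZ2 V M act" and f1: "f (\<one>\<^bsub>N\<^esub>, \<one>\<^bsub>G\<^esub>, \<one>\<^bsub>G\<^esub>) = \<one>\<^bsub>M\<^esub>"
  shows "\<exists>x\<in>T2. \<exists>b\<in>carrier (xC1 V M). f = xd1 V M act b \<otimes>\<^bsub>xC2 V M\<^esub> \<Psi> x"
proof -
  have fC: "f \<in> carrier (xC2 V M)" using f by (simp add: xZ2_def)
  note fM [simp] = xC2_closed[OF fC]
  have A_mult [simp]: "a \<bullet> b \<in> carrier A" if "a \<in> carrier A" "b \<in> carrier A" for a b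
    using A.A.m_closed that by (simp add: mult_A)
  have A_N: "a \<in> carrier N" "\<mu> a = \<one>\<^bsub>G\<^esub>" if "a \<in> carrier A" for a using that by (auto simp: carrier_A)
  note cocyc = xZ2_cocycle[OF f]
  \<comment> \<open>Each fact up to \<open>f_central\<close> is one instance of the cocycle identity
    with most arguments equal to 1; normalisation at (1,1,1) starts the chain.\<close>
  have f_mid: "f (\<one>\<^bsub>N\<^esub>, k, \<one>\<^bsub>G\<^esub>) = \<one>\<^bsub>M\<^esub>" if "k \<in> carrier G" for k
    using cocyc[of "\<one>\<^bsub>N\<^esub>" "\<one>\<^bsub>N\<^esub>" k "\<one>\<^bsub>N\<^esub>" "\<one>\<^bsub>G\<^esub>" "\<one>\<^bsub>G\<^esub>"] that f1 by simp
  have f_right: "f (\<one>\<^bsub>N\<^esub>, \<one>\<^bsub>G\<^esub>, g) = \<one>\<^bsub>M\<^esub>" if "g \<in> carrier G" for g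
    using cocyc[of "\<one>\<^bsub>N\<^esub>" "\<one>\<^bsub>N\<^esub>" "\<one>\<^bsub>G\<^esub>" "\<one>\<^bsub>N\<^esub>" "\<one>\<^bsub>G\<^esub>" g] that f1 by (simp add: M.act_id)
  define \<phi> where "\<phi> = (\<lambda>a\<in>carrier A. f (a, \<one>\<^bsub>G\<^esub>, \<one>\<^bsub>G\<^esub>))"
  have f_const: "f (a, \<one>\<^bsub>G\<^esub>, g) = \<phi> a" if "a \<in> carrier A" "g \<in> carrier G" for a g
    using cocyc[of a "\<one>\<^bsub>N\<^esub>" "\<one>\<^bsub>G\<^esub>" "\<one>\<^bsub>N\<^esub>" "\<one>\<^bsub>G\<^esub>" g] that f_right by (simp add: \<phi>_def M.act_id A_N)
  have f_central: "f (a \<bullet> m, h, g) = \<phi> a \<star> f (m, h, g)"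
    if "a \<in> carrier A" "m \<in> carrier N" "h \<in> carrier G" "g \<in> carrier G" for a m h g
    using cocyc[of "\<one>\<^bsub>N\<^esub>" a "\<one>\<^bsub>G\<^esub>" m h g] that by (simp add: f_const f_right M.act_id A_N)
  have \<phi>_closed [simp]: "\<phi> a \<in> carrier M" if "a \<in> carrier A" for a
    using that by (simp add: \<phi>_def A_N)
  have \<phi>: "\<phi> \<in> HomP P A (xpi1_act V) M act"
  proof (rule HomPI)
    fix a b assume "a \<in> carrier A" "b \<in> carrier A"
    then show "\<phi> (a \<bullet> b) = \<phi> a \<star> \<phi> b"
      using f_central[of a b "\<one>\<^bsub>G\<^esub>" "\<one>\<^bsub>G\<^esub>"] by (simp add: f_const A_N)
  next
    fix g a assume ga: "g \<in> carrier G" "a \<in> carrier A"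
    \<comment> \<open>The value of f at \<open>(g \<triangleright> a, g, 1)\<close> is computed
      twice: by the cocycle identity it is the action on the image of a, by \<open>f_central\<close>
      it is the image of \<open>g \<triangleright> a\<close>.\<close>
    have "f (g \<triangleright> a, g, \<one>\<^bsub>G\<^esub>) = act (cl g) (\<phi> a)"
      using cocyc[of "\<one>\<^bsub>N\<^esub>" "\<one>\<^bsub>N\<^esub>" g a "\<one>\<^bsub>G\<^esub>" "\<one>\<^bsub>G\<^esub>"] ga by (simp add: f_mid f_const A_N)
    then show "\<phi> (g \<triangleright> a) = act (cl g) (\<phi> a)"
      using f_central[of "g \<triangleright> a" "\<one>\<^bsub>N\<^esub>" g "\<one>\<^bsub>G\<^esub>"] ga by (simp add: f_mid xact_A A_N)
  qed (auto simp: \<phi>_def A_N)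
  \<comment> \<open>This \<open>b\<close> is chosen so that \<open>f\<close> minus its coboundary plus the defect term vanishes at \<open>(m,h,1)\<close>.\<close>
  define b where "b = (\<lambda>g\<in>carrier G. f (\<sigma> g, s (cl g), \<one>\<^bsub>G\<^esub>))"
  have b: "b \<in> carrier (xC1 V M)" by (auto simp: b_def xC1_def fun_group_carrier)
  have bM [simp]: "b g \<in> carrier M" if "g \<in> carrier G" for g using that by (simp add: b_def)
  have b1: "b \<one>\<^bsub>G\<^esub> = \<one>\<^bsub>M\<^esub>" by (simp add: b_def f1)
  have b_mu: "b (\<mu> m \<cdot> h) = \<phi> (defect m h \<one>\<^bsub>G\<^esub>) \<star> f (m, h, \<one>\<^bsub>G\<^esub>) \<star> b h"
    if mh: "m \<in> carrier N" "h \<in> carrier G" for m h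
  proof -
    have "f (m, h, \<one>\<^bsub>G\<^esub>) \<star> f (\<sigma> h, s (cl h), \<one>\<^bsub>G\<^esub>) = f (m \<bullet> \<sigma> h, s (cl h), \<one>\<^bsub>G\<^esub>)"
      using cocyc[of m "\<sigma> h" "s (cl h)" "\<one>\<^bsub>N\<^esub>" "\<one>\<^bsub>G\<^esub>" "\<one>\<^bsub>G\<^esub>"] mh by (simp add: mu_sigma f1)
    moreover have "b (\<mu> m \<cdot> h) = f (defect m h \<one>\<^bsub>G\<^esub> \<bullet> (m \<bullet> \<sigma> h), s (cl h), \<one>\<^bsub>G\<^esub>)"
      using mh defect_one_right[OF mh] by (simp add: b_def)
    ultimately show ?thesis
      using mh by (simp add: f_central b_def M.A.m_assoc)
  qed
  \<comment> \<open>Obtained by solving f = db - phi(defect) + c for c, before it is known that the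
    result depends on classes only.\<close>
  define e where "e = (\<lambda>(m,h,g). f (m,h,g) \<star> \<ominus>\<ominus> xd1 V M act b (m,h,g) \<star> \<phi> (defect m h g))"
  have xd1_b [simp]: "xd1 V M act b (m,h,g) \<in> carrier M"
    if "m \<in> carrier N" "h \<in> carrier G" "g \<in> carrier G" for m h g
    using that by (simp add: xd1_def)
  have eM [simp]: "e (m,h,g) \<in> carrier M"
    if "m \<in> carrier N" "h \<in> carrier G" "g \<in> carrier G" for m h g
    using that by (simp add: e_def)
  have e_one: "e (m,h,\<one>\<^bsub>G\<^esub>) = \<one>\<^bsub>M\<^esub>" if mh: "m \<in> carrier N" "h \<in> carrier G" for m h
    using M.A.normalisation_cancel[OF b_mu[OF mh]] mh by (simp add: e_def xd1_def b1)
  have e_cocyc: "e (p, \<mu> n \<cdot> k, \<mu> m \<cdot> h) \<star> e (n \<bullet> (k \<triangleright> m), k \<cdot> h, g)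
      = \<phi> (z (cl k, cl h, cl g)) \<star> (e (p \<bullet> n, k, h \<cdot> g) \<star> act (cl k) (e (m, h, g)))"
    if [simp]: "p \<in> carrier N" "n \<in> carrier N" "k \<in> carrier G" "m \<in> carrier N" "h \<in> carrier G" "g \<in> carrier G"
    for p n k m h g
  proof -
    have kA: "k \<triangleright> defect m h g \<in> carrier A" by (intro xact_A) auto
    have "\<phi> (defect p (\<mu> n \<cdot> k) (\<mu> m \<cdot> h)) \<star> \<phi> (defect (n \<bullet> (k \<triangleright> m)) (k \<cdot> h) g)
        = \<phi> (z (cl k, cl h, cl g)) \<star> (\<phi> (defect (p \<bullet> n) k (h \<cdot> g)) \<star> act (cl k) (\<phi> (defect m h g)))"
      using arg_cong[OF defect_cocycle[OF that], of \<phi>] by (simp add: HomP_mult[OF \<phi>] kA flip: HomP_act[OF \<phi>])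
    txt \<open>X\<close>
    from M.A.cocycle_quotient_mult[OF cocyc[OF that] xZ2_cocycle[OF xd2_xd1[OF b] that] this]
    show ?thesis by (simp add: e_def M.act_mult M.act_inv)
  qed
  have \<phi>_one: "\<phi> \<one>\<^bsub>N\<^esub> = \<one>\<^bsub>M\<^esub>"
    using f1 by (simp add: \<phi>_def carrier_A)
  have z_one: "z (r,q,p) = \<one>\<^bsub>N\<^esub>"
    if "r \<in> carrier P" "q \<in> carrier P" "p \<in> carrier P" "r = \<one>\<^bsub>P\<^esub> \<or> q = \<one>\<^bsub>P\<^esub> \<or> p = \<one>\<^bsub>P\<^esub>" for r q p
    using z_pointed that by (auto simp: cpt3_def one_A)
  \<comment> \<open>As \<open>z\<close> is pointed, the twist is absent whenever one of the three
    classes is 1. The arguments (p,1,1,1,1,g) give vanishing at (p,1,g), then (p,1,k,1,1,g) give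
    independence of p, and finally (1,n,k,m,h,1) give invariance under \<open>\<mu> n\<close> and
    \<open>\<mu> m\<close>.\<close>
  have e_left: "e (p, \<one>\<^bsub>G\<^esub>, g) = \<one>\<^bsub>M\<^esub>" if "p \<in> carrier N" "g \<in> carrier G" for p g
    using e_cocyc[of p "\<one>\<^bsub>N\<^esub>" "\<one>\<^bsub>G\<^esub>" "\<one>\<^bsub>N\<^esub>" "\<one>\<^bsub>G\<^esub>" g] that
    by (simp add: z_one \<phi>_one e_one M.act_id)
  have e_first: "e (p, k, g) = e (\<one>\<^bsub>N\<^esub>, k, g)" if "p \<in> carrier N" "k \<in> carrier G" "g \<in> carrier G" for p k g
    using e_cocyc[of p "\<one>\<^bsub>N\<^esub>" k "\<one>\<^bsub>N\<^esub>" "\<one>\<^bsub>G\<^esub>" g] that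
    by (simp add: z_one \<phi>_one e_one e_left)
  have e_mu: "e (\<one>\<^bsub>N\<^esub>, \<mu> n \<cdot> k, \<mu> m \<cdot> h) = e (\<one>\<^bsub>N\<^esub>, k, h)"
    if "n \<in> carrier N" "k \<in> carrier G" "m \<in> carrier N" "h \<in> carrier G" for n k m h
    using e_cocyc[of "\<one>\<^bsub>N\<^esub>" n k m h "\<one>\<^bsub>G\<^esub>"] that e_first[of n k h]
    by (simp add: z_one \<phi>_one e_one)
  define c where "c = (\<lambda>(q,p)\<in>carrier P \<times> carrier P. e (\<one>\<^bsub>N\<^esub>, s q, s p))"
  have c_e: "c (cl h, cl g) = e (m, h, g)" if "m \<in> carrier N" "h \<in> carrier G" "g \<in> carrier G" for m h g
    using e_mu[of "\<sigma> h" "s (cl h)" "\<sigma> g" "s (cl g)"] e_first[of m h g] that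
    by (simp add: c_def mu_sigma)
  have c: "c \<in> C2cpt P M"
    by (auto simp: c_def C2cpt_def C2_def fun_group_carrier cpt2_def e_one e_left)
  have "\<phi> (z (r,q,p)) = dg2 P M act c (r,q,p)" if "r \<in> carrier P" "q \<in> carrier P" "p \<in> carrier P" for r q p
  proof -
    have "c (r,q) \<star> c (r \<otimes>\<^bsub>P\<^esub> q, p) = \<phi> (z (r,q,p)) \<star> (c (r, q \<otimes>\<^bsub>P\<^esub> p) \<star> act r (c (q,p)))"
      using e_cocyc[of "\<one>\<^bsub>N\<^esub>" "\<one>\<^bsub>N\<^esub>" "s r" "\<one>\<^bsub>N\<^esub>" "s q" "s p"] that
        c_e[of "\<one>\<^bsub>N\<^esub>" "s r" "s q"] c_e[of "\<one>\<^bsub>N\<^esub>" "s r" "s q \<cdot> s p"]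
        c_e[of "\<one>\<^bsub>N\<^esub>" "s r \<cdot> s q" "s p"] c_e[of "\<one>\<^bsub>N\<^esub>" "s q" "s p"]
      by (simp add: cl_mult)
    from M.A.alternating4_eqI[OF this] show ?thesis
      using that by (simp add: dg2_def C2cpt_closed[OF c])
  qed
  then have "(\<phi>, c) \<in> T2" using \<phi> c by (simp add: T2_iff)
  moreover have "f = xd1 V M act b \<otimes>\<^bsub>xC2 V M\<^esub> \<Psi> (\<phi>, c)"
  proof (rule extensionalityI[of _ S2])
    fix x assume "x \<in> S2"
    then obtain m h g where x: "x = (m,h,g)" "m \<in> carrier N" "h \<in> carrier G" "g \<in> carrier G" by auto
    then show "f x = (xd1 V M act b \<otimes>\<^bsub>xC2 V M\<^esub> \<Psi> (\<phi>, c)) x"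
      using M.A.split_off[of "f (m,h,g)" "xd1 V M act b (m,h,g)" "\<phi> (defect m h g)"] c_e[of m h g]
      by (simp add: xC2_def fun_group_mult \<Psi>_def e_def)
  qed (use fC in \<open>auto simp: xC2_def fun_group_carrier PiE_iff fun_group_mult\<close>)
  ultimately show ?thesis using b by blast
qed

text \<open>The coboundary of a constant cochain takes the value of that constant at (1,1,1), so
  adding the coboundary of the constant inverse of f(1,1,1) reduces to the normalised case.\<close>

lemma cocycle_decomposition:
  assumes f: "f \<in> xZ2 V M act"
  shows "\<exists>x\<in>T2. \<exists>b\<in>xB2 V M act. f = b \<otimes>\<^bsub>xC2 V M\<^esub> \<Psi> x"
proof -
  interpret C1: comm_group "xC1 V M" by (rule xC1_group)
  interpret C2: comm_group "xC2 V M" by (rule xC2_group)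
  interpret d: group_hom "xC1 V M" "xC2 V M" "xd1 V M act"
    by (simp add: group_hom_def group_hom_axioms_def xd1_hom)
  have fC: "f \<in> carrier (xC2 V M)" using f by (simp add: xZ2_def)
  define t where "t = f (\<one>\<^bsub>N\<^esub>, \<one>\<^bsub>G\<^esub>, \<one>\<^bsub>G\<^esub>)"
  have t: "t \<in> carrier M" unfolding t_def using fC by (simp add: xC2_closed)
  define k where "k = (\<lambda>g\<in>carrier G. \<ominus>\<ominus> t)"
  have k: "k \<in> carrier (xC1 V M)" using t by (auto simp: k_def xC1_def fun_group_carrier)
  have dk: "xd1 V M act k \<in> carrier (xC2 V M)" using k by simp
  have "xd1 V M act k \<otimes>\<^bsub>xC2 V M\<^esub> f \<in> xZ2 V M act"
    using subgroup.m_closed[OF xZ2_subgroup xd2_xd1[OF k] f] .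
  moreover have "(xd1 V M act k \<otimes>\<^bsub>xC2 V M\<^esub> f) (\<one>\<^bsub>N\<^esub>, \<one>\<^bsub>G\<^esub>, \<one>\<^bsub>G\<^esub>) = \<one>\<^bsub>M\<^esub>"
    using t by (simp add: xC2_def fun_group_mult xd1_def k_def M.act_id flip: t_def)
  ultimately obtain x b where x: "x \<in> T2" and b: "b \<in> carrier (xC1 V M)"
    and eq: "xd1 V M act k \<otimes>\<^bsub>xC2 V M\<^esub> f = xd1 V M act b \<otimes>\<^bsub>xC2 V M\<^esub> \<Psi> x"
    using normalized_cocycle_decomposition by blast
  have \<Psi>: "\<Psi> x \<in> carrier (xC2 V M)" using Psi_cocycle[OF x] by (simp add: xZ2_def)
  have "f = xd1 V M act (inv\<^bsub>xC1 V M\<^esub> k) \<otimes>\<^bsub>xC2 V M\<^esub> (xd1 V M act k \<otimes>\<^bsub>xC2 V M\<^esub> f)"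
    using k fC by (simp add: C2.inv_cancel_left)
  also have "\<dots> = xd1 V M act (inv\<^bsub>xC1 V M\<^esub> k \<otimes>\<^bsub>xC1 V M\<^esub> b) \<otimes>\<^bsub>xC2 V M\<^esub> \<Psi> x"
    using k b \<Psi> by (simp add: eq C2.m_assoc)
  finally have "f = xd1 V M act (inv\<^bsub>xC1 V M\<^esub> k \<otimes>\<^bsub>xC1 V M\<^esub> b) \<otimes>\<^bsub>xC2 V M\<^esub> \<Psi> x" .
  moreover have "xd1 V M act (inv\<^bsub>xC1 V M\<^esub> k \<otimes>\<^bsub>xC1 V M\<^esub> b) \<in> xB2 V M act"
    unfolding xB2_def using k b by (intro imageI) simp
  ultimately show ?thesis using x by blast
qed

lemma xH2_iso: "xH2 V M act \<cong> H2_triple P A (xpi1_act V) z M act"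
  unfolding xH2_def H2_triple_def
proof (rule quotient_isoI[OF T2_group xZ2_group xB2_subgroup Psi_hom])
  show "B2_triple P A M act = {x \<in> carrier (E\<lparr>carrier := T2\<rparr>). \<Psi> x \<in> xB2 V M act}"
    by (simp add: Psi_boundary_iff)
qed (use cocycle_decomposition in simp)

end

lemma crossed_module_H2_iso:
  assumes "crossed_module V" "is_module (xpi0 V) M act"
    and "z \<in> Z3cpt (xpi0 V) (xpi1 V) (xpi1_act V)"
    and "H3cpt_class (xpi0 V) (xpi1 V) (xpi1_act V) z = k3 V"
  shows "xH2 V M act \<cong> H2_triple (xpi0 V) (xpi1 V) (xpi1_act V) z M act"
proof -
  interpret xmodule_coeff V M act
    using assms(1,2) by (simp add: xmodule_coeff_def xmodule_def gmodule_def)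
  obtain s Z where "postnikov_lift V s Z z"
    using postnikov_lift_exists assms(3,4) by blast
  then interpret lift_coeff V s Z z M act
    by (simp add: lift_coeff_def xmodule_coeff_axioms)
  show ?thesis by (rule xH2_iso)
qed

section \<open>Simplicial groups\<close>

locale simplicial =
  fixes S :: "'g sgroup"
  assumes simplicial: "simplicial_group S"
begin

definition "G0 = sgrp S 0"
definition "G1 = sgrp S 1"
definition "G2 = sgrp S 2"
definition "a0 = sface S 1 0"
definition "a1 = sface S 1 1"
definition "e0 = sface S 2 0"
definition "e1 = sface S 2 1"
definition "e2 = sface S 2 2"
definition "t = sdeg S 0 0"
definition "u0 = sdeg S 1 0"
definition "u1 = sdeg S 1 1"

lemmas low_dim = G0_def G1_def G2_def a0_def a1_def e0_def e1_def e2_def t_def u0_def u1_def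

lemma level_group: "group (sgrp S n)"
  using simplicial unfolding simplicial_group_def by (elim conjE) (erule spec)

sublocale G0: group G0 + G1: group G1 + G2: group G2
  by (simp_all add: low_dim level_group)

lemma face_hom: "i \<le> Suc n \<Longrightarrow> sface S (Suc n) i \<in> hom (sgrp S (Suc n)) (sgrp S n)"
  and deg_hom: "j \<le> n \<Longrightarrow> sdeg S n j \<in> hom (sgrp S n) (sgrp S (Suc n))"
  and face_face: "i < j \<Longrightarrow> j \<le> Suc (Suc n) \<Longrightarrow> x \<in> carrier (sgrp S (Suc (Suc n))) \<Longrightarrow>
    sface S (Suc n) i (sface S (Suc (Suc n)) j x) = sface S (Suc n) (j - 1) (sface S (Suc (Suc n)) i x)"
  and face_deg_less: "i < j \<Longrightarrow> j \<le> Suc n \<Longrightarrow> x \<in> carrier (sgrp S (Suc n)) \<Longrightarrow>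
    sface S (Suc (Suc n)) i (sdeg S (Suc n) j x) = sdeg S n (j - 1) (sface S (Suc n) i x)"
  and face_deg_same: "j \<le> n \<Longrightarrow> x \<in> carrier (sgrp S n) \<Longrightarrow> sface S (Suc n) j (sdeg S n j x) = x"
  and face_deg_next: "j \<le> n \<Longrightarrow> x \<in> carrier (sgrp S n) \<Longrightarrow> sface S (Suc n) (Suc j) (sdeg S n j x) = x"
  and face_deg_greater: "Suc j < i \<Longrightarrow> i \<le> Suc (Suc n) \<Longrightarrow> x \<in> carrier (sgrp S (Suc n)) \<Longrightarrow>
    sface S (Suc (Suc n)) i (sdeg S (Suc n) j x) = sdeg S n j (sface S (Suc n) (i - 1) x)"
proof -
  note * = simplicial[unfolded simplicial_group_def]
  show "i \<le> Suc n \<Longrightarrow> sface S (Suc n) i \<in> hom (sgrp S (Suc n)) (sgrp S n)"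
    using *[THEN conjunct2, THEN conjunct1] by simp
  show "j \<le> n \<Longrightarrow> sdeg S n j \<in> hom (sgrp S n) (sgrp S (Suc n))"
    using *[THEN conjunct2, THEN conjunct2, THEN conjunct1] by simp
  show "i < j \<Longrightarrow> j \<le> Suc (Suc n) \<Longrightarrow> x \<in> carrier (sgrp S (Suc (Suc n))) \<Longrightarrow>
      sface S (Suc n) i (sface S (Suc (Suc n)) j x) = sface S (Suc n) (j - 1) (sface S (Suc (Suc n)) i x)"
    using *[THEN conjunct2, THEN conjunct2, THEN conjunct2, THEN conjunct1] by simp
  note * = *[THEN conjunct2, THEN conjunct2, THEN conjunct2, THEN conjunct2]
  show "i < j \<Longrightarrow> j \<le> Suc n \<Longrightarrow> x \<in> carrier (sgrp S (Suc n)) \<Longrightarrow>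
      sface S (Suc (Suc n)) i (sdeg S (Suc n) j x) = sdeg S n (j - 1) (sface S (Suc n) i x)"
    using *[THEN conjunct1] by simp
  show "j \<le> n \<Longrightarrow> x \<in> carrier (sgrp S n) \<Longrightarrow> sface S (Suc n) j (sdeg S n j x) = x"
    using *[THEN conjunct2, THEN conjunct1] by simp
  show "j \<le> n \<Longrightarrow> x \<in> carrier (sgrp S n) \<Longrightarrow> sface S (Suc n) (Suc j) (sdeg S n j x) = x"
    using *[THEN conjunct2, THEN conjunct1] by simp
  show "Suc j < i \<Longrightarrow> i \<le> Suc (Suc n) \<Longrightarrow> x \<in> carrier (sgrp S (Suc n)) \<Longrightarrow>
      sface S (Suc (Suc n)) i (sdeg S (Suc n) j x) = sdeg S n j (sface S (Suc n) (i - 1) x)"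
    using *[THEN conjunct2, THEN conjunct2, THEN conjunct1] by simp
qed

lemma low_dim_homs: "a0 \<in> hom G1 G0" "a1 \<in> hom G1 G0" "e0 \<in> hom G2 G1" "e1 \<in> hom G2 G1" "e2 \<in> hom G2 G1"
  "t \<in> hom G0 G1" "u0 \<in> hom G1 G2" "u1 \<in> hom G1 G2"
  using face_hom[of 0 0] face_hom[of 1 0] face_hom[of 0 1] face_hom[of 1 1] face_hom[of 2 1]
    deg_hom[of 0 0] deg_hom[of 0 1] deg_hom[of 1 1]
  by (simp_all add: low_dim numeral_2_eq_2)

sublocale a0: group_hom G1 G0 a0 + a1: group_hom G1 G0 a1
  + e0: group_hom G2 G1 e0 + e1: group_hom G2 G1 e1 + e2: group_hom G2 G1 e2
  + t: group_hom G0 G1 t + u0: group_hom G1 G2 u0 + u1: group_hom G1 G2 u1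
  using low_dim_homs by unfold_locales

lemma low_dim_identities:
  "x \<in> carrier G2 \<Longrightarrow> a0 (e1 x) = a0 (e0 x)"
  "x \<in> carrier G2 \<Longrightarrow> a1 (e0 x) = a0 (e2 x)"
  "x \<in> carrier G2 \<Longrightarrow> a1 (e1 x) = a1 (e2 x)"
  "g \<in> carrier G0 \<Longrightarrow> a0 (t g) = g" "g \<in> carrier G0 \<Longrightarrow> a1 (t g) = g"
  "y \<in> carrier G1 \<Longrightarrow> e0 (u0 y) = y" "y \<in> carrier G1 \<Longrightarrow> e1 (u0 y) = y"
  "y \<in> carrier G1 \<Longrightarrow> e2 (u0 y) = t (a1 y)"
  "y \<in> carrier G1 \<Longrightarrow> e0 (u1 y) = t (a0 y)"
  "y \<in> carrier G1 \<Longrightarrow> e1 (u1 y) = y" "y \<in> carrier G1 \<Longrightarrow> e2 (u1 y) = y"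
  using face_face[of 0 1 0 x] face_face[of 0 2 0 x] face_face[of 1 2 0 x]
    face_deg_same[of 0 0 g] face_deg_next[of 0 0 g]
    face_deg_same[of 0 1 y] face_deg_next[of 0 1 y] face_deg_greater[of 0 2 0 y]
    face_deg_less[of 0 1 0 y] face_deg_same[of 1 1 y] face_deg_next[of 1 1 y]
  by (simp_all add: low_dim numeral_2_eq_2)

declare low_dim_identities [simp]

section \<open>The crossed module segment of a simplicial group\<close>

abbreviation mult1 (infixl \<open>\<cdot>\<close> 70) where "x \<cdot> y \<equiv> x \<otimes>\<^bsub>G1\<^esub> y"
abbreviation "NN \<equiv> N1 S"
abbreviation "K \<equiv> BN1 S"
abbreviation "V \<equiv> T1 S"

lemma NN_iff: "x \<in> NN \<longleftrightarrow> x \<in> carrier G1 \<and> a1 x = \<one>\<^bsub>G0\<^esub>"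
  by (simp add: N1_def low_dim)

lemma N2_iff: "x \<in> N2 S \<longleftrightarrow> x \<in> carrier G2 \<and> e1 x = \<one>\<^bsub>G1\<^esub> \<and> e2 x = \<one>\<^bsub>G1\<^esub>"
  by (simp add: N2_def low_dim)

lemma K_eq: "K = e0 ` N2 S"
  by (simp add: BN1_def low_dim)

text \<open>Congruences modulo B_1NG are proved below by exhibiting such an x: a product of
  degenerate elements, possibly with a given element of \<open>G2\<close> or
  \<open>N2\<close>.\<close>

lemma K_I: "x \<in> carrier G2 \<Longrightarrow> e1 x = \<one>\<^bsub>G1\<^esub> \<Longrightarrow> e2 x = \<one>\<^bsub>G1\<^esub> \<Longrightarrow> e0 x = y \<Longrightarrow> y \<in> K"
  by (auto simp: K_eq N2_iff)

lemma K_closed: "y \<in> K \<Longrightarrow> y \<in> carrier G1" and a0_K: "y \<in> K \<Longrightarrow> a0 y = \<one>\<^bsub>G0\<^esub>"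
  and a1_K: "y \<in> K \<Longrightarrow> a1 y = \<one>\<^bsub>G0\<^esub>"
  by (auto simp: K_eq N2_iff simp flip: low_dim_identities(1))

sublocale K: normal K G1
proof -
  have "subgroup (N2 S) G2"
    using G2.one_closed by (intro G2.subgroupI) (auto simp: N2_iff ex_in_conv[symmetric] simp del: G2.one_closed)
  then have "subgroup K G1" unfolding K_eq by (rule e0.subgroup_img_is_subgroup)
  moreover have "x \<cdot> y \<cdot> inv\<^bsub>G1\<^esub> x \<in> K" if xy: "x \<in> carrier G1" "y \<in> K" for x y
  proof -
    obtain w where "y = e0 w" "w \<in> carrier G2" "e1 w = \<one>\<^bsub>G1\<^esub>" "e2 w = \<one>\<^bsub>G1\<^esub>"
      using xy(2) by (auto simp: K_eq N2_iff)
    then show ?thesis using xy(1)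
      \<comment> \<open>Conjugation by \<open>u0 x\<close> induces conjugation by x on the face
        \<open>e0\<close>, while the faces \<open>e1\<close> and \<open>e2\<close> of w are trivial
        and stay so.\<close>
      by (intro K_I[of "u0 x \<otimes>\<^bsub>G2\<^esub> w \<otimes>\<^bsub>G2\<^esub> inv\<^bsub>G2\<^esub> u0 x"]) simp_all
  qed
  ultimately show "normal K G1" by (simp add: G1.normal_inv_iff)
qed

lemma NN_subgroup: "subgroup NN G1"
proof -
  have "NN = kernel G1 G0 a1" by (auto simp: NN_iff kernel_def)
  then show ?thesis using a1.subgroup_kernel by simp
qed

lemma K_subset_NN: "K \<subseteq> NN"
  by (auto simp: NN_iff K_closed a1_K)

definition cls :: "'g \<Rightarrow> 'g set" where "cls x = K #>\<^bsub>G1\<^esub> x"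

lemma cls_mult: "x \<in> carrier G1 \<Longrightarrow> y \<in> carrier G1 \<Longrightarrow> cls x <#>\<^bsub>G1\<^esub> cls y = cls (x \<cdot> y)"
  by (simp add: cls_def K.rcos_sum)

lemma cls_eqI: "x \<in> carrier G1 \<Longrightarrow> y \<in> carrier G1 \<Longrightarrow> x \<cdot> inv\<^bsub>G1\<^esub> y \<in> K \<Longrightarrow> cls x = cls y"
  using G1.coset_mult_inv1[of K x y] K.subset
  unfolding cls_def
  by (metis G1.coset_join2 G1.coset_mult_inv1 G1.inv_closed G1.m_closed K.subgroup_axioms)

lemma cls_K_mult: "k \<in> K \<Longrightarrow> x \<in> carrier G1 \<Longrightarrow> cls (k \<cdot> x) = cls x"
  by (rule cls_eqI) (auto simp: K_closed G1.m_assoc)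

text \<open>The operations of \<open>T1\<close> pick representatives of cosets; this bounds the
  ambiguity by \<open>K\<close>, on which \<open>a0\<close> is trivial and which is stable under
  conjugation.\<close>

lemma some_cls:
  obtains k where "k \<in> K" "(SOME y. y \<in> cls x) = k \<cdot> x"
proof -
  have "\<one>\<^bsub>G1\<^esub> \<cdot> x \<in> cls x" using K.one_closed by (auto simp: cls_def r_coset_def)
  then have "(SOME y. y \<in> cls x) \<in> cls x" by (rule someI)
  then show ?thesis using that by (auto simp: cls_def r_coset_def)
qed

lemma xG_T1: "xG V = G0" and xM_T1: "xM V = (G1\<lparr>carrier := NN\<rparr>) Mod K"
  by (simp_all add: T1_def low_dim)

lemma carrier_xM_T1: "carrier (xM V) = cls ` NN"
  by (simp add: xM_T1 carrier_FactGroup cls_def[abs_def] r_coset_def)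

lemma mult_xM_T1: "C \<otimes>\<^bsub>xM V\<^esub> D = C <#>\<^bsub>G1\<^esub> D"
  by (simp add: xM_T1 set_mult_def)

lemma one_xM_T1: "\<one>\<^bsub>xM V\<^esub> = cls \<one>\<^bsub>G1\<^esub>"
  by (simp add: xM_T1 cls_def G1.coset_mult_one K.subset)

lemma group_xM_T1: "group (xM V)"
  unfolding xM_T1
  by (rule normal.factorgroup_is_group) (rule G1.normal_restrict_supergroup[OF NN_subgroup K.normal_axioms K_subset_NN])

lemma NN_closed: "x \<in> NN \<Longrightarrow> x \<in> carrier G1" and a1_NN: "x \<in> NN \<Longrightarrow> a1 x = \<one>\<^bsub>G0\<^esub>"
  by (auto simp: NN_iff)

lemma xmu_T1_some: "xmu V C = a0 (SOME x. x \<in> C)"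
  and xact_T1_some: "xact V g C = cls (t g \<cdot> (SOME x. x \<in> C) \<cdot> inv\<^bsub>G1\<^esub> t g)"
  by (simp_all add: T1_def cls_def low_dim)

lemma xmu_T1: "x \<in> carrier G1 \<Longrightarrow> xmu V (cls x) = a0 x"
proof -
  assume x: "x \<in> carrier G1"
  obtain k where "k \<in> K" "(SOME y. y \<in> cls x) = k \<cdot> x" by (rule some_cls)
  then show ?thesis using x by (simp add: xmu_T1_some a0_K K_closed)
qed

lemma xact_T1:
  assumes "g \<in> carrier G0" "x \<in> carrier G1"
  shows "xact V g (cls x) = cls (t g \<cdot> x \<cdot> inv\<^bsub>G1\<^esub> t g)"
proof -
  obtain k where k: "k \<in> K" "(SOME y. y \<in> cls x) = k \<cdot> x" by (rule some_cls)
  have "xact V g (cls x) = cls (t g \<cdot> (k \<cdot> x) \<cdot> inv\<^bsub>G1\<^esub> t g)"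
    by (simp add: xact_T1_some k(2))
  also have "t g \<cdot> (k \<cdot> x) \<cdot> inv\<^bsub>G1\<^esub> t g = (t g \<cdot> k \<cdot> inv\<^bsub>G1\<^esub> t g) \<cdot> (t g \<cdot> x \<cdot> inv\<^bsub>G1\<^esub> t g)"
    using assms k K_closed by (simp add: G1.m_assoc G1.inv_cancel_left)
  finally show ?thesis
    using assms k K.inv_op_closed2 by (simp add: cls_K_mult)
qed

lemma conj_NN: "g \<in> carrier G0 \<Longrightarrow> x \<in> NN \<Longrightarrow> t g \<cdot> x \<cdot> inv\<^bsub>G1\<^esub> t g \<in> NN"
  by (simp add: NN_iff)

lemma inv_xM_T1: "x \<in> NN \<Longrightarrow> inv\<^bsub>xM V\<^esub> (cls x) = cls (inv\<^bsub>G1\<^esub> x)"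
  using subgroup.m_inv_closed[OF NN_subgroup]
  by (intro group.inv_equality[OF group_xM_T1])
    (auto simp: mult_xM_T1 cls_mult NN_closed one_xM_T1 carrier_xM_T1)

text \<open>The witness is a product of two conjugates whose faces under \<open>e1\<close> cancel,
  because both become n m n^-1 up to inversion, and whose faces under \<open>e2\<close> vanish
  because \<open>a1\<close> kills m and n. Under \<open>e0\<close> the degeneracy
  \<open>u1 n\<close> becomes \<open>t (a0 n)\<close>, while \<open>u0 n\<close> becomes n, which
  leaves the quotient of the two sides.\<close>

lemma T1_peiffer:
  assumes "m \<in> NN" "n \<in> NN"
  shows "cls (t (a0 n) \<cdot> m \<cdot> inv\<^bsub>G1\<^esub> t (a0 n)) = cls (n \<cdot> m \<cdot> inv\<^bsub>G1\<^esub> n)"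
proof (rule cls_eqI)
  have [simp]: "m \<in> carrier G1" "n \<in> carrier G1" "a1 m = \<one>\<^bsub>G0\<^esub>" "a1 n = \<one>\<^bsub>G0\<^esub>"
    using assms by (auto simp: NN_iff)
  let ?w = "u1 n \<otimes>\<^bsub>G2\<^esub> u0 m \<otimes>\<^bsub>G2\<^esub> inv\<^bsub>G2\<^esub> u1 n \<otimes>\<^bsub>G2\<^esub> (u0 n \<otimes>\<^bsub>G2\<^esub> inv\<^bsub>G2\<^esub> u0 m \<otimes>\<^bsub>G2\<^esub> inv\<^bsub>G2\<^esub> u0 n)"
  show "t (a0 n) \<cdot> m \<cdot> inv\<^bsub>G1\<^esub> t (a0 n) \<cdot> inv\<^bsub>G1\<^esub> (n \<cdot> m \<cdot> inv\<^bsub>G1\<^esub> n) \<in> K"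
    by (rule K_I[of ?w]) (simp_all add: G1.m_assoc G1.inv_mult_group G1.inv_cancel_left G1.cancel_inv_left)
qed (use assms in \<open>simp_all add: NN_closed\<close>)

lemma crossed_module_T1: "crossed_module V"
  unfolding crossed_module_def
proof (intro conjI ballI)
  show "group (xG V)" by (simp add: xG_T1)
  show "group (xM V)" by (rule group_xM_T1)
  show "xmu V \<in> hom (xM V) (xG V)"
    by (auto simp: hom_def carrier_xM_T1 xmu_T1 mult_xM_T1 cls_mult NN_closed xG_T1)
  fix C assume "C \<in> carrier (xM V)"
  then obtain m where m: "C = cls m" "m \<in> NN" by (auto simp: carrier_xM_T1)
  then have [simp]: "m \<in> carrier G1" by (simp add: NN_closed)
  show "xact V \<one>\<^bsub>xG V\<^esub> C = C"
    by (simp add: m xact_T1 xG_T1)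
  {
    fix D assume "D \<in> carrier (xM V)"
    then obtain n where n: "D = cls n" "n \<in> NN" by (auto simp: carrier_xM_T1)
    then have [simp]: "n \<in> carrier G1" by (simp add: NN_closed)
    show "xact V (xmu V D) C = D \<otimes>\<^bsub>xM V\<^esub> C \<otimes>\<^bsub>xM V\<^esub> inv\<^bsub>xM V\<^esub> D"
      using m(2) n(2) by (simp add: m(1) n(1) xact_T1 xmu_T1 inv_xM_T1 mult_xM_T1 cls_mult T1_peiffer)
    fix g assume "g \<in> carrier (xG V)"
    then have [simp]: "g \<in> carrier G0" by (simp add: xG_T1)
    have "t g \<cdot> (m \<cdot> n) \<cdot> inv\<^bsub>G1\<^esub> t g = (t g \<cdot> m \<cdot> inv\<^bsub>G1\<^esub> t g) \<cdot> (t g \<cdot> n \<cdot> inv\<^bsub>G1\<^esub> t g)"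
      by (simp add: G1.m_assoc G1.inv_cancel_left)
    then show "xact V g (C \<otimes>\<^bsub>xM V\<^esub> D) = xact V g C \<otimes>\<^bsub>xM V\<^esub> xact V g D"
      by (simp add: m n mult_xM_T1 cls_mult xact_T1)
  }
  fix g assume "g \<in> carrier (xG V)"
  then have [simp]: "g \<in> carrier G0" by (simp add: xG_T1)
  show "xact V g C \<in> carrier (xM V)"
    using m by (simp add: xact_T1 carrier_xM_T1 conj_NN)
  show "xmu V (xact V g C) = g \<otimes>\<^bsub>xG V\<^esub> xmu V C \<otimes>\<^bsub>xG V\<^esub> inv\<^bsub>xG V\<^esub> g"
    by (simp add: m xact_T1 xmu_T1 xG_T1)
  fix h assume "h \<in> carrier (xG V)"
  then have [simp]: "h \<in> carrier G0" by (simp add: xG_T1)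
  show "xact V (g \<otimes>\<^bsub>xG V\<^esub> h) C = xact V g (xact V h C)"
    by (simp add: m xact_T1 xG_T1 G1.inv_mult_group G1.m_assoc)
qed

lemma BN0_T1: "xmu V ` carrier (xM V) = BN0 S"
proof -
  have "BN0 S = a0 ` NN" by (simp add: BN0_def a0_def)
  then show ?thesis by (simp add: carrier_xM_T1 image_image xmu_T1 NN_closed cong: image_cong)
qed

lemma xpi0_T1: "xpi0 V = spi0 S"
  unfolding xpi0_def spi0_def BN0_T1 xG_T1 by (simp add: low_dim)

lemma xcls_T1: "xcls V g = BN0 S #>\<^bsub>G0\<^esub> g"
  unfolding xcls_def BN0_T1 xG_T1 ..

text \<open>An equality of records, not just an isomorphism, so cocycles and triples for the segment
  are literally those for the simplicial group.\<close>

lemma xpi1_T1: "xpi1 V = spi1 S"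
proof -
  have "kernel (xM V) (xG V) (xmu V) = cls ` {x \<in> NN. a0 x = \<one>\<^bsub>G0\<^esub>}"
    by (auto simp: kernel_def carrier_xM_T1 xmu_T1 NN_closed xG_T1)
  moreover have "spi1 S = (G1\<lparr>carrier := {x \<in> NN. a0 x = \<one>\<^bsub>G0\<^esub>}\<rparr>) Mod K"
    by (simp add: spi1_def low_dim)
  ultimately show ?thesis
    by (simp add: xpi1_def xM_T1 FactGroup_def RCOSETS_def cls_def[abs_def] r_coset_def set_mult_def[abs_def])
      blast
qed

lemma xpi1_act_T1: "xpi1_act V = spi1_act S"
  by (simp add: fun_eq_iff xpi1_act_def spi1_act_def)

end

section \<open>Pulling cocycles back from the segment to the simplicial group\<close>

locale simplicial_coeff = simplicial S for S :: "'g sgroup" +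
  fixes M :: "('a,'y) monoid_scheme" and act :: "'g set \<Rightarrow> 'a \<Rightarrow> 'a"
  assumes module: "is_module (spi0 S) M act"
begin

sublocale T: xmodule_coeff "T1 S" M act
  using crossed_module_T1 module
  by (simp add: xmodule_coeff_def xmodule_def gmodule_def xpi0_T1)

abbreviation "D2 \<equiv> carrier G1 \<times> carrier G0"
abbreviation "D3 \<equiv> carrier G2 \<times> carrier G1 \<times> carrier G0"

text \<open>\<open>G1\<close> is a semidirect product of \<open>NN\<close> and the degenerate copy
  of \<open>G0\<close>: y = x t(h) with h = \<open>a1 y\<close>. The formula reads off the class of
  x together with h.\<close>

definition pull :: "('g set \<times> 'g \<times> 'g \<Rightarrow> 'a) \<Rightarrow> 'g \<times> 'g \<Rightarrow> 'a" where
  "pull c = (\<lambda>(y,g)\<in>D2. c (cls (y \<cdot> inv\<^bsub>G1\<^esub> t (a1 y)), a1 y, g))"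

lemma sC2_eq: "sC2 S M = fun_group D2 M"
  by (simp add: sC2_def low_dim)

lemma sd2_eq: "g2 \<in> carrier G2 \<Longrightarrow> g1 \<in> carrier G1 \<Longrightarrow> g0 \<in> carrier G0 \<Longrightarrow>
   sd2 S M act c (g2,g1,g0) = c (e0 g2, a0 g1) \<otimes>\<^bsub>M\<^esub> inv\<^bsub>M\<^esub> c (e1 g2, a1 g1 \<otimes>\<^bsub>G0\<^esub> g0)
      \<otimes>\<^bsub>M\<^esub> c (e2 g2 \<cdot> g1, g0) \<otimes>\<^bsub>M\<^esub> inv\<^bsub>M\<^esub> act (xcls V (a1 (e2 g2))) (c (g1,g0))"
  by (simp add: sd2_def scls2_def xcls_T1 low_dim)

lemma sd2_extensional: "sd2 S M act c \<in> extensional D3"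
  by (auto simp: sd2_def low_dim)

lemma section_NN: "y \<in> carrier G1 \<Longrightarrow> y \<cdot> inv\<^bsub>G1\<^esub> t (a1 y) \<in> NN"
  by (simp add: NN_iff)

lemma cls_closed: "x \<in> NN \<Longrightarrow> cls x \<in> carrier (xM V)"
  by (simp add: carrier_xM_T1)

text \<open>An element of \<open>G2\<close> yields coordinates p, n, k from its faces
  \<open>e0\<close> and \<open>e2\<close>. That its face \<open>e1\<close> has first coordinate pn
  holds only modulo B_1NG, and this is where passing to the quotient is needed.\<close>

lemma sd2_pull:
  assumes [simp]: "g2 \<in> carrier G2" "g1 \<in> carrier G1" "g0 \<in> carrier G0"
  shows "sd2 S M act (pull c) (g2,g1,g0) = xd2 V M act c
    (cls (e0 g2 \<cdot> inv\<^bsub>G1\<^esub> t (a1 (e0 g2))), cls (e2 g2 \<cdot> inv\<^bsub>G1\<^esub> t (a1 (e2 g2))), a1 (e2 g2),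
     cls (g1 \<cdot> inv\<^bsub>G1\<^esub> t (a1 g1)), a1 g1, g0)"
proof -
  let ?k = "a1 (e2 g2)" and ?h = "a1 g1"
  let ?p = "e0 g2 \<cdot> inv\<^bsub>G1\<^esub> t (a0 (e2 g2))" and ?n = "e2 g2 \<cdot> inv\<^bsub>G1\<^esub> t ?k" and ?m = "g1 \<cdot> inv\<^bsub>G1\<^esub> t ?h"
  have NN [simp]: "?p \<in> NN" "?n \<in> NN" "?m \<in> NN"
    using section_NN[of "e0 g2"] section_NN[of "e2 g2"] section_NN[of g1] by simp_all
  have mu_n: "xmu V (cls ?n) \<otimes>\<^bsub>G0\<^esub> ?k = a0 (e2 g2)" and mu_m: "xmu V (cls ?m) \<otimes>\<^bsub>G0\<^esub> ?h = a0 g1"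
    by (simp_all add: xmu_T1 G0.m_assoc)
  have pn: "cls ?p \<otimes>\<^bsub>xM V\<^esub> cls ?n = cls (e1 g2 \<cdot> inv\<^bsub>G1\<^esub> t ?k)"
  proof -
    \<comment> \<open>\<open>g2\<close> corrected by degenerate elements: the faces
      \<open>e1\<close> and \<open>e2\<close> telescope to 1, and the face \<open>e0\<close> is the
      quotient of the two sides of \<open>pn\<close>.\<close>
    let ?w = "g2 \<otimes>\<^bsub>G2\<^esub> inv\<^bsub>G2\<^esub> u1 (e2 g2) \<otimes>\<^bsub>G2\<^esub> u0 (e2 g2) \<otimes>\<^bsub>G2\<^esub> inv\<^bsub>G2\<^esub> u0 (e1 g2)"
    have "cls (?p \<cdot> ?n) = cls (e1 g2 \<cdot> inv\<^bsub>G1\<^esub> t ?k)"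
      by (rule cls_eqI, simp, simp, rule K_I[of ?w])
        (simp_all add: G1.m_assoc G1.inv_mult_group G1.inv_cancel_left G1.cancel_inv_left)
    then show ?thesis by (simp add: mult_xM_T1 cls_mult)
  qed
  have nkm: "cls ?n \<otimes>\<^bsub>xM V\<^esub> xact V ?k (cls ?m) = cls ((e2 g2 \<cdot> g1) \<cdot> inv\<^bsub>G1\<^esub> t (?k \<otimes>\<^bsub>G0\<^esub> ?h))"
    by (simp add: xact_T1 mult_xM_T1 cls_mult G1.m_assoc G1.inv_mult_group G1.inv_cancel_left)
  show ?thesis
    using NN[THEN cls_closed]
    by (simp add: sd2_eq xd2_def pull_def xG_T1 mu_n mu_m pn nkm)
qed

lemma sd1_pull:
  "sd1 S M act b = pull (xd1 V M act b)"
proof (rule extensionalityI[of _ D2])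
  show "sd1 S M act b \<in> extensional D2" by (auto simp: sd1_def low_dim)
  show "pull (xd1 V M act b) \<in> extensional D2" by (auto simp: pull_def)
  fix x assume "x \<in> D2"
  then obtain y g where x: "x = (y, g)" and [simp]: "y \<in> carrier G1" "g \<in> carrier G0" by auto
  have mu: "xmu V (cls (y \<cdot> inv\<^bsub>G1\<^esub> t (a1 y))) \<otimes>\<^bsub>G0\<^esub> a1 y = a0 y"
    by (simp add: xmu_T1 G0.m_assoc)
  have "sd1 S M act b x = b (a0 y) \<otimes>\<^bsub>M\<^esub> inv\<^bsub>M\<^esub> b (a1 y \<otimes>\<^bsub>G0\<^esub> g) \<otimes>\<^bsub>M\<^esub> act (xcls V (a1 y)) (b g)"
    using \<open>x \<in> D2\<close> by (simp add: x sd1_def scls1_def xcls_T1 low_dim)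
  then show "sd1 S M act b x = pull (xd1 V M act b) x"
    by (simp add: x pull_def xd1_def xG_T1 mu cls_closed section_NN)
qed

lemma sC2_group: "comm_group (sC2 S M)"
  by (simp add: sC2_def fun_group_comm_group T.M.A.comm_group_axioms)

lemma sZ2_iff:
  "f \<in> sZ2 S M act \<longleftrightarrow> f \<in> carrier (sC2 S M) \<and>
    (\<forall>g2\<in>carrier G2. \<forall>g1\<in>carrier G1. \<forall>g0\<in>carrier G0. sd2 S M act f (g2,g1,g0) = \<one>\<^bsub>M\<^esub>)"
proof -
  have "sd2 S M act f = \<one>\<^bsub>fun_group D3 M\<^esub> \<longleftrightarrow> (\<forall>x\<in>D3. sd2 S M act f x = \<one>\<^bsub>M\<^esub>)"
    using sd2_extensional[of f] by (auto simp: fun_group_one fun_eq_iff extensional_def)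
  then show ?thesis by (auto simp: sZ2_def low_dim)
qed

lemma sC2_closed: "f \<in> carrier (sC2 S M) \<Longrightarrow> y \<in> carrier G1 \<Longrightarrow> g \<in> carrier G0 \<Longrightarrow> f (y,g) \<in> carrier M"
  by (auto simp: sC2_eq fun_group_carrier)

lemma scls_closed: "g \<in> carrier G0 \<Longrightarrow> xcls V g \<in> carrier (xpi0 V)"
  using T.cl_closed by (simp add: xG_T1)

lemma sd2_hom: "sd2 S M act \<in> hom (sC2 S M) (fun_group D3 M)"
  unfolding sC2_eq
proof (rule fun_group_homI)
  fix f g x
  assume fg: "f \<in> carrier (fun_group D2 M)" "g \<in> carrier (fun_group D2 M)" and x: "x \<in> D3"
  note [simp] = T.M.fun_closed[OF fg(1)] T.M.fun_closed[OF fg(2)]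
  show "sd2 S M act (f \<otimes>\<^bsub>fun_group D2 M\<^esub> g) x = sd2 S M act f x \<otimes>\<^bsub>M\<^esub> sd2 S M act g x"
    using x by (auto simp: sd2_eq fun_group_mult T.M.act_mult scls_closed intro!: T.M.A.alternating4_mult)
qed (auto simp: sd2_eq T.M.fun_closed T.M.A.comm_group_axioms scls_closed sd2_extensional)

lemma sZ2_subgroup: "subgroup (sZ2 S M act) (sC2 S M)"
proof -
  interpret F: comm_group "fun_group D3 M" by (rule fun_group_comm_group) (rule T.M.A.comm_group_axioms)
  interpret C: comm_group "sC2 S M" by (rule sC2_group)
  interpret d: group_hom "sC2 S M" "fun_group D3 M" "sd2 S M act"
    by (simp add: group_hom_def group_hom_axioms_def sd2_hom)
  show ?thesis using d.subgroup_kernel by (simp add: kernel_def sZ2_def low_dim)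
qed

lemma sZ2_group: "comm_group ((sC2 S M)\<lparr>carrier := sZ2 S M act\<rparr>)"
  by (rule comm_group.subgroup_comm_group[OF sC2_group sZ2_subgroup])

lemma pull_closed:
  assumes "c \<in> xZ2 V M act"
  shows "pull c \<in> sZ2 S M act"
proof -
  have c: "c \<in> carrier (xC2 V M)" using assms by (simp add: xZ2_def)
  have "pull c \<in> carrier (sC2 S M)"
    using T.xC2_closed[OF c] by (auto simp: sC2_eq pull_def fun_group_carrier cls_closed section_NN xG_T1)
  moreover have "sd2 S M act (pull c) (g2,g1,g0) = \<one>\<^bsub>M\<^esub>"
    if "g2 \<in> carrier G2" "g1 \<in> carrier G1" "g0 \<in> carrier G0" for g2 g1 g0
    unfolding sd2_pull[OF that]
    using assms[unfolded T.xZ2_iff] that by (simp add: cls_closed section_NN xG_T1 del: low_dim_identities)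
  ultimately show ?thesis by (simp add: sZ2_iff)
qed

lemma pull_hom: "pull \<in> hom ((xC2 V M)\<lparr>carrier := xZ2 V M act\<rparr>) ((sC2 S M)\<lparr>carrier := sZ2 S M act\<rparr>)"
proof (rule homI)
  fix c c'
  have "pull (c \<otimes>\<^bsub>xC2 V M\<^esub> c') = pull c \<otimes>\<^bsub>sC2 S M\<^esub> pull c'"
    by (auto simp: pull_def fun_eq_iff xC2_def sC2_eq fun_group_mult cls_closed section_NN xG_T1)
  then show "pull (c \<otimes>\<^bsub>(xC2 V M)\<lparr>carrier := xZ2 V M act\<rparr>\<^esub> c')
      = pull c \<otimes>\<^bsub>(sC2 S M)\<lparr>carrier := sZ2 S M act\<rparr>\<^esub> pull c'"
    by simp
qed (simp add: pull_closed)

lemma pull_apply: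
  "x \<in> NN \<Longrightarrow> h \<in> carrier G0 \<Longrightarrow> g \<in> carrier G0 \<Longrightarrow> pull c (x \<cdot> t h, g) = c (cls x, h, g)"
  by (simp add: pull_def NN_closed a1_NN G1.m_assoc)

lemma pull_inj:
  assumes "c \<in> carrier (xC2 V M)" "c' \<in> carrier (xC2 V M)" "pull c = pull c'"
  shows "c = c'"
proof (rule extensionalityI[of _ T.S2])
  fix x assume "x \<in> T.S2"
  then obtain m h g where "x = (cls m,h,g)" "m \<in> NN" "h \<in> carrier G0" "g \<in> carrier G0"
    by (auto simp: carrier_xM_T1 xG_T1)
  then show "c x = c' x" using assms(3) pull_apply[of m h g c] pull_apply[of m h g c'] by simp
qed (use assms(1,2) in \<open>auto simp: xC2_def fun_group_carrier PiE_iff\<close>)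

text \<open>An element of \<open>N2\<close> in the cocycle identity gives constancy on
  \<open>K\<close>. The degenerate element \<open>u1 y\<close> then transports this: its identities
  with middle argument x in \<open>K\<close> and with middle argument 1 differ only in c(yx,g)
  against c(y,g).\<close>

lemma sZ2_K_invariant:
  assumes c: "c \<in> sZ2 S M act" and k: "k \<in> K" and [simp]: "y \<in> carrier G1" "g \<in> carrier G0"
  shows "c (k \<cdot> y, g) = c (y, g)"
proof -
  have "c \<in> carrier (sC2 S M)" using c by (simp add: sZ2_def)
  note [simp] = sC2_closed[OF this] scls_closed
  have cocyc: "c (e0 g2, a0 g1) \<otimes>\<^bsub>M\<^esub> c (e2 g2 \<cdot> g1, g0)
      = c (e1 g2, a1 g1 \<otimes>\<^bsub>G0\<^esub> g0) \<otimes>\<^bsub>M\<^esub> act (xcls V (a1 (e2 g2))) (c (g1,g0))"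
    if [simp]: "g2 \<in> carrier G2" "g1 \<in> carrier G1" "g0 \<in> carrier G0" for g2 g1 g0
  proof -
    have "sd2 S M act c (g2,g1,g0) = \<one>\<^bsub>M\<^esub>" using c that by (simp add: sZ2_iff)
    then show ?thesis
      unfolding sd2_eq[OF that] by (rule T.M.A.alternating4_eq_oneD) auto
  qed
  have const: "c (x, h) = c (\<one>\<^bsub>G1\<^esub>, h)" if x: "x \<in> K" and [simp]: "h \<in> carrier G0" for x h
  proof -
    obtain w where w [simp]: "w \<in> carrier G2" "e1 w = \<one>\<^bsub>G1\<^esub>" "e2 w = \<one>\<^bsub>G1\<^esub>" "x = e0 w"
      using x by (auto simp: K_eq N2_iff)
    have "xcls V \<one>\<^bsub>G0\<^esub> = \<one>\<^bsub>xpi0 V\<^esub>" using T.cl_one by (simp add: xG_T1)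
    then show ?thesis
      using cocyc[of w "t h" "\<one>\<^bsub>G0\<^esub>"] by (simp add: T.M.act_id)
  qed
  \<comment> \<open>The comparison yields invariance under right multiplication by \<open>K\<close>;
    normality converts it to left multiplication.\<close>
  define x where "x = inv\<^bsub>G1\<^esub> y \<cdot> k \<cdot> y"
  have x: "x \<in> K" "x \<in> carrier G1" unfolding x_def using k K.inv_op_closed1 K_closed by auto
  have "c (t (a0 y), \<one>\<^bsub>G0\<^esub>) \<otimes>\<^bsub>M\<^esub> c (y \<cdot> x, g) = c (t (a0 y), \<one>\<^bsub>G0\<^esub>) \<otimes>\<^bsub>M\<^esub> c (y, g)"
    using cocyc[of "u1 y" x g] cocyc[of "u1 y" "\<one>\<^bsub>G1\<^esub>" g] const[of x g] x
    by (simp add: a0_K a1_K)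
  then have "c (y \<cdot> x, g) = c (y, g)" using x by simp
  moreover have "y \<cdot> x = k \<cdot> y" using k K_closed by (simp add: x_def G1.m_assoc G1.cancel_inv_left)
  ultimately show ?thesis by simp
qed

text \<open>By invariance under \<open>K\<close>, the representative picked in \<open>c'\<close> is
  immaterial. The cocycle identity transfers back because every argument of \<open>xd2\<close>
  arises from an argument of \<open>sd2\<close>.\<close>

lemma pull_onto:
  assumes c: "c \<in> sZ2 S M act"
  shows "\<exists>c'\<in>xZ2 V M act. pull c' = c"
proof -
  have cC: "c \<in> carrier (sC2 S M)" using c by (simp add: sZ2_def)
  define c' where "c' = (\<lambda>(C,h,g)\<in>T.S2. c ((SOME x. x \<in> C) \<cdot> t h, g))"
  have c'_eq: "c' (cls x, h, g) = c (x \<cdot> t h, g)" if "x \<in> NN" "h \<in> carrier G0" "g \<in> carrier G0" for x h g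
  proof -
    obtain k where "k \<in> K" "(SOME y. y \<in> cls x) = k \<cdot> x" by (rule some_cls)
    then show ?thesis
      using that sZ2_K_invariant[OF c \<open>k \<in> K\<close>, of "x \<cdot> t h" g]
      by (simp add: c'_def cls_closed xG_T1 G1.m_assoc NN_closed K_closed)
  qed
  have pull: "pull c' = c"
  proof (rule extensionalityI[of _ D2])
    fix x assume "x \<in> D2"
    then show "pull c' x = c x"
      by (auto simp: pull_def c'_eq section_NN G1.m_assoc)
  qed (use cC in \<open>auto simp: pull_def sC2_eq fun_group_carrier PiE_iff\<close>)
  have "c' \<in> carrier (xC2 V M)"
    unfolding xC2_def fun_group_carrier
  proof (rule PiE_I)
    show "c' x \<in> carrier M" if "x \<in> T.S2" for x
      using that by (auto simp: carrier_xM_T1 xG_T1 c'_eq NN_closed sC2_closed[OF cC])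
  qed (simp add: c'_def)
  moreover have "xd2 V M act c' (P,N,k,m,h,g) = \<one>\<^bsub>M\<^esub>"
    if PN: "P \<in> carrier (xM V)" "N \<in> carrier (xM V)" "k \<in> carrier (xG V)" "m \<in> carrier (xM V)"
      "h \<in> carrier (xG V)" "g \<in> carrier (xG V)" for P N k m h g
  proof -
    obtain p' n' m' where NN: "p' \<in> NN" "n' \<in> NN" "m' \<in> NN" and eq: "P = cls p'" "N = cls n'" "m = cls m'"
      using PN by (auto simp: carrier_xM_T1)
    have [simp]: "p' \<in> carrier G1" "n' \<in> carrier G1" "m' \<in> carrier G1"
      "a1 p' = \<one>\<^bsub>G0\<^esub>" "a1 n' = \<one>\<^bsub>G0\<^esub>" "a1 m' = \<one>\<^bsub>G0\<^esub>"
      "k \<in> carrier G0" "h \<in> carrier G0" "g \<in> carrier G0"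
      using NN PN by (auto simp: NN_closed a1_NN xG_T1)
    \<comment> \<open>An element of \<open>G2\<close> with prescribed coordinates: its faces are p'
      t(a0(n') k), p' n' t(k) and n' t(k).\<close>
    let ?g2 = "u0 p' \<otimes>\<^bsub>G2\<^esub> u1 (n' \<cdot> t k)" and ?g1 = "m' \<cdot> t h"
    have "sd2 S M act (pull c') (?g2, ?g1, g) = \<one>\<^bsub>M\<^esub>"
      using c by (simp add: pull sZ2_iff)
    then show ?thesis
      by (subst (asm) sd2_pull) (simp_all add: eq G1.m_assoc)
  qed
  ultimately have "c' \<in> xZ2 V M act" by (simp add: T.xZ2_iff)
  then show ?thesis using pull by blast
qed

lemma sC1_eq: "carrier (sC1 S M) = carrier (xC1 V M)"
  by (simp add: sC1_def xC1_def xG_T1 low_dim)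

lemma sB2_eq: "sB2 S M act = pull ` xB2 V M act"
  by (simp add: sB2_def xB2_def sC1_eq image_image sd1_pull)

lemma sH2_iso: "sH2 S M act \<cong> xH2 V M act"
  unfolding sH2_def xH2_def
proof (rule quotient_isoI[OF T.xZ2_group sZ2_group _ pull_hom])
  let ?A = "(xC2 V M)\<lparr>carrier := xZ2 V M act\<rparr>" and ?B = "(sC2 S M)\<lparr>carrier := sZ2 S M act\<rparr>"
  interpret A: comm_group ?A by (rule T.xZ2_group)
  interpret B: comm_group ?B by (rule sZ2_group)
  interpret pull: group_hom ?A ?B pull
    by (simp add: group_hom_def group_hom_axioms_def pull_hom)
  show sub: "subgroup (sB2 S M act) ?B"
    unfolding sB2_eq using T.xB2_subgroup by (rule pull.subgroup_img_is_subgroup)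
  have xB2: "xB2 V M act \<subseteq> xZ2 V M act" using subgroup.subset[OF T.xB2_subgroup] by simp
  show "xB2 V M act = {c \<in> carrier ?A. pull c \<in> sB2 S M act}"
    using xB2 pull_inj by (auto simp: sB2_eq xZ2_def)
  show "\<exists>c\<in>carrier ?A. \<exists>b\<in>sB2 S M act. f = b \<otimes>\<^bsub>?B\<^esub> pull c" if f: "f \<in> carrier ?B" for f
  proof -
    obtain c where "c \<in> carrier ?A" "f = pull c" using pull_onto f by auto
    moreover have "pull c = \<one>\<^bsub>?B\<^esub> \<otimes>\<^bsub>?B\<^esub> pull c" using B.l_one calculation f by metis
    ultimately show ?thesis using subgroup.one_closed[OF sub] by blast
  qed
qed

end

lemma simplicial_group_H2_iso:
  assumes "simplicial_group S" "is_module (spi0 S) M act"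
    and "z \<in> Z3cpt (spi0 S) (spi1 S) (spi1_act S)"
    and "H3cpt_class (spi0 S) (spi1 S) (spi1_act S) z = k3 (T1 S)"
  shows "sH2 S M act \<cong> H2_triple (spi0 S) (spi1 S) (spi1_act S) z M act"
proof -
  interpret simplicial_coeff S M act
    using assms(1,2) by (simp add: simplicial_coeff_def simplicial_def simplicial_coeff_axioms_def)
  have "xH2 (T1 S) M act \<cong> H2_triple (spi0 S) (spi1 S) (spi1_act S) z M act"
    using crossed_module_H2_iso[OF crossed_module_T1, of M act z] assms(2-4)
    by (simp add: xpi0_T1 xpi1_T1 xpi1_act_T1)
  then show ?thesis using sH2_iso iso_trans by blast
qed

theorem theorem5p4:
  shows
  "(\<forall>(V :: ('g,'m) xmod) (M :: 'a monoid) actM z.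
      crossed_module V \<and> is_module (xpi0 V) M actM
      \<and> z \<in> Z3cpt (xpi0 V) (xpi1 V) (xpi1_act V)
      \<and> H3cpt_class (xpi0 V) (xpi1 V) (xpi1_act V) z = k3 V
      \<longrightarrow> xH2 V M actM \<cong> H2_triple (xpi0 V) (xpi1 V) (xpi1_act V) z M actM)
   \<and>
   (\<forall>(G :: 'h sgroup) (M :: 'b monoid) actM z.
      simplicial_group G \<and> is_module (spi0 G) M actM
      \<and> z \<in> Z3cpt (spi0 G) (spi1 G) (spi1_act G)
      \<and> H3cpt_class (spi0 G) (spi1 G) (spi1_act G) z = k3 (T1 G)
      \<longrightarrow> sH2 G M actM \<cong> H2_triple (spi0 G) (spi1 G) (spi1_act G) z M actM)"
  using crossed_module_H2_iso simplicial_group_H2_iso by blast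

end
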